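(* Let $M$ be an oriented maximal surface in the Minkowski space $\mathbb E^4_1$. Then $M$ has pointwise 1-type Gauss map of the first kind if and only if $M$ has flat normal bundle. Moreover, in that case the Gauss map $\nu$ satisfies $\Delta\nu=f(\nu+C)$ for $f=\|h\|^2$ and $C=0$.
   Context: $\mathbb E^4_1$ is $\mathbb R^4$ with the metric $-dx_1^2+dx_2^2+dx_3^2+dx_4^2$. A surface $M$ is space-like if every nonzero tangent vector $v$ satisfies $\langle v,v\rangle>0$. The second fundamental form $h$ and normal connection $D$ are defined by $\widetilde\nabla_XY=\nabla_XY+h(X,Y)$ and $\widetilde\nabla_X\xi=-A_\xi(X)+D_X\xi$, for $X,Y$ tangent and $\xi$ normal. Let $\{e_1,e_2,e_3,e_4\}$ be an oriented local orthonormal frame with $e_1,e_2$ tangent and $e_3,e_4$ normal to $M$, $\varepsilon_\beta=\langle e_\beta,e_\beta\rangle$, $h^\beta_{ij}=\langle h(e_i,e_j),e_\beta\rangle$. Then $H=\frac12(h(e_1,e_1)+h(e_2,e_2))$ and $\|h\|^2=\sum_{i,j=1}^2\sum_{\beta=3}^4\varepsilon_\beta (h^\beta_{ij})^2$. A maximal surface is a space-like surface with $H=0$ identically. $M$ has flat normal bundle if the curvature tensor $R^D$ of $D$ vanishes identically. The Gauss map is $\nu=e_3\wedge e_4:M\to\bigwedge^2\mathbb E^4_1$, with $\bigwedge^2\mathbb E^4_1$ identified with a pseudo-Euclidean space via $\langle f_1\wedge f_2,g_1\wedge g_2\rangle=\det(\langle f_i,g_j\rangle)$. The Laplacian $\Delta=\sum_{i=1}^2(\nabla_{e_i}e_i-e_ie_i)$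 of $M$ acts componentwise on $\nu$. $M$ has pointwise 1-type Gauss map if $\Delta\nu=f(\nu+C)$ for some smooth function $f$ on $M$ and some constant vector $C$; it is of the first kind if this holds with $C=0$, i.e. $\Delta\nu=f\nu$ (the case $f=0$ is allowed). *)

theory Defs
  imports "HOL-Analysis.Analysis"
begin

section \<open>Smooth maps between open subsets of normed spaces\<close>

primrec Ck_on :: "nat \<Rightarrow> 'a::real_normed_vector set \<Rightarrow> ('a \<Rightarrow> 'b::real_normed_vector) \<Rightarrow> bool" where
  "Ck_on 0 U f \<longleftrightarrow> continuous_on U f"
| "Ck_on (Suc k) U f \<longleftrightarrow>
     (\<forall>x\<in>U. f differentiable (at x)) \<and> (\<forall>v. Ck_on k U (\<lambda>x. frechet_derivative f (at x) v))"

(* Meant for open U: the derivatives are two-sided. *)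
definition smooth_on :: "'a::real_normed_vector set \<Rightarrow> ('a \<Rightarrow> 'b::real_normed_vector) \<Rightarrow> bool" where
  "smooth_on U f \<longleftrightarrow> (\<forall>k. Ck_on k U f)"


section \<open>The Minkowski space and its bivectors\<close>

definition mink :: "real^4 \<Rightarrow> real^4 \<Rightarrow> real" where
  "mink v w = - (v$1 * w$1) + v$2 * w$2 + v$3 * w$3 + v$4 * w$4"

(* The second exterior power of R^4 is realised as the space of skew-symmetric
   4 x 4 matrices; the six entries above the diagonal are the coordinates with respect
   to the basis of the wedge products of the standard basis vectors. *)
definition bivectors :: "(real^4^4) set" where
  "bivectors = {B. transpose B = - B}"

definition wedge :: "real^4 \<Rightarrow> real^4 \<Rightarrow> real^4^4" where
  "wedge v w = (\<chi> i j. v$i * w$j - v$j * w$i)"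


section \<open>Oriented surfaces immersed in the Minkowski space\<close>

(* An abstract 2-manifold with an atlas of local parametrisations (U, p), where p maps the
   open set U of R^2 onto an open set of the manifold, together with a map to R^4. *)
record 'm surface =
  surf_top :: "'m topology"
  atlas :: "((real^2) set \<times> (real^2 \<Rightarrow> 'm)) set"
  immersion :: "'m \<Rightarrow> real^4"

abbreviation points :: "'m surface \<Rightarrow> 'm set" where
  "points S \<equiv> topspace (surf_top S)"

definition oriented_manifold :: "'m surface \<Rightarrow> bool" where
  "oriented_manifold S \<longleftrightarrow>
     Hausdorff_space (surf_top S) \<and> second_countable (surf_top S) \<and>
     points S = (\<Union>(U, p)\<in>atlas S. p ` U) \<and>
     (\<forall>(U, p)\<in>atlas S. open U \<and> openin (surf_top S) (p ` U) \<and>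
        homeomorphic_map (top_of_set U) (subtopology (surf_top S) (p ` U)) p) \<and>
     (\<forall>(U, p)\<in>atlas S. \<forall>(V, q)\<in>atlas S.
        smooth_on {u \<in> U. p u \<in> q ` V} (inv_into V q \<circ> p) \<and>
        (\<forall>u\<in>{u \<in> U. p u \<in> q ` V}. det (jacobian (inv_into V q \<circ> p) (at u)) > 0))"

definition oriented_surface :: "'m surface \<Rightarrow> bool" where
  "oriented_surface S \<longleftrightarrow> oriented_manifold S \<and>
     (\<forall>(U, p)\<in>atlas S. smooth_on U (immersion S \<circ> p) \<and>
        (\<forall>u\<in>U. inj (frechet_derivative (immersion S \<circ> p) (at u))))"

(* W is meant to be open in the surface. *)
definition smooth_map_on :: "'m surface \<Rightarrow> 'm set \<Rightarrow> ('m \<Rightarrow> 'b::real_normed_vector) \<Rightarrow> bool" where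
  "smooth_map_on S W F \<longleftrightarrow> (\<forall>(U, p)\<in>atlas S. smooth_on {u \<in> U. p u \<in> W} (F \<circ> p))"


subsection \<open>Tangent and normal vectors\<close>

definition chart_at :: "'m surface \<Rightarrow> 'm \<Rightarrow> (real^2) set \<times> (real^2 \<Rightarrow> 'm)" where
  "chart_at S x = (SOME c. c \<in> atlas S \<and> x \<in> snd c ` fst c)"

(* The differential at x of a map on the surface, read in the chosen chart. *)
definition diff_at :: "'m surface \<Rightarrow> ('m \<Rightarrow> 'b::real_normed_vector) \<Rightarrow> 'm \<Rightarrow> real^2 \<Rightarrow> 'b" where
  "diff_at S F x = (let (U, p) = chart_at S x in frechet_derivative (F \<circ> p) (at (inv_into U p x)))"

(* Tangent vectors of the surface are identified with their images in R^4 under the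
   differential of the immersion. *)
definition tangent_space :: "'m surface \<Rightarrow> 'm \<Rightarrow> (real^4) set" where
  "tangent_space S x = range (diff_at S (immersion S) x)"

definition normal_space :: "'m surface \<Rightarrow> 'm \<Rightarrow> (real^4) set" where
  "normal_space S x = {n. \<forall>w\<in>tangent_space S x. mink n w = 0}"

definition tangent_coords :: "'m surface \<Rightarrow> 'm \<Rightarrow> real^4 \<Rightarrow> real^2" where
  "tangent_coords S x = inv (diff_at S (immersion S) x)"

(* For w in tangent_space S x, the derivative of F at x in direction w; by the chain rule
   it does not depend on the chart chosen at x. For a vector field F along the surface,
   with values in R^4, this is the flat ambient connection. *)
definition deriv_along :: "'m surface \<Rightarrow> ('m \<Rightarrow> 'b::real_normed_vector) \<Rightarrow> 'm \<Rightarrow> real^4 \<Rightarrow> 'b" where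
  "deriv_along S F x w = diff_at S F x (tangent_coords S x w)"

definition spacelike :: "'m surface \<Rightarrow> bool" where
  "spacelike S \<longleftrightarrow> (\<forall>x\<in>points S. \<forall>v\<in>tangent_space S x. v \<noteq> 0 \<longrightarrow> mink v v > 0)"

definition tan_part :: "'m surface \<Rightarrow> 'm \<Rightarrow> real^4 \<Rightarrow> real^4" where
  "tan_part S x w = (THE t. t \<in> tangent_space S x \<and> w - t \<in> normal_space S x)"

definition nor_part :: "'m surface \<Rightarrow> 'm \<Rightarrow> real^4 \<Rightarrow> real^4" where
  "nor_part S x w = w - tan_part S x w"

definition tangent_field_on :: "'m surface \<Rightarrow> 'm set \<Rightarrow> ('m \<Rightarrow> real^4) \<Rightarrow> bool" where
  "tangent_field_on S W X \<longleftrightarrow> smooth_map_on S W X \<and> (\<forall>x\<in>W. X x \<in> tangent_space S x)"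

definition normal_field_on :: "'m surface \<Rightarrow> 'm set \<Rightarrow> ('m \<Rightarrow> real^4) \<Rightarrow> bool" where
  "normal_field_on S W \<xi> \<longleftrightarrow> smooth_map_on S W \<xi> \<and> (\<forall>x\<in>W. \<xi> x \<in> normal_space S x)"


subsection \<open>Gauss and Weingarten formulas\<close>

definition levi_civita :: "'m surface \<Rightarrow> ('m \<Rightarrow> real^4) \<Rightarrow> ('m \<Rightarrow> real^4) \<Rightarrow> 'm \<Rightarrow> real^4" where
  "levi_civita S X Y x = tan_part S x (deriv_along S Y x (X x))"

definition second_ff :: "'m surface \<Rightarrow> ('m \<Rightarrow> real^4) \<Rightarrow> ('m \<Rightarrow> real^4) \<Rightarrow> 'm \<Rightarrow> real^4" where
  "second_ff S X Y x = nor_part S x (deriv_along S Y x (X x))"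

definition normal_connection ::
    "'m surface \<Rightarrow> ('m \<Rightarrow> real^4) \<Rightarrow> ('m \<Rightarrow> real^4) \<Rightarrow> 'm \<Rightarrow> real^4" where
  "normal_connection S X \<xi> x = nor_part S x (deriv_along S \<xi> x (X x))"

(* Since X is the derivative of the immersion along X, this is the commutator of the
   derivations X and Y applied to the components of the immersion, that is, the image in
   R^4 of the usual Lie bracket. *)
definition lie_bracket :: "'m surface \<Rightarrow> ('m \<Rightarrow> real^4) \<Rightarrow> ('m \<Rightarrow> real^4) \<Rightarrow> 'm \<Rightarrow> real^4" where
  "lie_bracket S X Y x = deriv_along S Y x (X x) - deriv_along S X x (Y x)"

definition normal_curvature ::
    "'m surface \<Rightarrow> ('m \<Rightarrow> real^4) \<Rightarrow> ('m \<Rightarrow> real^4) \<Rightarrow> ('m \<Rightarrow> real^4) \<Rightarrow> 'm \<Rightarrow> real^4" where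
  "normal_curvature S X Y \<xi> x =
     normal_connection S X (normal_connection S Y \<xi>) x
     - normal_connection S Y (normal_connection S X \<xi>) x
     - normal_connection S (lie_bracket S X Y) \<xi> x"

definition flat_normal_bundle :: "'m surface \<Rightarrow> bool" where
  "flat_normal_bundle S \<longleftrightarrow>
     (\<forall>W X Y \<xi>. openin (surf_top S) W \<longrightarrow> tangent_field_on S W X \<longrightarrow> tangent_field_on S W Y \<longrightarrow>
        normal_field_on S W \<xi> \<longrightarrow> (\<forall>x\<in>W. normal_curvature S X Y \<xi> x = 0))"


subsection \<open>Local orthonormal frames\<close>

(* The pair e 1, e 2 is positive for the orientation of the surface and the whole frame is
   positive for the standard orientation of R^4. Either of e 3 and e 4 may be the
   time-like vector. *)
definition oriented_frame_on :: "'m surface \<Rightarrow> 'm set \<Rightarrow> (4 \<Rightarrow> 'm \<Rightarrow> real^4) \<Rightarrow> bool" where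
  "oriented_frame_on S W e \<longleftrightarrow>
     tangent_field_on S W (e 1) \<and> tangent_field_on S W (e 2) \<and>
     normal_field_on S W (e 3) \<and> normal_field_on S W (e 4) \<and>
     (\<forall>x\<in>W.
        (\<forall>a b. a \<noteq> b \<longrightarrow> mink (e a x) (e b x) = 0) \<and>
        (\<forall>a. \<bar>mink (e a x) (e a x)\<bar> = 1) \<and>
        det (vector [tangent_coords S x (e 1 x), tangent_coords S x (e 2 x)] :: real^2^2) > 0 \<and>
        det (\<chi> a. e a x) > 0)"

(* The quantities defined below from this frame do not depend on the choice. *)
definition frame_at :: "'m surface \<Rightarrow> 'm \<Rightarrow> 4 \<Rightarrow> 'm \<Rightarrow> real^4" where
  "frame_at S x = (SOME e. \<exists>W. openin (surf_top S) W \<and> x \<in> W \<and> oriented_frame_on S W e)"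

definition mean_curvature_vector :: "'m surface \<Rightarrow> 'm \<Rightarrow> real^4" where
  "mean_curvature_vector S x = (let e = frame_at S x in
     (1/2) *\<^sub>R (second_ff S (e 1) (e 1) x + second_ff S (e 2) (e 2) x))"

definition norm_h_sq :: "'m surface \<Rightarrow> 'm \<Rightarrow> real" where
  "norm_h_sq S x = (let e = frame_at S x in
     \<Sum>i\<in>{1,2}. \<Sum>j\<in>{1,2}. \<Sum>b\<in>{3,4}.
       mink (e b x) (e b x) * (mink (second_ff S (e i) (e j) x) (e b x))\<^sup>2)"

definition gauss_map :: "'m surface \<Rightarrow> 'm \<Rightarrow> real^4^4" where
  "gauss_map S x = (let e = frame_at S x in wedge (e 3 x) (e 4 x))"

definition laplacian :: "'m surface \<Rightarrow> ('m \<Rightarrow> 'b::real_normed_vector) \<Rightarrow> 'm \<Rightarrow> 'b" where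
  "laplacian S F x = (let e = frame_at S x in
     \<Sum>i\<in>{1,2}. (deriv_along S F x (levi_civita S (e i) (e i) x)
               - deriv_along S (\<lambda>y. deriv_along S F y (e i y)) x (e i x)))"

definition maximal_surface :: "'m surface \<Rightarrow> bool" where
  "maximal_surface S \<longleftrightarrow>
     oriented_surface S \<and> spacelike S \<and> (\<forall>x\<in>points S. mean_curvature_vector S x = 0)"


subsection \<open>Pointwise 1-type Gauss map\<close>

definition pointwise_1type_with :: "'m surface \<Rightarrow> ('m \<Rightarrow> real) \<Rightarrow> real^4^4 \<Rightarrow> bool" where
  "pointwise_1type_with S f C \<longleftrightarrow>
     smooth_map_on S (points S) f \<and> C \<in> bivectors \<and>
     (\<forall>x\<in>points S. laplacian S (gauss_map S) x = f x *\<^sub>R (gauss_map S x + C))"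

definition pointwise_1type_first_kind :: "'m surface \<Rightarrow> bool" where
  "pointwise_1type_first_kind S \<longleftrightarrow> (\<exists>f. pointwise_1type_with S f 0)"

end

theory Submission
  imports Defs
begin

text \<open>
  In a chart let \<open>a\<close>, \<open>b\<close> be constant directions that are orthonormal for the induced metric at a
  point, and let \<open>II\<close> be the second fundamental form. The plane field is the unit bivector
  \<open>\<mu> = \<phi>\<^sub>a \<and> \<phi>\<^sub>b / sqrt (det g)\<close>, and the Gauss map is its Hodge dual, so both have the same Laplacian
  up to this linear isomorphism. If the mean curvature vanishes, then \<open>\<Delta>F\<close> is the first derivative of
  \<open>F\<close> along the tangential part of \<open>\<phi>\<^sub>a\<^sub>a + \<phi>\<^sub>b\<^sub>b\<close> minus \<open>F\<^sub>a\<^sub>a + F\<^sub>b\<^sub>b\<close>; in particular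
  no derivative of the frame enters. Differentiating the identity "\<open>g\<^sub>b\<^sub>b \<phi>\<^sub>a\<^sub>a - 2 g\<^sub>a\<^sub>b \<phi>\<^sub>a\<^sub>b + g\<^sub>a\<^sub>a \<phi>\<^sub>b\<^sub>b\<close>
  is tangent" determines the normal part of the third derivatives (this replaces the Codazzi equation)
  and yields \<open>\<Delta>\<mu> = \<parallel>h\<parallel>\<^sup>2 \<mu> - 4 II(a,a) \<and> II(a,b)\<close>, where the coefficient of \<open>\<mu>\<close> comes from
  \<open>\<langle>\<mu>, \<mu>\<rangle> = 1\<close>. On the other hand \<open>R\<^sup>D(a,b)\<xi>\<close> is twice the contraction of \<open>II(a,a) \<and> II(a,b)\<close>
  with \<open>\<xi>\<close>. Hence both conditions of the theorem say that \<open>II(a,a) \<and> II(a,b) = 0\<close> everywhere.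
\<close>

section \<open>Calculus of smooth maps\<close>

text \<open>Constant directions \<open>a\<close>, \<open>b\<close> spare isothermal coordinates and
  the differentiation of an orthonormal frame, but they are orthonormal at one point only. So the
  metric coefficients have nonzero derivatives there: \<open>mu\<close> carries the factor
  \<open>1 / sqrt (gram a b u)\<close>, and vanishing mean curvature is put in a cofactor form that
  holds for all directions and may be differentiated. In the Laplacian of \<open>mu\<close> the
  mixed tangent-normal bivectors cancel by the formula for the third derivatives; tangential terms
  only alter the coefficient of \<open>mu\<close> and are never evaluated. The constant 4 comes from
  the cross term of the second-order product rule, twice the sum of
  \<open>wedge (hess a a u) (hess a b u)\<close> and \<open>wedge (hess a b u) (hess b b u)\<close>:
  as II(b,b) = - II(a,a), both have the same normal-normal part. In an equation with eigenvalue f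
  the two summands separate, one being a bivector of the tangent plane and the other of the normal
  plane, so f has to be the squared norm of h. Charts and frames are picked by \<open>SOME\<close>,
  so smoothness of the Gauss map and of that norm is read off frame-free chart expressions.\<close>

definition dir :: "'a::real_normed_vector \<Rightarrow> ('a \<Rightarrow> 'b::real_normed_vector) \<Rightarrow> 'a \<Rightarrow> 'b" where
  "dir v f = (\<lambda>x. frechet_derivative f (at x) v)"

lemma has_derivative_dir: "f differentiable at x \<Longrightarrow> (f has_derivative (\<lambda>v. dir v f x)) (at x)"
  unfolding dir_def frechet_derivative_works by (simp add: eta_contract_eq)

lemma dir_eqI: "(f has_derivative f') (at x) \<Longrightarrow> dir v f x = f' v"
  unfolding dir_def using frechet_derivative_at by metis

lemma linear_dir: "f differentiable at x \<Longrightarrow> linear (\<lambda>v. dir v f x)"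
  using has_derivative_dir has_derivative_linear by blast

text \<open>With the direction as first argument, \<open>dir v f\<close> is again a map of the point
  and can be iterated. This form replaces the defining equation as simplification rule, so that
  induction hypotheses apply to \<open>dir v f\<close>.\<close>

lemma Ck_on_Suc_dir:
  "Ck_on (Suc k) U f \<longleftrightarrow> (\<forall>x\<in>U. f differentiable at x) \<and> (\<forall>v. Ck_on k U (dir v f))"
  by (simp add: dir_def)

declare Ck_on.simps(2)[simp del] Ck_on_Suc_dir[simp]

lemma differentiable_cong_open:
  assumes "open U" "x \<in> U" "\<And>y. y \<in> U \<Longrightarrow> f y = g y" "f differentiable at x"
  shows "g differentiable at x"
  using assms has_derivative_transform_within_open unfolding differentiable_def by metis

lemma dir_cong_open:
  assumes "open U" "x \<in> U" "\<And>y. y \<in> U \<Longrightarrow> f y = g y" "f differentiable at x"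
  shows "dir v f x = dir v g x"
  using frechet_derivative_transform_within_open[OF assms(4,1,2,3)] by (simp add: dir_def)

lemma Ck_on_cong:
  assumes "open U" "\<And>x. x \<in> U \<Longrightarrow> f x = g x" "Ck_on k U f"
  shows "Ck_on k U g"
  using assms(2,3)
proof (induction k arbitrary: f g)
  case 0
  then show ?case using continuous_on_cong[of U U f g] by simp
next
  case (Suc k)
  then have d: "\<And>x. x \<in> U \<Longrightarrow> f differentiable at x" by simp
  have "Ck_on k U (dir v g)" for v
    by (rule Suc.IH[of "dir v f"])
      (use dir_cong_open[OF assms(1) _ _ d] Suc.prems in \<open>auto simp: Ck_on_Suc_dir\<close>)
  then show ?case
    unfolding Ck_on_Suc_dir using differentiable_cong_open[OF assms(1) _ _ d] Suc.prems by metis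
qed

lemma Ck_on_SucD: "Ck_on (Suc k) U f \<Longrightarrow> Ck_on k U f"
proof (induction k arbitrary: f)
  case 0
  then show ?case
    by (auto intro!: continuous_at_imp_continuous_on differentiable_imp_continuous_within)
next
  case (Suc k)
  then show ?case by (metis Ck_on_Suc_dir)
qed

lemma Ck_on_subset: "Ck_on k U f \<Longrightarrow> V \<subseteq> U \<Longrightarrow> Ck_on k V f"
  by (induction k arbitrary: f) (auto intro: continuous_on_subset)

lemma dir_const: "dir v (\<lambda>x. c) x = 0"
  by (simp add: dir_def)

lemma Ck_on_const: "Ck_on k U (\<lambda>x. c)"
  by (induction k arbitrary: c) (auto simp: dir_const[abs_def])

lemma Ck_on_add:
  assumes "open U" "Ck_on k U f" "Ck_on k U g"
  shows "Ck_on k U (\<lambda>x. f x + g x)"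
  using assms(2,3)
proof (induction k arbitrary: f g)
  case 0
  then show ?case by (auto intro: continuous_on_add)
next
  case (Suc k)
  have d: "((\<lambda>x. f x + g x) has_derivative (\<lambda>v. dir v f x + dir v g x)) (at x)" if "x \<in> U" for x
    using Suc.prems that by (auto intro!: has_derivative_add has_derivative_dir)
  have "Ck_on k U (dir v (\<lambda>x. f x + g x))" for v
    by (rule Ck_on_cong[OF assms(1) _ Suc.IH[of "dir v f" "dir v g"]])
      (use Suc.prems dir_eqI[OF d] in \<open>auto simp: Ck_on_Suc_dir\<close>)
  then show ?case using d by (auto simp: Ck_on_Suc_dir differentiable_def)
qed

lemma Ck_on_sum:
  assumes "open U" "\<And>i. i \<in> I \<Longrightarrow> Ck_on k U (f i)"
  shows "Ck_on k U (\<lambda>x. \<Sum>i\<in>I. f i x)"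
  using assms(2)
  by (induction I rule: infinite_finite_induct) (auto intro: Ck_on_const Ck_on_add[OF assms(1)])

lemma Ck_on_linear:
  assumes "open U" "bounded_linear L" "Ck_on k U f"
  shows "Ck_on k U (\<lambda>x. L (f x))"
  using assms(3)
proof (induction k arbitrary: f)
  case 0
  then show ?case by (auto intro: bounded_linear.continuous_on[OF assms(2)])
next
  case (Suc k)
  have d: "((\<lambda>x. L (f x)) has_derivative (\<lambda>v. L (dir v f x))) (at x)" if "x \<in> U" for x
    using Suc.prems that
    by (auto intro!: bounded_linear.has_derivative[OF assms(2)] has_derivative_dir)
  have "Ck_on k U (dir v (\<lambda>x. L (f x)))" for v
    by (rule Ck_on_cong[OF assms(1) _ Suc.IH[of "dir v f"]])
      (use Suc.prems dir_eqI[OF d] in \<open>auto simp: Ck_on_Suc_dir\<close>)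
  then show ?case using d by (auto simp: Ck_on_Suc_dir differentiable_def)
qed

lemma Ck_on_bilinear:
  assumes "open U" "bounded_bilinear B" "Ck_on k U f" "Ck_on k U g"
  shows "Ck_on k U (\<lambda>x. B (f x) (g x))"
  using assms(3,4)
proof (induction k arbitrary: f g)
  case 0
  then show ?case by (auto intro: bounded_bilinear.continuous_on[OF assms(2)])
next
  case (Suc k)
  have d: "((\<lambda>x. B (f x) (g x)) has_derivative (\<lambda>v. B (f x) (dir v g x) + B (dir v f x) (g x))) (at x)"
    if "x \<in> U" for x
    using Suc.prems that
    by (auto intro!: bounded_bilinear.FDERIV[OF assms(2)] has_derivative_dir)
  have "Ck_on k U (dir v (\<lambda>x. B (f x) (g x)))" for v
    by (rule Ck_on_cong[OF assms(1) _ Ck_on_add[OF assms(1) Suc.IH[of f "dir v g"] Suc.IH[of "dir v f" g]]])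
      (use Suc.prems Suc.prems[THEN Ck_on_SucD] dir_eqI[OF d] in auto)
  then show ?case using d by (auto simp: Ck_on_Suc_dir differentiable_def)
qed

lemma has_derivative_inverse_sqrt:
  fixes f :: "'a::real_normed_vector \<Rightarrow> real"
  assumes "f differentiable at x" "f x > 0"
  shows "((\<lambda>x. 1 / sqrt (f x)) has_derivative (\<lambda>v. - (1/2) * (1 / sqrt (f x))^3 * dir v f x)) (at x)"
proof -
  have "DERIV (\<lambda>t. 1 / sqrt t) (f x) :> - (1/2) * (1 / sqrt (f x))^3"
    using assms(2) by (auto intro!: derivative_eq_intros simp: field_simps power3_eq_cube)
  from DERIV_compose_FDERIV[OF this has_derivative_dir[OF assms(1)]]
  show ?thesis by (simp only: mult.commute)
qed

text \<open>The derivative is a polynomial in the function itself and in \<open>dir v f\<close>, so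
  the induction on the order feeds on its own conclusion one order lower.\<close>

lemma Ck_on_inverse_sqrt:
  fixes f :: "'a::real_normed_vector \<Rightarrow> real"
  assumes "open U" "Ck_on k U f" "\<And>x. x \<in> U \<Longrightarrow> f x > 0"
  shows "Ck_on k U (\<lambda>x. 1 / sqrt (f x))"
  using assms(2)
proof (induction k)
  case 0
  then show ?case using assms(3) by (force intro!: continuous_intros)
next
  case (Suc k)
  have d: "((\<lambda>x. 1 / sqrt (f x)) has_derivative (\<lambda>v. - (1/2) * (1 / sqrt (f x))^3 * dir v f x)) (at x)"
    if "x \<in> U" for x
    by (rule has_derivative_inverse_sqrt) (use Suc.prems that assms(3) in auto)
  have r: "Ck_on k U (\<lambda>x. 1 / sqrt (f x))" using Suc Ck_on_SucD by blast
  have m: "Ck_on k U (\<lambda>x. g x * h x)" if "Ck_on k U g" "Ck_on k U h" for g h :: "'a \<Rightarrow> real"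
    using Ck_on_bilinear[OF assms(1) bounded_bilinear_mult that] .
  have "Ck_on k U (dir v f)" for v using Suc.prems by (simp add: Ck_on_Suc_dir)
  then have "Ck_on k U (\<lambda>x. - (1/2) * (1 / sqrt (f x))^3 * dir v f x)" for v
    unfolding power3_eq_cube by (intro m r Ck_on_const)
  then have "Ck_on k U (dir v (\<lambda>x. 1 / sqrt (f x)))" for v
    by (rule Ck_on_cong[OF assms(1), rotated]) (use dir_eqI[OF d] in auto)
  then show ?case using d by (auto simp: Ck_on_Suc_dir differentiable_def)
qed

lemma linear_eq_sum_Basis:
  fixes L :: "'a::euclidean_space \<Rightarrow> 'b::real_vector"
  assumes "linear L"
  shows "L v = (\<Sum>i\<in>Basis. (v \<bullet> i) *\<^sub>R L i)"
proof -
  have "L v = L (\<Sum>i\<in>Basis. (v \<bullet> i) *\<^sub>R i)" by (simp add: euclidean_representation)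
  then show ?thesis by (simp add: linear_sum[OF assms] linear_scale[OF assms])
qed

lemma dir_compose:
  assumes "g differentiable at x" "f differentiable at (g x)"
  shows "dir v (\<lambda>x. f (g x)) x = dir (dir v g x) f (g x)"
  using frechet_derivative_compose[OF assms] by (simp add: dir_def o_def fun_eq_iff)

text \<open>The chain rule produces a derivative of \<open>f\<close> in a direction that moves with
  the point. Expanding this direction in \<open>Basis\<close> leaves derivatives in fixed
  directions, to which the induction hypothesis applies.\<close>

lemma Ck_on_compose:
  fixes g :: "'a::real_normed_vector \<Rightarrow> 'c::euclidean_space" and f :: "'c \<Rightarrow> 'b::real_normed_vector"
  assumes "open U" "open V" "\<And>x. x \<in> U \<Longrightarrow> g x \<in> V" "Ck_on k U g" "Ck_on k V f"
  shows "Ck_on k U (\<lambda>x. f (g x))"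
  using assms(4,5)
proof (induction k arbitrary: f)
  case 0
  then show ?case using assms(3)
    by (auto intro!: continuous_on_compose2[of V f U g])
next
  case (Suc k)
  have d: "g differentiable at x" "f differentiable at (g x)" if "x \<in> U" for x
    using that Suc.prems assms(3) by auto
  have e: "dir v (\<lambda>x. f (g x)) x = (\<Sum>i\<in>Basis. (dir v g x \<bullet> i) *\<^sub>R dir i f (g x))" if "x \<in> U" for v x
    using dir_compose[OF d[OF that]] linear_eq_sum_Basis[OF linear_dir[OF d(2)[OF that]]] by metis
  have g: "Ck_on k U g" using Suc.prems Ck_on_SucD by blast
  have "Ck_on k U (dir v (\<lambda>x. f (g x)))" for v
  proof (rule Ck_on_cong[OF assms(1) e[symmetric]])
    show "Ck_on k U (\<lambda>x. \<Sum>i\<in>Basis. (dir v g x \<bullet> i) *\<^sub>R dir i f (g x))"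
      by (intro Ck_on_sum Ck_on_bilinear[OF _ bounded_bilinear_scaleR]
          Ck_on_linear[OF _ bounded_linear_inner_left] Suc.IH g assms(1))
        (use Suc.prems in \<open>auto simp: Ck_on_Suc_dir\<close>)
  qed
  moreover have "(\<lambda>x. f (g x)) differentiable at x" if "x \<in> U" for x
    by (rule differentiable_compose[where f = f and g = g]) (use d[OF that] in auto)
  ultimately show ?case by auto
qed

lemma smooth_on_differentiable: "smooth_on U f \<Longrightarrow> x \<in> U \<Longrightarrow> f differentiable at x"
  by (metis smooth_on_def Ck_on_Suc_dir)

lemma smooth_on_dir: "smooth_on U f \<Longrightarrow> smooth_on U (dir v f)"
  by (metis smooth_on_def Ck_on_Suc_dir)

lemma smooth_on_subset: "smooth_on U f \<Longrightarrow> V \<subseteq> U \<Longrightarrow> smooth_on V f"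
  by (metis smooth_on_def Ck_on_subset)

lemma smooth_on_cong:
  "open U \<Longrightarrow> (\<And>x. x \<in> U \<Longrightarrow> f x = g x) \<Longrightarrow> smooth_on U f \<Longrightarrow> smooth_on U g"
  by (metis smooth_on_def Ck_on_cong)

lemma smooth_on_const: "smooth_on U (\<lambda>x. c)"
  by (simp add: smooth_on_def Ck_on_const)

lemma smooth_on_add:
  "open U \<Longrightarrow> smooth_on U f \<Longrightarrow> smooth_on U g \<Longrightarrow> smooth_on U (\<lambda>x. f x + g x)"
  by (simp add: smooth_on_def Ck_on_add)

lemma smooth_on_sum:
  "open U \<Longrightarrow> (\<And>i. i \<in> I \<Longrightarrow> smooth_on U (f i)) \<Longrightarrow> smooth_on U (\<lambda>x. \<Sum>i\<in>I. f i x)"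
  by (simp add: smooth_on_def Ck_on_sum)

lemma smooth_on_linear:
  "open U \<Longrightarrow> bounded_linear L \<Longrightarrow> smooth_on U f \<Longrightarrow> smooth_on U (\<lambda>x. L (f x))"
  by (simp add: smooth_on_def Ck_on_linear)

lemma smooth_on_bilinear:
  "open U \<Longrightarrow> bounded_bilinear B \<Longrightarrow> smooth_on U f \<Longrightarrow> smooth_on U g \<Longrightarrow> smooth_on U (\<lambda>x. B (f x) (g x))"
  by (simp add: smooth_on_def Ck_on_bilinear)

lemmas smooth_on_mult = smooth_on_bilinear[OF _ bounded_bilinear_mult]
  and smooth_on_scaleR = smooth_on_bilinear[OF _ bounded_bilinear_scaleR]
  and smooth_on_inner = smooth_on_bilinear[OF _ bounded_bilinear_inner]

lemma smooth_on_uminus: "open U \<Longrightarrow> smooth_on U f \<Longrightarrow> smooth_on U (\<lambda>x. - f x)"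
  using smooth_on_linear[OF _ bounded_linear_minus[OF bounded_linear_ident]] by blast

lemma smooth_on_diff:
  "open U \<Longrightarrow> smooth_on U f \<Longrightarrow> smooth_on U g \<Longrightarrow> smooth_on U (\<lambda>x. f x - g x)"
  using smooth_on_add[OF _ _ smooth_on_uminus, of U f g] by simp

lemma smooth_on_inverse_sqrt:
  fixes f :: "'a::real_normed_vector \<Rightarrow> real"
  shows "open U \<Longrightarrow> smooth_on U f \<Longrightarrow> (\<And>x. x \<in> U \<Longrightarrow> f x > 0) \<Longrightarrow> smooth_on U (\<lambda>x. 1 / sqrt (f x))"
  by (simp add: smooth_on_def Ck_on_inverse_sqrt)

lemma smooth_on_inverse:
  fixes f :: "'a::real_normed_vector \<Rightarrow> real"
  assumes "open U" "smooth_on U f" "\<And>x. x \<in> U \<Longrightarrow> f x > 0"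
  shows "smooth_on U (\<lambda>x. 1 / f x)"
proof (rule smooth_on_cong[OF assms(1)])
  show "smooth_on U (\<lambda>x. (1 / sqrt (f x)) * (1 / sqrt (f x)))"
    by (intro smooth_on_mult smooth_on_inverse_sqrt assms)
  show "\<And>x. x \<in> U \<Longrightarrow> (1 / sqrt (f x)) * (1 / sqrt (f x)) = 1 / f x"
    using assms(3) by (simp add: less_imp_le)
qed

lemma smooth_on_compose:
  fixes g :: "'a::real_normed_vector \<Rightarrow> 'c::euclidean_space"
  shows "open U \<Longrightarrow> open V \<Longrightarrow> (\<And>x. x \<in> U \<Longrightarrow> g x \<in> V) \<Longrightarrow> smooth_on U g \<Longrightarrow> smooth_on V f
    \<Longrightarrow> smooth_on U (\<lambda>x. f (g x))"
  using Ck_on_compose[of U V g _ f] by (simp add: smooth_on_def)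

lemma smooth_on_dir_var:
  fixes F :: "'a::euclidean_space \<Rightarrow> 'b::real_normed_vector"
  assumes "open U" "smooth_on U F" "smooth_on U b"
  shows "smooth_on U (\<lambda>x. dir (b x) F x)"
proof (rule smooth_on_cong[OF assms(1)])
  show "smooth_on U (\<lambda>x. \<Sum>i\<in>Basis. (b x \<bullet> i) *\<^sub>R dir i F x)"
    by (intro smooth_on_sum smooth_on_scaleR smooth_on_inner smooth_on_const smooth_on_dir assms)
  show "(\<Sum>i\<in>Basis. (b x \<bullet> i) *\<^sub>R dir i F x) = dir (b x) F x" if "x \<in> U" for x
    using linear_eq_sum_Basis[OF linear_dir[OF smooth_on_differentiable[OF assms(2) that]]] by metis
qed

section \<open>Product rules and derivatives along variable directions\<close>

lemma dir_linear:
  assumes "bounded_linear L" "f differentiable at x"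
  shows "dir v (\<lambda>x. L (f x)) x = L (dir v f x)"
  by (rule dir_eqI[OF bounded_linear.has_derivative[OF assms(1) has_derivative_dir[OF assms(2)]]])

lemma dir_bilinear:
  assumes "bounded_bilinear B" "f differentiable at x" "g differentiable at x"
  shows "dir v (\<lambda>x. B (f x) (g x)) x = B (dir v f x) (g x) + B (f x) (dir v g x)"
  using dir_eqI[OF bounded_bilinear.FDERIV[OF assms(1) has_derivative_dir has_derivative_dir]] assms(2,3)
  by (simp add: add.commute)

lemma dir_add:
  assumes "f differentiable at x" "g differentiable at x"
  shows "dir v (\<lambda>x. f x + g x) x = dir v f x + dir v g x"
  by (rule dir_eqI[OF has_derivative_add[OF assms[THEN has_derivative_dir]]])

lemma dir_diff:
  assumes "f differentiable at x" "g differentiable at x"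
  shows "dir v (\<lambda>x. f x - g x) x = dir v f x - dir v g x"
  by (rule dir_eqI[OF has_derivative_diff[OF assms[THEN has_derivative_dir]]])

lemma dir_sum:
  assumes "\<And>i. i \<in> I \<Longrightarrow> f i differentiable at x"
  shows "dir v (\<lambda>x. \<Sum>i\<in>I. f i x) x = (\<Sum>i\<in>I. dir v (f i) x)"
  by (rule dir_eqI[OF has_derivative_sum[OF has_derivative_dir[OF assms]]])

lemma dir_dir_linear:
  assumes "open U" "x \<in> U" "bounded_linear L" "smooth_on U f"
  shows "dir w (dir v (\<lambda>x. L (f x))) x = L (dir w (dir v f) x)"
proof -
  have s: "smooth_on U (\<lambda>x. L (f x))" by (rule smooth_on_linear[OF assms(1,3,4)])
  have "dir w (dir v (\<lambda>x. L (f x))) x = dir w (\<lambda>x. L (dir v f x)) x"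
    by (rule dir_cong_open[OF assms(1,2) dir_linear[OF assms(3) smooth_on_differentiable[OF assms(4)]]
          smooth_on_differentiable[OF smooth_on_dir[OF s] assms(2)]])
  also have "\<dots> = L (dir w (dir v f) x)"
    by (rule dir_linear[OF assms(3) smooth_on_differentiable[OF smooth_on_dir[OF assms(4)] assms(2)]])
  finally show ?thesis .
qed

lemma dir_dir_bilinear:
  assumes "open U" "x \<in> U" "bounded_bilinear B" "smooth_on U f" "smooth_on U g"
  shows "dir v (dir v (\<lambda>x. B (f x) (g x))) x =
    B (dir v (dir v f) x) (g x) + 2 *\<^sub>R B (dir v f x) (dir v g x) + B (f x) (dir v (dir v g) x)"
proof -
  note d = smooth_on_differentiable[OF _ assms(2)]
  note s = assms(4,5) smooth_on_dir[OF assms(4), of v] smooth_on_dir[OF assms(5), of v]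
  have s': "smooth_on U (dir v (\<lambda>x. B (f x) (g x)))"
    by (rule smooth_on_dir[OF smooth_on_bilinear[OF assms(1,3,4,5)]])
  have "dir v (dir v (\<lambda>x. B (f x) (g x))) x = dir v (\<lambda>x. B (dir v f x) (g x) + B (f x) (dir v g x)) x"
    by (rule dir_cong_open[OF assms(1,2) dir_bilinear[OF assms(3)
          smooth_on_differentiable[OF assms(4)] smooth_on_differentiable[OF assms(5)]] d[OF s']])
  also have "\<dots> = dir v (\<lambda>x. B (dir v f x) (g x)) x + dir v (\<lambda>x. B (f x) (dir v g x)) x"
    by (rule dir_add[OF d[OF smooth_on_bilinear[OF assms(1,3) s(3) s(2)]] d[OF smooth_on_bilinear[OF assms(1,3) s(1) s(4)]]])
  also have "\<dots> = B (dir v (dir v f) x) (g x) + B (dir v f x) (dir v g x)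
      + (B (dir v f x) (dir v g x) + B (f x) (dir v (dir v g) x))"
    by (simp only: dir_bilinear[OF assms(3) d[OF s(3)] d[OF s(2)]] dir_bilinear[OF assms(3) d[OF s(1)] d[OF s(4)]])
  finally show ?thesis by (simp add: scaleR_2)
qed

text \<open>The second summand is the price of a direction field that is not constant. It carries
  every derivative of a tangent field in what follows: in the Laplacian, the curvature and the
  differentiated maximality condition these summands cancel or are tangent.\<close>

lemma dir_dir_var:
  fixes F :: "'a::euclidean_space \<Rightarrow> 'b::real_normed_vector"
  assumes "open U" "x \<in> U" "smooth_on U F" "smooth_on U b"
  shows "dir a (\<lambda>x. dir (b x) F x) x = dir a (dir (b x) F) x + dir (dir a b x) F x"
proof -
  note d = smooth_on_differentiable[OF _ assms(2)]
  have l: "linear (\<lambda>v. dir v F y)" if "y \<in> U" for y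
    by (intro linear_dir smooth_on_differentiable[OF assms(3)] that)
  have *: "dir (c y) F y = (\<Sum>i\<in>Basis. (c y \<bullet> i) *\<^sub>R dir i F y)" if "y \<in> U" for c y
    using linear_eq_sum_Basis[OF l[OF that]] by metis
  have sm: "smooth_on U (\<lambda>y. (c y \<bullet> i) *\<^sub>R dir i F y)" if "smooth_on U c" for c i
    by (intro smooth_on_scaleR smooth_on_inner smooth_on_const smooth_on_dir that assms)
  have db: "dir a (\<lambda>y. c y \<bullet> i) x = dir a c x \<bullet> i" if "smooth_on U c" for c i
    by (rule dir_linear[OF bounded_linear_inner_left d[OF that]])
  \<comment> \<open>Stated for any direction field, so that it can be used both for \<open>b\<close>
    and for the constant field \<open>b x\<close>; the two results differ by exactly the correction
    term.\<close>
  have gen: "dir a (\<lambda>y. dir (c y) F y) x =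
     (\<Sum>i\<in>Basis. (dir a c x \<bullet> i) *\<^sub>R dir i F x + (c x \<bullet> i) *\<^sub>R dir a (dir i F) x)" if c: "smooth_on U c" for c
  proof -
    have "dir a (\<lambda>y. dir (c y) F y) x = dir a (\<lambda>y. \<Sum>i\<in>Basis. (c y \<bullet> i) *\<^sub>R dir i F y) x"
      by (rule dir_cong_open[OF assms(1,2) _ d[OF smooth_on_dir_var[OF assms(1,3) c]]]) (rule *)
    also have "\<dots> = (\<Sum>i\<in>Basis. dir a (\<lambda>y. (c y \<bullet> i) *\<^sub>R dir i F y) x)"
      by (rule dir_sum[OF d[OF sm[OF c]]])
    also have "\<dots> = (\<Sum>i\<in>Basis. (dir a c x \<bullet> i) *\<^sub>R dir i F x + (c x \<bullet> i) *\<^sub>R dir a (dir i F) x)"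
      by (intro sum.cong refl)
        (simp add: dir_bilinear[OF bounded_bilinear_scaleR d d] smooth_on_inner[OF assms(1) c smooth_on_const]
          smooth_on_dir[OF assms(3)] db[OF c])
    finally show ?thesis .
  qed
  show ?thesis
    using gen[OF assms(4)] gen[OF smooth_on_const, of "b x"] *[OF assms(2), of "\<lambda>y. dir a b x"]
    by (simp add: sum.distrib dir_const)
qed

section \<open>Symmetry of second derivatives\<close>

lemma has_real_derivative_line:
  fixes f :: "'a::real_normed_vector \<Rightarrow> real"
  assumes "f differentiable at (y + t *\<^sub>R a)"
  shows "((\<lambda>t. f (y + t *\<^sub>R a)) has_real_derivative dir a f (y + t *\<^sub>R a)) (at t)"
proof -
  have l: "((\<lambda>t. y + t *\<^sub>R a) has_derivative (\<lambda>t. t *\<^sub>R a)) (at t)"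
    by (auto intro!: derivative_eq_intros)
  from diff_chain_at[OF l has_derivative_dir[OF assms]]
  have "((\<lambda>t. f (y + t *\<^sub>R a)) has_derivative (\<lambda>s. dir (s *\<^sub>R a) f (y + t *\<^sub>R a))) (at t)"
    by (simp add: o_def)
  moreover have "dir (s *\<^sub>R a) f (y + t *\<^sub>R a) = dir a f (y + t *\<^sub>R a) * s" for s
    using linear_scale[OF linear_dir[OF assms]] by simp
  ultimately show ?thesis by (simp add: has_field_derivative_def)
qed

text \<open>The mean value theorem is used twice: in direction \<open>a\<close> for the difference
  of \<open>f\<close> on two parallel segments, then in direction \<open>b\<close> for
  \<open>dir a f\<close>.\<close>

lemma second_difference_mean_value:
  fixes f :: "'a::real_normed_vector \<Rightarrow> real"
  assumes f: "smooth_on U f" and s: "0 < s"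
    and U: "\<And>t r. \<bar>t\<bar> \<le> s \<Longrightarrow> \<bar>r\<bar> \<le> s \<Longrightarrow> x + t *\<^sub>R a + r *\<^sub>R b \<in> U"
  shows "\<exists>t r. \<bar>t\<bar> \<le> s \<and> \<bar>r\<bar> \<le> s \<and>
    f (x + s *\<^sub>R a + s *\<^sub>R b) - f (x + s *\<^sub>R a) - f (x + s *\<^sub>R b) + f x
      = s * s * dir b (dir a f) (x + t *\<^sub>R a + r *\<^sub>R b)"
proof -
  let ?h = "\<lambda>t. f ((x + s *\<^sub>R b) + t *\<^sub>R a) - f (x + t *\<^sub>R a)"
  let ?h' = "\<lambda>t. dir a f ((x + s *\<^sub>R b) + t *\<^sub>R a) - dir a f (x + t *\<^sub>R a)"
  have fd: "g differentiable at (x + t *\<^sub>R a + r *\<^sub>R b)" if "smooth_on U g" "\<bar>t\<bar> \<le> s" "\<bar>r\<bar> \<le> s" for g :: "'a \<Rightarrow> real" and t r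
    using smooth_on_differentiable[OF that(1) U] that by auto
  have "(?h has_real_derivative ?h' t) (at t)" if "0 \<le> t" "t \<le> s" for t
    using fd[OF f, of t s] fd[OF f, of t 0] that s
    by (intro DERIV_diff has_real_derivative_line) (auto simp: algebra_simps)
  from MVT2[OF s this] obtain t where t: "0 < t" "t < s" "?h s - ?h 0 = s * ?h' t" by auto
  have "((\<lambda>r. dir a f (x + t *\<^sub>R a + r *\<^sub>R b)) has_real_derivative dir b (dir a f) (x + t *\<^sub>R a + r *\<^sub>R b)) (at r)"
    if "0 \<le> r" "r \<le> s" for r
    using fd[OF smooth_on_dir[OF f], of t r] that t by (intro has_real_derivative_line) auto
  from MVT2[OF s this] obtain r where r: "0 < r" "r < s"
    "dir a f (x + t *\<^sub>R a + s *\<^sub>R b) - dir a f (x + t *\<^sub>R a + 0 *\<^sub>R b) = s * dir b (dir a f) (x + t *\<^sub>R a + r *\<^sub>R b)"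
    by auto
  show ?thesis
    by (rule exI[of _ t], rule exI[of _ r]) (use t r in \<open>simp add: algebra_simps\<close>)
qed

text \<open>The second difference is symmetric in \<open>a\<close> and \<open>b\<close>, so mixed
  derivatives of either order agree at suitable points near \<open>x\<close>; continuity at
  \<open>x\<close> then excludes different values there.\<close>

lemma dir_commute_real:
  fixes f :: "'a::real_normed_vector \<Rightarrow> real"
  assumes "open U" "x \<in> U" "smooth_on U f"
  shows "dir a (dir b f) x = dir b (dir a f) x"
proof (rule ccontr)
  define e where "e = \<bar>dir a (dir b f) x - dir b (dir a f) x\<bar> / 2"
  assume "dir a (dir b f) x \<noteq> dir b (dir a f) x"
  then have e: "e > 0" by (simp add: e_def)
  have c: "continuous (at x) (dir v (dir w f))" for v w
    by (intro differentiable_imp_continuous_within smooth_on_differentiable[OF _ assms(2)] smooth_on_dir assms(3))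
  have "\<exists>d>0. \<forall>y. dist y x < d \<longrightarrow> y \<in> U \<and> \<bar>dir v (dir w f) y - dir v (dir w f) x\<bar> < e" for v w
  proof -
    obtain d1 where "d1 > 0" "\<forall>y. dist y x < d1 \<longrightarrow> y \<in> U" using assms(1,2) open_dist by blast
    moreover obtain d2 where "d2 > 0" "\<forall>y. dist y x < d2 \<longrightarrow> \<bar>dir v (dir w f) y - dir v (dir w f) x\<bar> < e"
      using c[of v w] e unfolding continuous_at_eps_delta dist_real_def by blast
    ultimately show ?thesis by (intro exI[of _ "min d1 d2"]) auto
  qed
  then obtain d where d: "\<And>v w. d v w > 0"
    "\<And>v w y. dist y x < d v w \<Longrightarrow> y \<in> U \<and> \<bar>dir v (dir w f) y - dir v (dir w f) x\<bar> < e"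
    by metis
  define D where "D = min (d a b) (d b a)"
  have D: "D > 0" using d(1) by (simp add: D_def)
  \<comment> \<open>With this side length the whole parallelogram stays within distance
    \<open>D / 2\<close> of \<open>x\<close>; the summand 1 keeps the denominator positive.\<close>
  define s where "s = D / (2 * (norm a + norm b + 1))"
  have s: "s > 0" using D by (simp add: s_def add_pos_nonneg add_nonneg_pos)
  have near: "dist (x + t *\<^sub>R a + r *\<^sub>R b) x < D" if "\<bar>t\<bar> \<le> s" "\<bar>r\<bar> \<le> s" for t r
  proof -
    have "dist (x + t *\<^sub>R a + r *\<^sub>R b) x \<le> norm (t *\<^sub>R a) + norm (r *\<^sub>R b)"
      by (simp add: dist_norm norm_triangle_ineq add.assoc del: norm_scaleR)
    also have "\<dots> \<le> s * norm a + s * norm b" using that by (simp add: add_mono mult_right_mono)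
    also have "\<dots> \<le> s * (norm a + norm b + 1)" using s by (simp add: algebra_simps)
    also have "\<dots> = D / 2" by (simp add: s_def add_nonneg_eq_0_iff field_simps)
    finally show ?thesis using D by simp
  qed
  have near': "y \<in> U" "\<bar>dir a (dir b f) y - dir a (dir b f) x\<bar> < e" "\<bar>dir b (dir a f) y - dir b (dir a f) x\<bar> < e"
    if "dist y x < D" for y using that d(2) by (auto simp: D_def)
  let ?d = "f (x + s *\<^sub>R a + s *\<^sub>R b) - f (x + s *\<^sub>R a) - f (x + s *\<^sub>R b) + f x"
  obtain t1 r1 where 1: "\<bar>t1\<bar> \<le> s" "\<bar>r1\<bar> \<le> s" "?d = s * s * dir b (dir a f) (x + t1 *\<^sub>R a + r1 *\<^sub>R b)"
    using second_difference_mean_value[OF assms(3) s, of x a b] near near' by metis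
  have U': "x + t *\<^sub>R b + r *\<^sub>R a \<in> U" if "\<bar>t\<bar> \<le> s" "\<bar>r\<bar> \<le> s" for t r
    using near'(1)[OF near[OF that(2,1)]] by (simp add: algebra_simps)
  obtain t2 r2 where 2: "\<bar>t2\<bar> \<le> s" "\<bar>r2\<bar> \<le> s"
    "f (x + s *\<^sub>R b + s *\<^sub>R a) - f (x + s *\<^sub>R b) - f (x + s *\<^sub>R a) + f x = s * s * dir a (dir b f) (x + t2 *\<^sub>R b + r2 *\<^sub>R a)"
    using second_difference_mean_value[OF assms(3) s U'] by blast
  \<comment> \<open>The mean value lemma was applied with \<open>a\<close> and \<open>b\<close>
    exchanged, so its second difference has to be recognised as the first one.\<close>
  have e2: "x + s *\<^sub>R b + s *\<^sub>R a = x + s *\<^sub>R a + s *\<^sub>R b" "x + t2 *\<^sub>R b + r2 *\<^sub>R a = x + r2 *\<^sub>R a + t2 *\<^sub>R b"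
    by (simp_all add: algebra_simps)
  have "s * s * dir b (dir a f) (x + t1 *\<^sub>R a + r1 *\<^sub>R b) = s * s * dir a (dir b f) (x + r2 *\<^sub>R a + t2 *\<^sub>R b)"
    using 1(3) 2(3)[unfolded e2] by linarith
  then have "dir b (dir a f) (x + t1 *\<^sub>R a + r1 *\<^sub>R b) = dir a (dir b f) (x + r2 *\<^sub>R a + t2 *\<^sub>R b)"
    using s by simp
  moreover note near'(3)[OF near[OF 1(1,2)]] near'(2)[OF near[OF 2(2,1)]]
  ultimately show False
    unfolding e_def abs_real_def by (simp add: field_simps split: if_splits)
qed

lemma dir_commute:
  fixes f :: "'a::real_normed_vector \<Rightarrow> 'b::euclidean_space"
  assumes "open U" "x \<in> U" "smooth_on U f"
  shows "dir a (dir b f) x = dir b (dir a f) x"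
proof (rule euclidean_eqI)
  fix i :: 'b
  have "dir a (dir b f) x \<bullet> i = dir a (dir b (\<lambda>x. f x \<bullet> i)) x" for a b
    using dir_dir_linear[OF assms(1,2) bounded_linear_inner_left assms(3)] by simp
  then show "dir a (dir b f) x \<bullet> i = dir b (dir a f) x \<bullet> i"
    using dir_commute_real[OF assms(1,2) smooth_on_inner[OF assms(1,3) smooth_on_const]] by simp
qed

section \<open>Minkowski vectors, bivectors and the Hodge star\<close>

lemma bounded_bilinear_mink: "bounded_bilinear mink"
  unfolding bilinear_conv_bounded_bilinear[symmetric] bilinear_def linear_iff mink_def
  by (auto simp: algebra_simps)

lemma bounded_bilinear_wedge: "bounded_bilinear wedge"
  unfolding bilinear_conv_bounded_bilinear[symmetric] bilinear_def linear_iff wedge_def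
  by (auto simp: algebra_simps vec_eq_iff)

lemmas mink_simps = bounded_bilinear.add_left[OF bounded_bilinear_mink] bounded_bilinear.add_right[OF bounded_bilinear_mink]
  bounded_bilinear.diff_left[OF bounded_bilinear_mink] bounded_bilinear.diff_right[OF bounded_bilinear_mink]
  bounded_bilinear.minus_left[OF bounded_bilinear_mink] bounded_bilinear.minus_right[OF bounded_bilinear_mink]
  bounded_bilinear.scaleR_left[OF bounded_bilinear_mink] bounded_bilinear.scaleR_right[OF bounded_bilinear_mink]
  bounded_bilinear.zero_left[OF bounded_bilinear_mink] bounded_bilinear.zero_right[OF bounded_bilinear_mink]

lemmas wedge_simps = bounded_bilinear.add_left[OF bounded_bilinear_wedge] bounded_bilinear.add_right[OF bounded_bilinear_wedge]
  bounded_bilinear.diff_left[OF bounded_bilinear_wedge] bounded_bilinear.diff_right[OF bounded_bilinear_wedge]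
  bounded_bilinear.minus_left[OF bounded_bilinear_wedge] bounded_bilinear.minus_right[OF bounded_bilinear_wedge]
  bounded_bilinear.scaleR_left[OF bounded_bilinear_wedge] bounded_bilinear.scaleR_right[OF bounded_bilinear_wedge]
  bounded_bilinear.zero_left[OF bounded_bilinear_wedge] bounded_bilinear.zero_right[OF bounded_bilinear_wedge]

lemma mink_commute: "mink v w = mink w v"
  by (simp add: mink_def mult.commute)

lemma wedge_self [simp]: "wedge v v = 0"
  by (simp add: wedge_def vec_eq_iff)

lemma wedge_flip: "wedge w v = - wedge v w"
  by (simp add: wedge_def vec_eq_iff)

text \<open>The inner product on bivectors induced by \<open>mink\<close>: one term per pair of
  indices, negative when the pair contains the time index 1. On wedge products it is the 2 x 2
  determinant of the problem, by \<open>biv_mink_wedge\<close>.\<close>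

definition biv_mink :: "real^4^4 \<Rightarrow> real^4^4 \<Rightarrow> real" where
  "biv_mink A B = - (A$1$2 * B$1$2) - A$1$3 * B$1$3 - A$1$4 * B$1$4
     + A$2$3 * B$2$3 + A$2$4 * B$2$4 + A$3$4 * B$3$4"

lemma bounded_bilinear_biv_mink: "bounded_bilinear biv_mink"
  unfolding bilinear_conv_bounded_bilinear[symmetric] bilinear_def linear_iff biv_mink_def
  by (auto simp: algebra_simps)

lemmas biv_mink_simps = bounded_bilinear.add_left[OF bounded_bilinear_biv_mink] bounded_bilinear.add_right[OF bounded_bilinear_biv_mink]
  bounded_bilinear.diff_left[OF bounded_bilinear_biv_mink] bounded_bilinear.diff_right[OF bounded_bilinear_biv_mink]
  bounded_bilinear.minus_left[OF bounded_bilinear_biv_mink] bounded_bilinear.minus_right[OF bounded_bilinear_biv_mink]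
  bounded_bilinear.scaleR_left[OF bounded_bilinear_biv_mink] bounded_bilinear.scaleR_right[OF bounded_bilinear_biv_mink]
  bounded_bilinear.zero_left[OF bounded_bilinear_biv_mink] bounded_bilinear.zero_right[OF bounded_bilinear_biv_mink]

lemma biv_mink_wedge: "biv_mink (wedge a b) (wedge c d) = mink a c * mink b d - mink a d * mink b c"
  unfolding biv_mink_def wedge_def mink_def by (simp add: algebra_simps)

text \<open>The bivector regarded as an endomorphism, by means of the metric. For skew
  \<open>B\<close> it is adjoint to the wedge product (\<open>mink_contract\<close>), which allows
  bivectors to be tested on vectors.\<close>

definition contract :: "real^4^4 \<Rightarrow> real^4 \<Rightarrow> real^4" where
  "contract B v = (\<chi> i. mink (B$i) v)"

lemma linear_contract: "linear (\<lambda>B. contract B v)" "linear (contract B)"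
  by (auto simp: linear_iff contract_def vec_eq_iff mink_simps)

lemma contract_wedge: "contract (wedge a b) v = mink b v *\<^sub>R a - mink a v *\<^sub>R b"
  by (simp add: contract_def wedge_def mink_def vec_eq_iff algebra_simps)

lemma contract_eq_0: "(\<And>v. contract B v = 0) \<Longrightarrow> B = 0"
proof (intro vec_eq_iff[THEN iffD2] allI)
  fix i j assume *: "\<And>v. contract B v = 0"
  have "contract B (axis j 1) $ i = (if j = 1 then - B$i$j else B$i$j)"
    using exhaust_4[of j] by (auto simp: contract_def mink_def axis_def)
  then show "B $ i $ j = 0 $ i $ j" using *[of "axis j 1"] by (auto split: if_splits)
qed

lemma mink_contract:
  "transpose B = - B \<Longrightarrow> mink v (contract B w) = biv_mink B (wedge v w)"
proof -
  assume "transpose B = - B"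
  then have "transpose B $ i $ j = (- B) $ i $ j" for i j by metis
  then have t: "B $ j $ i = - B $ i $ j" for i j
    unfolding transpose_def vec_lambda_beta vector_uminus_component .
  have d: "B $ i $ i = 0" for i using t[of i i] by simp
  show ?thesis
    unfolding contract_def mink_def biv_mink_def wedge_def
    by (simp add: d t[of 1 2] t[of 1 3] t[of 1 4] t[of 2 3] t[of 2 4] t[of 3 4] algebra_simps)
qed

text \<open>The Hodge star of the Minkowski metric. Its sign is fixed by
  \<open>biv_mink_hodge_wedge\<close>, so that for a positive orthonormal frame with space-like
  \<open>e 1\<close>, \<open>e 2\<close> it sends the tangent bivector to the wedge of
  \<open>e 3\<close> and \<open>e 4\<close>.\<close>

definition hodge :: "real^4^4 \<Rightarrow> real^4^4" where
  "hodge B = (\<chi> i j.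
     if i = 1 \<and> j = 2 then B$3$4 else if i = 2 \<and> j = 1 then - B$3$4 else
     if i = 1 \<and> j = 3 then - B$2$4 else if i = 3 \<and> j = 1 then B$2$4 else
     if i = 1 \<and> j = 4 then B$2$3 else if i = 4 \<and> j = 1 then - B$2$3 else
     if i = 2 \<and> j = 3 then - B$1$4 else if i = 3 \<and> j = 2 then B$1$4 else
     if i = 2 \<and> j = 4 then B$1$3 else if i = 4 \<and> j = 2 then - B$1$3 else
     if i = 3 \<and> j = 4 then - B$1$2 else if i = 4 \<and> j = 3 then B$1$2 else 0)"

lemma bounded_linear_hodge: "bounded_linear hodge"
  unfolding linear_conv_bounded_linear[symmetric] linear_iff hodge_def
  by (auto simp: vec_eq_iff)

lemma hodge_antisym: "transpose (hodge B) = - hodge B"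
  unfolding transpose_def vec_eq_iff forall_4 by (simp add: hodge_def)

text \<open>In Lorentzian signature the star squares to minus the identity on bivectors. In
  particular it is injective there, which is how an equation for the Gauss map is carried back to
  the tangent plane.\<close>

lemma hodge_hodge: "transpose B = - B \<Longrightarrow> hodge (hodge B) = - B"
proof -
  assume "transpose B = - B"
  then have "transpose B $ i $ j = (- B) $ i $ j" for i j by metis
  then have t: "B $ j $ i = - B $ i $ j" for i j
    unfolding transpose_def vec_lambda_beta vector_uminus_component .
  have d: "B $ i $ i = 0" for i using t[of i i] by simp
  show ?thesis
    unfolding vec_eq_iff forall_4
    by (simp add: hodge_def d t[of 1 2] t[of 1 3] t[of 1 4] t[of 2 3] t[of 2 4] t[of 3 4])
qed

lemma wedge_antisym: "transpose (wedge v w) = - wedge v w"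
  by (simp add: wedge_def transpose_def vec_eq_iff)

text \<open>Laplace expansion along the first two rows: each summand pairs a coordinate of the wedge
  of rows 1 and 2 with the complementary coordinate of the wedge of rows 3 and 4, just as
  \<open>hodge\<close> does.\<close>

lemma det_4:
  "det (A::'a::comm_ring_1^4^4) =
    (A$1$1 * A$2$2 - A$1$2 * A$2$1) * (A$3$3 * A$4$4 - A$3$4 * A$4$3)
    - (A$1$1 * A$2$3 - A$1$3 * A$2$1) * (A$3$2 * A$4$4 - A$3$4 * A$4$2)
    + (A$1$1 * A$2$4 - A$1$4 * A$2$1) * (A$3$2 * A$4$3 - A$3$3 * A$4$2)
    + (A$1$2 * A$2$3 - A$1$3 * A$2$2) * (A$3$1 * A$4$4 - A$3$4 * A$4$1)
    - (A$1$2 * A$2$4 - A$1$4 * A$2$2) * (A$3$1 * A$4$3 - A$3$3 * A$4$1)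
    + (A$1$3 * A$2$4 - A$1$4 * A$2$3) * (A$3$1 * A$4$2 - A$3$2 * A$4$1)"
proof -
  have f: "finite {2::4, 3, 4}" "1 \<notin> {2::4, 3, 4}" "finite {3::4, 4}" "2 \<notin> {3::4, 4}" "finite {4::4}" "3 \<notin> {4::4}"
    by auto
  show ?thesis
    unfolding det_def UNIV_4
    unfolding sum_over_permutations_insert[OF f(1,2)] sum_over_permutations_insert[OF f(3,4)]
      sum_over_permutations_insert[OF f(5,6)]
    unfolding permutes_sing
    by (simp add: sign_swap_id sign_compose permutation_compose permutation_swap_id sign_id swap_id_eq)
      (simp add: algebra_simps)
qed

lemma biv_mink_hodge_wedge:
  "biv_mink (hodge (wedge a b)) (wedge c d) = - det (\<chi> i. if i = 1 then a else if i = 2 then b else if i = 3 then c else d)"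
  unfolding det_4 biv_mink_def by (simp add: hodge_def wedge_def algebra_simps)

section \<open>Orthonormal frames of the Minkowski space\<close>

definition eta :: "real^4^4" where
  "eta = (\<chi> i j. if i = j then (if i = 1 then -1 else 1) else 0)"

lemma mink_eta: "mink v w = v \<bullet> (eta *v w)"
  by (simp add: mink_def eta_def inner_vec_def sum_4 matrix_vector_mult_def)

lemma prod_4: "prod f (UNIV::4 set) = f 1 * f 2 * f 3 * f 4"
  unfolding UNIV_4 by (simp add: ac_simps)

lemma det_eta: "det eta = -1"
proof -
  have "det eta = (\<Prod>i\<in>UNIV. eta$i$i)" by (rule det_diagonal) (simp add: eta_def)
  then show ?thesis by (simp add: prod_4 eta_def)
qed

text \<open>The individual signs are left open because either of the two normal vectors may be the
  time-like one; only the product of the four signs is determined.\<close>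

locale mink_frame =
  fixes e :: "4 \<Rightarrow> real^4"
  assumes orth: "a \<noteq> b \<Longrightarrow> mink (e a) (e b) = 0"
    and unit: "\<bar>mink (e a) (e a)\<bar> = 1"
    and pos_det: "det (\<chi> a. e a) > 0"
begin

lemma sign_sq: "mink (e a) (e a) * mink (e a) (e a) = 1"
  using unit[of a] by (metis abs_mult_self_eq mult_1)

text \<open>The Gram matrix of the frame is diagonal and has determinant \<open>- (det E)^2\<close>
  for the matrix \<open>E\<close> of the frame. Its diagonal entries have absolute value 1, which
  gives \<open>(det E)^2 = 1\<close>, and the orientation selects the positive root.\<close>

lemma det_sign: "det (\<chi> a. e a) = 1" "(\<Prod>a\<in>UNIV. mink (e a) (e a)) = -1"
proof -
  let ?E = "\<chi> a. e a"
  let ?G = "?E ** eta ** transpose ?E"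
  have G: "?G $ a $ b = mink (e a) (e b)" for a b
    by (simp add: matrix_matrix_mult_def transpose_def mink_eta inner_vec_def matrix_vector_mult_def
        sum_4 algebra_simps)
  have "det ?G = (\<Prod>a\<in>UNIV. ?G$a$a)" by (rule det_diagonal) (simp add: G orth)
  then have 1: "(\<Prod>a\<in>UNIV. mink (e a) (e a)) = - (det ?E * det ?E)"
    by (simp add: det_mul det_transpose det_eta G)
  have "\<bar>\<Prod>a\<in>UNIV. mink (e a) (e a)\<bar> = 1" by (simp add: abs_prod unit)
  then have "\<bar>det ?E * det ?E\<bar> = 1" unfolding 1 by simp
  then have "(det ?E)\<^sup>2 = 1" by (simp add: power2_eq_square abs_mult)
  then show d: "det ?E = 1" using pos_det by (simp add: power2_eq_1_iff)
  show "(\<Prod>a\<in>UNIV. mink (e a) (e a)) = -1" using 1 by (simp add: d)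
qed

lemma eq_0I:
  assumes "\<And>a. mink v (e a) = 0"
  shows "v = 0"
proof -
  let ?E = "\<chi> a. e a"
  have "?E *v (eta *v v) = 0"
    using assms by (simp add: vec_eq_iff matrix_vector_mul_component mink_eta[symmetric] mink_commute)
  moreover have "invertible ?E" using pos_det by (simp add: invertible_det_nz)
  ultimately have "eta *v v = 0"
    by (metis invertible_def matrix_left_invertible_ker)
  moreover have "invertible eta" using det_eta by (simp add: invertible_det_nz)
  ultimately show ?thesis by (metis invertible_def matrix_left_invertible_ker)
qed

lemma expansion: "v = (\<Sum>a\<in>UNIV. (mink (e a) (e a) * mink v (e a)) *\<^sub>R e a)"
proof -
  have "mink (v - (\<Sum>a\<in>UNIV. (mink (e a) (e a) * mink v (e a)) *\<^sub>R e a)) (e b) = 0" for b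
    using exhaust_4[of b] sign_sq
    by (auto simp: sum_4 mink_simps orth mult.assoc mult.commute mult.left_commute)
  then show ?thesis using eq_0I by force
qed

lemma bivector_eq_0I:
  assumes "transpose B = - B" "\<And>a b. biv_mink B (wedge (e a) (e b)) = 0"
  shows "B = 0"
proof (rule contract_eq_0)
  fix v
  have "contract B (e b) = 0" for b
    by (rule eq_0I) (use assms mink_contract[OF assms(1)] in \<open>simp add: mink_commute\<close>)
  then have "contract B (\<Sum>a\<in>UNIV. (mink (e a) (e a) * mink v (e a)) *\<^sub>R e a) = 0"
    by (simp add: linear_sum[OF linear_contract(2)] linear_scale[OF linear_contract(2)])
  then show "contract B v = 0" using expansion[of v] by simp
qed

text \<open>This turns the sum over the normal frame in \<open>norm_h_sq\<close> into a square that
  does not mention \<open>e 3\<close> and \<open>e 4\<close>.\<close>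

lemma normal_norm:
  assumes "mink n (e 1) = 0" "mink n (e 2) = 0"
  shows "mink n n = (\<Sum>b\<in>{3,4}. mink (e b) (e b) * (mink n (e b))\<^sup>2)"
proof -
  have "mink n n = mink n (\<Sum>a\<in>UNIV. (mink (e a) (e a) * mink n (e a)) *\<^sub>R e a)"
    using expansion[of n] by simp
  then show ?thesis using assms by (simp add: sum_4 mink_simps power2_eq_square algebra_simps)
qed

text \<open>A bivector is determined by its products with the wedges of frame vectors. If an index 1
  or 2 occurs, both sides give 0, one by orthogonality and the other by a repeated row of a
  determinant; on the normal pair both give -1.\<close>

lemma wedge_normal_eq_hodge:
  assumes "mink (e 1) (e 1) = 1" "mink (e 2) (e 2) = 1"
  shows "wedge (e 3) (e 4) = hodge (wedge (e 1) (e 2))"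
proof -
  let ?B = "wedge (e 3) (e 4) - hodge (wedge (e 1) (e 2))"
  have s: "mink (e 3) (e 3) * mink (e 4) (e 4) = -1"
    using det_sign(2) assms by (simp add: prod_4)
  have t: "transpose ?B = - ?B"
  proof -
    have "transpose ?B = transpose (wedge (e 3) (e 4)) - transpose (hodge (wedge (e 1) (e 2)))"
      by (simp add: transpose_def vec_eq_iff)
    then show ?thesis by (simp only: wedge_antisym hodge_antisym) simp
  qed
  have 34: "biv_mink ?B (wedge (e 3) (e 4)) = 0"
  proof -
    have "(\<chi> i. if i = 1 then e 1 else if i = 2 then e 2 else if i = 3 then e 3 else e 4) = (\<chi> a. e a)"
      unfolding vec_eq_iff[where ?'b = 4] forall_4 by simp
    then have "biv_mink (hodge (wedge (e 1) (e 2))) (wedge (e 3) (e 4)) = -1"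
      by (simp add: biv_mink_hodge_wedge det_sign)
    then show ?thesis by (simp add: biv_mink_simps biv_mink_wedge s orth)
  qed
  have rep: "biv_mink ?B (wedge (e a) (e b)) = 0" if ab: "{a, b} \<inter> {1, 2} \<noteq> {}" for a b
  proof -
    have h0: "biv_mink (hodge (wedge (e 1) (e 2))) (wedge (e a) (e b)) = 0"
      using ab unfolding biv_mink_hodge_wedge det_4 by (auto simp: algebra_simps)
    have "biv_mink (wedge (e 3) (e 4)) (wedge (e a) (e b)) = 0"
      using ab by (auto simp: biv_mink_wedge orth)
    then show ?thesis using h0 by (simp add: biv_mink_simps)
  qed
  have "biv_mink ?B (wedge (e a) (e b)) = 0" for a b
  proof (cases "{a, b} \<inter> {1, 2} = {}")
    case False then show ?thesis by (rule rep)
  next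
    case True
    then consider "a = b" | "a = 3 \<and> b = 4" | "a = 4 \<and> b = 3" using exhaust_4[of a] exhaust_4[of b] by auto
    then show ?thesis
    proof cases
      case 3
      then show ?thesis using 34 wedge_flip[of "e 4" "e 3"] by (simp add: biv_mink_simps)
    qed (use 34 in \<open>auto simp: biv_mink_simps\<close>)
  qed
  then have "?B = 0" by (rule bivector_eq_0I[OF t])
  then show ?thesis by simp
qed

end

text \<open>
  Here \<open>e1, e2\<close> are \<open>\<phi>\<^sub>a, \<phi>\<^sub>b\<close>; the vectors \<open>f11, f12, f22\<close> are the second derivatives of \<open>\<phi>\<close> with
  normal parts \<open>P, Q, -P\<close>; \<open>k1, k2\<close> are the Laplacians of \<open>\<phi>\<^sub>a, \<phi>\<^sub>b\<close>, whose normal parts are those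
  found in \<open>codazzi\<close> below; \<open>j1, j2, jj\<close> are derivatives of \<open>1 / sqrt (det g)\<close>.
\<close>

lemma laplacian_wedge_identity:
  fixes e1 e2 P Q :: "real^4" and s11 s12 s22 t11 t12 t22 x1 y1 x2 y2 jj :: real
  defines "al \<equiv> s11 + s22" and "be \<equiv> t11 + t22"
    and "j1 \<equiv> - (s11 + t12)" and "j2 \<equiv> - (s12 + t22)"
  defines "f11 \<equiv> s11 *\<^sub>R e1 + t11 *\<^sub>R e2 + P" and "f12 \<equiv> s12 *\<^sub>R e1 + t12 *\<^sub>R e2 + Q"
    and "f22 \<equiv> s22 *\<^sub>R e1 + t22 *\<^sub>R e2 - P"
  defines "k1 \<equiv> x1 *\<^sub>R e1 + y1 *\<^sub>R e2 + (al *\<^sub>R P + be *\<^sub>R Q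
      - ((2 * t12) *\<^sub>R P - (2 * (t11 + s12)) *\<^sub>R Q - (2 * s11) *\<^sub>R P))"
    and "k2 \<equiv> x2 *\<^sub>R e1 + y2 *\<^sub>R e2 + (al *\<^sub>R Q - be *\<^sub>R P
      - ((2 * t22) *\<^sub>R P - (2 * (t12 + s22)) *\<^sub>R Q - (2 * s12) *\<^sub>R P))"
  shows "al *\<^sub>R (j1 *\<^sub>R wedge e1 e2 + (wedge f11 e2 + wedge e1 f12))
      + be *\<^sub>R (j2 *\<^sub>R wedge e1 e2 + (wedge f12 e2 + wedge e1 f22))
      - (jj *\<^sub>R wedge e1 e2 + (2 * j1) *\<^sub>R (wedge f11 e2 + wedge e1 f12)
         + (2 * j2) *\<^sub>R (wedge f12 e2 + wedge e1 f22)
         + wedge k1 e2 + wedge e1 k2 + 2 *\<^sub>R (wedge f11 f12 + wedge f12 f22))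
    = - (jj + 2 * j1 * (s11 + t12) + 2 * j2 * (s12 + t22) + x1 + y2
          + 2 * (s11 * t12 - t11 * s12 + s12 * t22 - t12 * s22)) *\<^sub>R wedge e1 e2
      - 4 *\<^sub>R wedge P Q"
  unfolding assms
  by (simp add: vec_eq_iff wedge_def) algebra

text \<open>\<open>contract (hodge (wedge a b)) c\<close> is the triple cross product of
  \<open>a\<close>, \<open>b\<close>, \<open>c\<close>. The bracket on the right is their Gram
  determinant, and the minus sign reflects the signature.\<close>

lemma mink_contract_hodge:
  "mink (contract (hodge (wedge a b)) c) (contract (hodge (wedge a b)) c) =
    - (mink a a * (mink b b * mink c c - mink b c * mink b c)
       - mink a b * (mink a b * mink c c - mink b c * mink a c)
       + mink a c * (mink a b * mink b c - mink b b * mink a c))"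
  unfolding contract_def mink_def hodge_def wedge_def
  by (simp) algebra

section \<open>Space-like immersions of plane domains\<close>

definition area :: "real^2 \<Rightarrow> real^2 \<Rightarrow> real" where
  "area a b = a$1 * b$2 - a$2 * b$1"

lemma area_cramer: "area a b *\<^sub>R v = area v b *\<^sub>R a + area a v *\<^sub>R b"
  by (simp add: area_def vec_eq_iff forall_2 algebra_simps)

lemma area_0: "area a 0 = 0" "area 0 a = 0"
  by (simp_all add: area_def)

text \<open>The positivity assumption expresses at once that \<phi> is an immersion and that its
  tangent planes are space-like.\<close>

locale spacelike_chart =
  fixes U :: "(real^2) set" and \<phi> :: "real^2 \<Rightarrow> real^4"
  assumes open_U: "open U" and smooth: "smooth_on U \<phi>"
    and pos: "u \<in> U \<Longrightarrow> a \<noteq> 0 \<Longrightarrow> 0 < mink (dir a \<phi> u) (dir a \<phi> u)"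
begin

definition g :: "real^2 \<Rightarrow> real^2 \<Rightarrow> real^2 \<Rightarrow> real" where
  "g a b u = mink (dir a \<phi> u) (dir b \<phi> u)"

definition gram :: "real^2 \<Rightarrow> real^2 \<Rightarrow> real^2 \<Rightarrow> real" where
  "gram a b u = g a a u * g b b u - g a b u * g a b u"

abbreviation "E1 \<equiv> axis 1 1 :: real^2"
abbreviation "E2 \<equiv> axis 2 1 :: real^2"

text \<open>Coordinates of the orthogonal projection to the tangent plane, obtained by solving the
  normal equations with Cramer's rule. The closed formula makes smooth dependence on the point
  evident.\<close>

definition coords :: "real^4 \<Rightarrow> real^2 \<Rightarrow> real^2" where
  "coords w u = (1 / gram E1 E2 u) *\<^sub>R
     ((g E2 E2 u * mink w (dir E1 \<phi> u) - g E1 E2 u * mink w (dir E2 \<phi> u)) *\<^sub>R E1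
      + (g E1 E1 u * mink w (dir E2 \<phi> u) - g E1 E2 u * mink w (dir E1 \<phi> u)) *\<^sub>R E2)"

definition normal :: "real^4 \<Rightarrow> real^2 \<Rightarrow> real^4" where
  "normal w u = w - dir (coords w u) \<phi> u"

lemma diff_phi: "u \<in> U \<Longrightarrow> \<phi> differentiable at u"
  by (rule smooth_on_differentiable[OF smooth])

lemmas lin = linear_dir[OF diff_phi]

lemma dir_phi_simps:
  assumes "u \<in> U"
  shows "dir (a + b) \<phi> u = dir a \<phi> u + dir b \<phi> u" "dir (c *\<^sub>R a) \<phi> u = c *\<^sub>R dir a \<phi> u"
    "dir (a - b) \<phi> u = dir a \<phi> u - dir b \<phi> u"
  using linear_add[OF lin[OF assms]] linear_scale[OF lin[OF assms]] linear_diff[OF lin[OF assms]] by auto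

lemma g_commute: "g a b u = g b a u"
  by (simp add: g_def mink_commute)

lemma gram_pos:
  assumes "u \<in> U" "area a b \<noteq> 0"
  shows "gram a b u > 0"
proof -
  have "a \<noteq> 0" using assms(2) by (auto simp: area_def)
  then have a: "g a a u > 0" using pos[OF assms(1)] by (simp add: g_def)
  \<comment> \<open>The part of \<open>b\<close> orthogonal to \<open>a\<close>, multiplied by
    \<open>g a a u\<close> to avoid a division; its square is \<open>g a a u\<close> times the Gram
    determinant.\<close>
  let ?v = "g a a u *\<^sub>R b - g a b u *\<^sub>R a"
  have "area a ?v = g a a u * area a b" by (simp add: area_def algebra_simps)
  then have "area a ?v \<noteq> 0" using a assms(2) by simp
  then have "?v \<noteq> 0" using area_0(1) by metis
  then have "0 < g ?v ?v u" using pos[OF assms(1)] by (simp add: g_def)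
  also have "g ?v ?v u = g a a u * gram a b u"
    unfolding gram_def g_def dir_phi_simps[OF assms(1)]
    by (simp add: mink_simps mink_commute[of "dir b \<phi> u" "dir a \<phi> u"] algebra_simps)
  finally show ?thesis using a by (simp add: zero_less_mult_iff)
qed

lemma area_E: "area E1 E2 = 1"
  by (simp add: area_def axis_def)

lemma smooth_g: "smooth_on U (g a b)"
  unfolding g_def[abs_def]
  by (rule smooth_on_bilinear[OF open_U bounded_bilinear_mink]) (intro smooth_on_dir smooth)+

lemma smooth_gram: "smooth_on U (gram a b)"
  unfolding gram_def[abs_def] by (intro smooth_on_diff smooth_on_mult open_U smooth_g)

lemma E_expand: "a = a$1 *\<^sub>R E1 + a$2 *\<^sub>R E2"
  by (simp add: vec_eq_iff forall_2 axis_def)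

lemma normal_orth:
  assumes "u \<in> U"
  shows "mink (normal w u) (dir a \<phi> u) = 0"
proof -
  let ?G = "gram E1 E2 u"
  have G: "?G \<noteq> 0" using gram_pos[OF assms, of E1 E2] by (simp add: area_E)
  let ?A = "g E2 E2 u * mink w (dir E1 \<phi> u) - g E1 E2 u * mink w (dir E2 \<phi> u)"
  let ?B = "g E1 E1 u * mink w (dir E2 \<phi> u) - g E1 E2 u * mink w (dir E1 \<phi> u)"
  have d: "dir (coords w u) \<phi> u = (?A / ?G) *\<^sub>R dir E1 \<phi> u + (?B / ?G) *\<^sub>R dir E2 \<phi> u"
    unfolding coords_def dir_phi_simps[OF assms] by (simp add: scaleR_add_right)
  have 1: "mink (normal w u) (dir E1 \<phi> u) = mink w (dir E1 \<phi> u) - (?A / ?G * g E1 E1 u + ?B / ?G * g E1 E2 u)"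
    "mink (normal w u) (dir E2 \<phi> u) = mink w (dir E2 \<phi> u) - (?A / ?G * g E1 E2 u + ?B / ?G * g E2 E2 u)"
    unfolding normal_def d by (simp_all add: mink_simps g_def mink_commute[of "dir E2 \<phi> u" "dir E1 \<phi> u"])
  have "?G * mink (normal w u) (dir E1 \<phi> u) = 0" "?G * mink (normal w u) (dir E2 \<phi> u) = 0"
    unfolding 1 using G by (simp_all add: field_simps) (simp_all add: gram_def algebra_simps)
  then have "mink (normal w u) (dir E1 \<phi> u) = 0" "mink (normal w u) (dir E2 \<phi> u) = 0" using G by auto
  moreover have "dir a \<phi> u = a$1 *\<^sub>R dir E1 \<phi> u + a$2 *\<^sub>R dir E2 \<phi> u"
    by (subst E_expand[of a]) (simp only: dir_phi_simps[OF assms])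
  ultimately show ?thesis by (simp add: mink_simps)
qed

lemma tangent_normal_eq_0:
  assumes "u \<in> U" "mink (dir a \<phi> u) (dir a \<phi> u) = 0"
  shows "a = 0"
  using pos[OF assms(1), of a] assms(2) by auto

text \<open>Two candidates differ by a vector that is both tangent and normal, and a positive
  definite tangent plane contains no such vector except 0.\<close>

lemma coords_unique:
  assumes "u \<in> U" "\<And>b. mink (w - dir a \<phi> u) (dir b \<phi> u) = 0"
  shows "coords w u = a"
proof -
  let ?c = "coords w u - a"
  have "mink (dir ?c \<phi> u) (dir ?c \<phi> u) =
     mink (w - dir a \<phi> u) (dir ?c \<phi> u) - mink (normal w u) (dir ?c \<phi> u)"
    unfolding normal_def by (simp add: dir_phi_simps[OF assms(1)] mink_simps)
  then have "mink (dir ?c \<phi> u) (dir ?c \<phi> u) = 0" using assms(2) normal_orth[OF assms(1)] by simp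
  then have "?c = 0" by (rule tangent_normal_eq_0[OF assms(1)])
  then show ?thesis by simp
qed

lemma coords_dir: "u \<in> U \<Longrightarrow> coords (dir a \<phi> u) u = a"
  by (rule coords_unique) (auto simp: mink_simps)

lemma coords_add: "u \<in> U \<Longrightarrow> coords (v + w) u = coords v u + coords w u"
  by (simp add: coords_def mink_simps algebra_simps)

lemma coords_scaleR: "u \<in> U \<Longrightarrow> coords (c *\<^sub>R w) u = c *\<^sub>R coords w u"
  by (simp add: coords_def mink_simps algebra_simps)

lemma linear_normal: "u \<in> U \<Longrightarrow> linear (\<lambda>w. normal w u)"
  by (rule linearI) (auto simp: normal_def coords_add coords_scaleR dir_phi_simps algebra_simps)

lemma normal_simps:
  assumes "u \<in> U"
  shows "normal (v + w) u = normal v u + normal w u" "normal (c *\<^sub>R w) u = c *\<^sub>R normal w u"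
    "normal (v - w) u = normal v u - normal w u" "normal (- w) u = - normal w u" "normal 0 u = 0"
  using linear_add[OF linear_normal[OF assms]] linear_scale[OF linear_normal[OF assms]]
    linear_diff[OF linear_normal[OF assms]] linear_neg[OF linear_normal[OF assms]] linear_0[OF linear_normal[OF assms]]
  by auto

lemma normal_dir: "u \<in> U \<Longrightarrow> normal (dir a \<phi> u) u = 0"
  by (simp add: normal_def coords_dir)

lemma mink_normal:
  assumes "u \<in> U" "\<And>a. mink n (dir a \<phi> u) = 0"
  shows "mink (normal w u) n = mink w n"
  using assms by (simp add: normal_def mink_simps mink_commute)

lemma smooth_coords:
  assumes "open V" "V \<subseteq> U" "smooth_on V F"
  shows "smooth_on V (\<lambda>u. coords (F u) u)"
proof -
  have m: "smooth_on V (\<lambda>u. mink (F u) (dir a \<phi> u))" for a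
    by (rule smooth_on_bilinear[OF assms(1) bounded_bilinear_mink assms(3)])
      (rule smooth_on_subset[OF smooth_on_dir[OF smooth] assms(2)])
  have gs: "smooth_on V (g a b)" for a b by (rule smooth_on_subset[OF smooth_g assms(2)])
  have i: "smooth_on V (\<lambda>u. 1 / gram E1 E2 u)"
    by (rule smooth_on_inverse[OF assms(1) smooth_on_subset[OF smooth_gram assms(2)]])
      (use gram_pos assms(2) area_E in auto)
  show ?thesis unfolding coords_def
    by (intro smooth_on_scaleR smooth_on_add smooth_on_diff smooth_on_mult m gs i assms(1) smooth_on_const)
qed

lemma smooth_normal:
  assumes "open V" "V \<subseteq> U" "smooth_on V F"
  shows "smooth_on V (\<lambda>u. normal (F u) u)"
  unfolding normal_def
  by (intro smooth_on_diff smooth_on_dir_var smooth_coords assms smooth_on_subset[OF smooth])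

lemma second_commute: "u \<in> U \<Longrightarrow> dir a (dir b \<phi>) u = dir b (dir a \<phi>) u"
  by (rule dir_commute[OF open_U _ smooth])

lemma dir_dir_add_right:
  assumes "u \<in> U"
  shows "dir a (dir (x *\<^sub>R b + y *\<^sub>R c) \<phi>) u = x *\<^sub>R dir a (dir b \<phi>) u + y *\<^sub>R dir a (dir c \<phi>) u"
proof -
  note d = smooth_on_differentiable[OF smooth_on_dir[OF smooth] assms]
  have s: "smooth_on U (\<lambda>u. x *\<^sub>R dir b \<phi> u)" for x b
    by (intro smooth_on_scaleR smooth_on_const smooth_on_dir smooth open_U)
  have "dir a (dir (x *\<^sub>R b + y *\<^sub>R c) \<phi>) u = dir a (\<lambda>u. x *\<^sub>R dir b \<phi> u + y *\<^sub>R dir c \<phi> u) u"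
    by (rule dir_cong_open[OF open_U assms _ d]) (simp add: dir_phi_simps)
  also have "\<dots> = dir a (\<lambda>u. x *\<^sub>R dir b \<phi> u) u + dir a (\<lambda>u. y *\<^sub>R dir c \<phi> u) u"
    by (intro dir_add smooth_on_differentiable[OF s assms])
  finally show ?thesis by (simp add: dir_linear[OF bounded_linear_scaleR_right d])
qed

lemma dir_dir_add_left:
  assumes "u \<in> U"
  shows "dir (x *\<^sub>R b + y *\<^sub>R c) (dir a \<phi>) u = x *\<^sub>R dir b (dir a \<phi>) u + y *\<^sub>R dir c (dir a \<phi>) u"
  using linear_add[OF linear_dir[OF smooth_on_differentiable[OF smooth_on_dir[OF smooth] assms]]]
    linear_scale[OF linear_dir[OF smooth_on_differentiable[OF smooth_on_dir[OF smooth] assms]]]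
  by metis

end

text \<open>Meant for \<open>biv_mink (mu a b v) (mu a b v) = 1\<close>: the first derivative of
  \<open>mu\<close> is orthogonal to \<open>mu\<close>, and the product of the second derivative
  with \<open>mu\<close> is minus the square of the first.\<close>

lemma dir_bilinear_const:
  assumes "open U" "x \<in> U" "bounded_bilinear B" "smooth_on U f" "smooth_on U g"
    "\<And>y. y \<in> U \<Longrightarrow> B (f y) (g y) = c"
  shows "B (dir v f x) (g x) + B (f x) (dir v g x) = 0"
    "B (dir v (dir v f) x) (g x) + 2 *\<^sub>R B (dir v f x) (dir v g x) + B (f x) (dir v (dir v g) x) = 0"
proof -
  have s: "smooth_on U (\<lambda>y. B (f y) (g y))" by (rule smooth_on_bilinear[OF assms(1,3,4,5)])
  have 0: "dir v (\<lambda>y. B (f y) (g y)) y = 0" if "y \<in> U" for y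
    using dir_cong_open[OF assms(1) that assms(6) smooth_on_differentiable[OF s that]] by (simp add: dir_const)
  show "B (dir v f x) (g x) + B (f x) (dir v g x) = 0"
    using 0[OF assms(2)] dir_bilinear[OF assms(3)
      smooth_on_differentiable[OF assms(4,2)] smooth_on_differentiable[OF assms(5,2)]] by simp
  have "dir v (dir v (\<lambda>y. B (f y) (g y))) x = 0"
    using dir_cong_open[OF assms(1,2) 0 smooth_on_differentiable[OF smooth_on_dir[OF s] assms(2)]] by (simp add: dir_const)
  then show "B (dir v (dir v f) x) (g x) + 2 *\<^sub>R B (dir v f x) (dir v g x) + B (f x) (dir v (dir v g) x) = 0"
    using dir_dir_bilinear[OF assms(1-5)] by simp
qed

section \<open>Second fundamental form and Laplacian of the tangent plane field\<close>

context spacelike_chart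
begin

definition orthonormal :: "real^2 \<Rightarrow> real^2 \<Rightarrow> real^2 \<Rightarrow> bool" where
  "orthonormal a b u \<longleftrightarrow> g a a u = 1 \<and> g b b u = 1 \<and> g a b u = 0"

definition hess :: "real^2 \<Rightarrow> real^2 \<Rightarrow> real^2 \<Rightarrow> real^4" where
  "hess a b = dir a (dir b \<phi>)"

definition II :: "real^2 \<Rightarrow> real^2 \<Rightarrow> real^2 \<Rightarrow> real^4" where
  "II a b u = normal (hess a b u) u"

definition lap :: "real^2 \<Rightarrow> real^2 \<Rightarrow> (real^2 \<Rightarrow> 'b::real_normed_vector) \<Rightarrow> real^2 \<Rightarrow> 'b" where
  "lap a b F u = dir (coords (hess a a u + hess b b u) u) F u - dir a (dir a F) u - dir b (dir b F) u"

definition mu :: "real^2 \<Rightarrow> real^2 \<Rightarrow> real^2 \<Rightarrow> real^4^4" where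
  "mu a b u = (1 / sqrt (gram a b u)) *\<^sub>R wedge (dir a \<phi> u) (dir b \<phi> u)"

definition sff_norm_sq :: "real^2 \<Rightarrow> real^2 \<Rightarrow> real^2 \<Rightarrow> real" where
  "sff_norm_sq a b u = mink (II a a u) (II a a u) + 2 * mink (II a b u) (II a b u) + mink (II b b u) (II b b u)"

lemma smooth_hess: "smooth_on U (hess a b)"
  unfolding hess_def by (intro smooth_on_dir smooth)

lemma II_commute: "u \<in> U \<Longrightarrow> II a b u = II b a u"
  by (simp add: II_def hess_def second_commute)

lemma II_linear:
  assumes "u \<in> U"
  shows "II a (x *\<^sub>R b + y *\<^sub>R c) u = x *\<^sub>R II a b u + y *\<^sub>R II a c u"
    "II (x *\<^sub>R b + y *\<^sub>R c) a u = x *\<^sub>R II b a u + y *\<^sub>R II c a u"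
  by (simp_all add: II_def hess_def dir_dir_add_right[OF assms] dir_dir_add_left[OF assms] normal_simps[OF assms])

text \<open>It turns a derivative of \<open>hess a a\<close> along \<open>c\<close> into
  \<open>dir a (hess a c)\<close>, the third derivative that occurs in the Laplacian of
  \<open>dir c \<phi>\<close>.\<close>

lemma third_commute:
  assumes "u \<in> U"
  shows "dir c (hess a b) u = dir a (dir b (dir c \<phi>)) u"
proof -
  have "dir c (hess a b) u = dir a (dir c (dir b \<phi>)) u"
    unfolding hess_def by (rule dir_commute[OF open_U assms smooth_on_dir[OF smooth]])
  also have "\<dots> = dir a (dir b (dir c \<phi>)) u"
    by (rule dir_cong_open[OF open_U assms second_commute
        smooth_on_differentiable[OF smooth_on_dir[OF smooth_on_dir[OF smooth]] assms]])
  finally show ?thesis .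
qed

lemma orthonormal_area:
  assumes "u \<in> U" "orthonormal a b u"
  shows "area a b \<noteq> 0"
proof
  assume "area a b = 0"
  \<comment> \<open>If the area vanished, the Cramer identity would be a linear relation for every
    \<open>v\<close>. Pairing it with \<open>a\<close> leaves \<open>area v b = 0\<close> for all
    \<open>v\<close>, hence \<open>b = 0\<close>, against unit length.\<close>
  then have 0: "area v b *\<^sub>R a + area a v *\<^sub>R b = 0" for v using area_cramer[of a b v] by simp
  have "area v b = 0" for v
  proof -
    have "0 = mink (dir (area v b *\<^sub>R a + area a v *\<^sub>R b) \<phi> u) (dir a \<phi> u)"
      using 0 linear_0[OF lin[OF assms(1)]] by (simp add: mink_simps)
    also have "\<dots> = area v b * g a a u + area a v * g a b u"
      by (simp only: dir_phi_simps[OF assms(1)] mink_simps g_def mink_commute[of "dir b \<phi> u"]) simp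
    finally show ?thesis using assms(2) by (simp add: orthonormal_def)
  qed
  from this[of E1] this[of E2] have "b = 0" by (simp add: area_def axis_def vec_eq_iff forall_2)
  then show False using assms(2) linear_0[OF lin[OF assms(1)]]
    by (simp add: orthonormal_def g_def mink_simps)
qed

lemma basis_expand:
  assumes "area a b \<noteq> 0"
  obtains x y where "v = x *\<^sub>R a + y *\<^sub>R b"
proof
  show "v = (area v b / area a b) *\<^sub>R a + (area a v / area a b) *\<^sub>R b"
    using arg_cong[OF area_cramer[of a b v], of "\<lambda>w. (1 / area a b) *\<^sub>R w"] assms
    by (simp add: scaleR_add_right)
qed

lemma coords_orthonormal:
  assumes "u \<in> U" "orthonormal a b u"
  shows "coords w u = mink w (dir a \<phi> u) *\<^sub>R a + mink w (dir b \<phi> u) *\<^sub>R b"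
proof (rule coords_unique[OF assms(1)])
  fix v
  obtain x y where v: "v = x *\<^sub>R a + y *\<^sub>R b" using basis_expand[OF orthonormal_area[OF assms]] .
  show "mink (w - dir (mink w (dir a \<phi> u) *\<^sub>R a + mink w (dir b \<phi> u) *\<^sub>R b) \<phi> u) (dir v \<phi> u) = 0"
    unfolding v dir_phi_simps[OF assms(1)] using assms(2) mink_commute[of "dir b \<phi> u" "dir a \<phi> u"]
    by (simp add: mink_simps orthonormal_def g_def algebra_simps)
qed

lemma orthonormal_expand:
  assumes "u \<in> U" "orthonormal a b u"
  shows "w = mink w (dir a \<phi> u) *\<^sub>R dir a \<phi> u + mink w (dir b \<phi> u) *\<^sub>R dir b \<phi> u + normal w u"
  unfolding normal_def coords_orthonormal[OF assms] dir_phi_simps[OF assms(1)] by simp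

text \<open>The left side is the metric trace of \<open>B\<close> multiplied by the Gram
  determinant, written with cofactors of the metric. Expressing \<open>c\<close> and
  \<open>d\<close> in the orthonormal pair makes the claim a polynomial identity in four
  coefficients.\<close>

lemma trace_change_basis:
  fixes B :: "real^2 \<Rightarrow> real^2 \<Rightarrow> 'v::euclidean_space"
  assumes "u \<in> U" "orthonormal a b u"
    and B: "\<And>x y v w z. B (x *\<^sub>R v + y *\<^sub>R w) z = x *\<^sub>R B v z + y *\<^sub>R B w z"
    and s: "\<And>v w. B v w = B w v"
  shows "g d d u *\<^sub>R B c c - (2 * g c d u) *\<^sub>R B c d + g c c u *\<^sub>R B d d = gram c d u *\<^sub>R (B a a + B b b)"
proof -
  obtain p q where c: "c = p *\<^sub>R a + q *\<^sub>R b" using basis_expand[OF orthonormal_area[OF assms(1,2)]] .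
  obtain r t where d: "d = r *\<^sub>R a + t *\<^sub>R b" using basis_expand[OF orthonormal_area[OF assms(1,2)]] .
  have B': "B z (x *\<^sub>R v + y *\<^sub>R w) = x *\<^sub>R B z v + y *\<^sub>R B z w" for x y v w z
    using B s by metis
  have g: "g (x *\<^sub>R a + y *\<^sub>R b) (x' *\<^sub>R a + y' *\<^sub>R b) u = x * x' + y * y'" for x y x' y'
    using assms(2) mink_commute[of "dir b \<phi> u" "dir a \<phi> u"]
    by (simp add: g_def orthonormal_def dir_phi_simps[OF assms(1)] mink_simps)
  show ?thesis
    unfolding gram_def c d g B B' s[of b a]
    by (rule euclidean_eqI) (simp add: inner_simps, algebra)
qed

lemma smooth_mu:
  assumes "area a b \<noteq> 0"
  shows "smooth_on U (mu a b)"
  unfolding mu_def[abs_def]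
  by (intro smooth_on_scaleR smooth_on_inverse_sqrt open_U smooth_gram
      smooth_on_bilinear[OF open_U bounded_bilinear_wedge smooth_on_dir[OF smooth] smooth_on_dir[OF smooth]])
    (use gram_pos assms in auto)

lemma biv_mink_mu:
  assumes "area a b \<noteq> 0" "v \<in> U"
  shows "biv_mink (mu a b v) (mu a b v) = 1"
proof -
  have "biv_mink (wedge (dir a \<phi> v) (dir b \<phi> v)) (wedge (dir a \<phi> v) (dir b \<phi> v)) = gram a b v"
    by (simp add: biv_mink_wedge gram_def g_def mink_commute)
  moreover have "(1 / sqrt (gram a b v)) * ((1 / sqrt (gram a b v)) * gram a b v) = 1"
    using gram_pos[OF assms(2,1)] by simp
  ultimately show ?thesis unfolding mu_def biv_mink_simps by simp
qed

text \<open>The derivative of the normalising factor is not computed from the square root but from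
  the fact that \<open>mu\<close> has constant length 1. It cancels the tangential parts of the
  Hessians, so that only normal parts survive in the derivative of \<open>mu\<close>.\<close>

lemma dir_mu:
  assumes "u \<in> U" "orthonormal a b u"
  shows "dir c (mu a b) u = wedge (II c a u) (dir b \<phi> u) + wedge (dir a \<phi> u) (II c b u)"
    "dir c (\<lambda>v. 1 / sqrt (gram a b v)) u
       = - (mink (hess c a u) (dir a \<phi> u) + mink (hess c b u) (dir b \<phi> u))"
    "dir c (\<lambda>v. wedge (dir a \<phi> v) (dir b \<phi> v)) u
       = wedge (hess c a u) (dir b \<phi> u) + wedge (dir a \<phi> u) (hess c b u)"
proof -
  note ar = orthonormal_area[OF assms]
  let ?J = "\<lambda>v. 1 / sqrt (gram a b v)" and ?N = "\<lambda>v. wedge (dir a \<phi> v) (dir b \<phi> v)"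
  note d = smooth_on_differentiable[OF _ assms(1)]
  have sJ: "smooth_on U ?J"
    using gram_pos ar by (intro smooth_on_inverse_sqrt open_U smooth_gram) auto
  have sN: "smooth_on U ?N"
    by (rule smooth_on_bilinear[OF open_U bounded_bilinear_wedge smooth_on_dir[OF smooth] smooth_on_dir[OF smooth]])
  have J1: "?J u = 1" using assms(2) by (simp add: gram_def orthonormal_def)
  have o: "mink (dir a \<phi> u) (dir a \<phi> u) = 1" "mink (dir b \<phi> u) (dir b \<phi> u) = 1"
    "mink (dir a \<phi> u) (dir b \<phi> u) = 0" "mink (dir b \<phi> u) (dir a \<phi> u) = 0"
    using assms(2) mink_commute[of "dir b \<phi> u" "dir a \<phi> u"] by (auto simp: orthonormal_def g_def)
  show dN: "dir c ?N u = wedge (hess c a u) (dir b \<phi> u) + wedge (dir a \<phi> u) (hess c b u)"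
    unfolding hess_def
    by (rule dir_bilinear[OF bounded_bilinear_wedge d[OF smooth_on_dir[OF smooth]] d[OF smooth_on_dir[OF smooth]]])
  have dmu: "dir c (mu a b) u = dir c ?J u *\<^sub>R ?N u + dir c ?N u"
    using dir_bilinear[OF bounded_bilinear_scaleR d[OF sJ] d[OF sN]] J1 by (simp add: mu_def[abs_def])
  have m: "mu a b u = ?N u" using J1 by (simp add: mu_def)
  have "biv_mink (dir c (mu a b) u) (mu a b u) = 0"
    using dir_bilinear_const(1)[OF open_U assms(1) bounded_bilinear_biv_mink smooth_mu[OF ar] smooth_mu[OF ar] biv_mink_mu[OF ar], of c]
    by (simp add: biv_mink_def mult.commute)
  then show dJ: "dir c ?J u = - (mink (hess c a u) (dir a \<phi> u) + mink (hess c b u) (dir b \<phi> u))"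
    unfolding dmu m dN by (simp add: biv_mink_simps biv_mink_wedge o)
  show "dir c (mu a b) u = wedge (II c a u) (dir b \<phi> u) + wedge (dir a \<phi> u) (II c b u)"
  proof -
    have "wedge (hess c a u) (dir b \<phi> u) = mink (hess c a u) (dir a \<phi> u) *\<^sub>R ?N u + wedge (II c a u) (dir b \<phi> u)"
      by (subst orthonormal_expand[OF assms, of "hess c a u"]) (simp add: wedge_simps II_def)
    moreover have "wedge (dir a \<phi> u) (hess c b u) = mink (hess c b u) (dir b \<phi> u) *\<^sub>R ?N u + wedge (dir a \<phi> u) (II c b u)"
      by (subst orthonormal_expand[OF assms, of "hess c b u"]) (simp add: wedge_simps II_def)
    ultimately show ?thesis unfolding dmu dN dJ by (simp add: scaleR_add_left algebra_simps)
  qed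
qed

lemma dir_mu_norm:
  assumes "u \<in> U" "orthonormal a b u"
  shows "biv_mink (dir a (mu a b) u) (dir a (mu a b) u) + biv_mink (dir b (mu a b) u) (dir b (mu a b) u)
    = sff_norm_sq a b u"
proof -
  have o: "mink (dir a \<phi> u) (dir a \<phi> u) = 1" "mink (dir b \<phi> u) (dir b \<phi> u) = 1"
    "mink (dir a \<phi> u) (dir b \<phi> u) = 0" "mink (dir b \<phi> u) (dir a \<phi> u) = 0"
    using assms(2) mink_commute[of "dir b \<phi> u" "dir a \<phi> u"] by (auto simp: orthonormal_def g_def)
  have n: "mink (II c d u) (dir x \<phi> u) = 0" "mink (dir x \<phi> u) (II c d u) = 0" for c d x
    using normal_orth[OF assms(1)] by (simp_all add: II_def mink_commute)
  show ?thesis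
    unfolding dir_mu(1)[OF assms] sff_norm_sq_def II_commute[OF assms(1), of b a]
    by (simp add: biv_mink_simps biv_mink_wedge o n)
qed

text \<open>By \<open>trace_change_basis\<close> this is the vanishing of the mean curvature
  multiplied by a Gram determinant. It refers to all directions and points, hence can be
  differentiated while \<open>a\<close> and \<open>b\<close> stay constant.\<close>

definition maximal :: bool where
  "maximal \<longleftrightarrow> (\<forall>u\<in>U. \<forall>a b.
     g b b u *\<^sub>R II a a u - (2 * g a b u) *\<^sub>R II a b u + g a a u *\<^sub>R II b b u = 0)"

lemma maximal_orthonormal:
  assumes "maximal" "u \<in> U" "orthonormal a b u"
  shows "II b b u = - II a a u"
  using assms unfolding maximal_def orthonormal_def
  by (metis (no_types, lifting) add.commute add_eq_0_iff diff_zero mult_zero_right scaleR_one scale_zero_left)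

lemma dir_g: "u \<in> U \<Longrightarrow> dir c (g a b) u = mink (hess c a u) (dir b \<phi> u) + mink (dir a \<phi> u) (hess c b u)"
  unfolding g_def[abs_def] hess_def
  by (rule dir_bilinear[OF bounded_bilinear_mink]) (rule smooth_on_differentiable[OF smooth_on_dir[OF smooth]], assumption)+

lemma codazzi:
  assumes "maximal" "u \<in> U" "orthonormal a b u"
  shows "normal (dir a (hess a c) u + dir b (hess b c) u) u =
     mink (hess a a u + hess b b u) (dir a \<phi> u) *\<^sub>R II c a u
     + mink (hess a a u + hess b b u) (dir b \<phi> u) *\<^sub>R II c b u
     - ((2 * mink (hess c b u) (dir b \<phi> u)) *\<^sub>R II a a u
        - (2 * (mink (hess c a u) (dir b \<phi> u) + mink (hess c b u) (dir a \<phi> u))) *\<^sub>R II a b u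
        + (2 * mink (hess c a u) (dir a \<phi> u)) *\<^sub>R II b b u)"
proof -
  note d = smooth_on_differentiable[OF _ assms(2)]
  have o: "g a a u = 1" "g b b u = 1" "g a b u = 0"
    using assms(3) by (auto simp: orthonormal_def)
  let ?V = "\<lambda>v. g b b v *\<^sub>R hess a a v - (2 * g a b v) *\<^sub>R hess a b v + g a a v *\<^sub>R hess b b v"
  have sV: "smooth_on U ?V"
    by (intro smooth_on_add smooth_on_diff smooth_on_scaleR smooth_on_mult smooth_on_const smooth_g smooth_hess open_U)
  have "normal (?V v) v = 0" if "v \<in> U" for v
    using assms(1) that unfolding maximal_def II_def by (simp add: normal_simps[OF that])
  then have V: "?V v = dir (coords (?V v) v) \<phi> v" if "v \<in> U" for v
    using that unfolding normal_def by simp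
  have sc: "smooth_on U (\<lambda>v. coords (?V v) v)"
    by (rule smooth_coords[OF open_U order_refl sV])
  have cu: "coords (?V u) u = mink (hess a a u + hess b b u) (dir a \<phi> u) *\<^sub>R a + mink (hess a a u + hess b b u) (dir b \<phi> u) *\<^sub>R b"
    using coords_orthonormal[OF assms(2,3)] by (simp add: o)
  have "dir c ?V u = dir c (\<lambda>v. dir (coords (?V v) v) \<phi> v) u"
    by (rule dir_cong_open[OF open_U assms(2) _ d[OF sV]]) (rule V)
  also have "\<dots> = dir c (dir (coords (?V u) u) \<phi>) u + dir (dir c (\<lambda>v. coords (?V v) v) u) \<phi> u"
    by (rule dir_dir_var[OF open_U assms(2) smooth sc])
  \<comment> \<open>The derivative of the coordinate field enters as a directional derivative of
    \<phi>; it is tangent and is removed by \<open>normal\<close>.\<close>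
  finally have "normal (dir c ?V u) u = II c (coords (?V u) u) u"
    by (simp add: normal_simps[OF assms(2)] normal_dir[OF assms(2)] II_def hess_def)
  also have "\<dots> = mink (hess a a u + hess b b u) (dir a \<phi> u) *\<^sub>R II c a u
     + mink (hess a a u + hess b b u) (dir b \<phi> u) *\<^sub>R II c b u"
    unfolding cu by (rule II_linear(1)[OF assms(2)])
  finally have 1: "normal (dir c ?V u) u = \<dots>" .
  have s: "smooth_on U (\<lambda>v. g p q v *\<^sub>R hess p' q' v)" for p q p' q'
    by (intro smooth_on_scaleR smooth_g smooth_hess open_U)
  have s2: "smooth_on U (\<lambda>v. 2 *\<^sub>R (g p q v *\<^sub>R hess p' q' v))" for p q p' q'
    by (intro smooth_on_scaleR s smooth_on_const open_U)
  have pr: "dir c (\<lambda>v. g p q v *\<^sub>R hess p' q' v) u = dir c (g p q) u *\<^sub>R hess p' q' u + g p q u *\<^sub>R dir c (hess p' q') u" for p q p' q'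
    by (rule dir_bilinear[OF bounded_bilinear_scaleR d[OF smooth_g] d[OF smooth_hess]])
  have "dir c ?V u = dir c (\<lambda>v. g b b v *\<^sub>R hess a a v - 2 *\<^sub>R (g a b v *\<^sub>R hess a b v) + g a a v *\<^sub>R hess b b v) u"
    by simp
  also have "\<dots> = dir c (\<lambda>v. g b b v *\<^sub>R hess a a v) u - dir c (\<lambda>v. 2 *\<^sub>R (g a b v *\<^sub>R hess a b v)) u
      + dir c (\<lambda>v. g a a v *\<^sub>R hess b b v) u"
    by (simp only: dir_add[OF d[OF smooth_on_diff[OF open_U s s2]] d[OF s]] dir_diff[OF d[OF s] d[OF s2]])
  also have "\<dots> = dir c (\<lambda>v. g b b v *\<^sub>R hess a a v) u - 2 *\<^sub>R dir c (\<lambda>v. g a b v *\<^sub>R hess a b v) u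
      + dir c (\<lambda>v. g a a v *\<^sub>R hess b b v) u"
    by (simp only: dir_linear[OF bounded_linear_scaleR_right d[OF s]])
  \<comment> \<open>At \<open>u\<close> the undifferentiated metric coefficients are 1, 0, 1, so of
    the third derivatives only their trace remains.\<close>
  also have "\<dots> = dir c (g b b) u *\<^sub>R hess a a u - 2 *\<^sub>R (dir c (g a b) u *\<^sub>R hess a b u) + dir c (g a a) u *\<^sub>R hess b b u
      + (dir c (hess a a) u + dir c (hess b b) u)"
    by (simp add: pr o)
  finally have 2: "normal (dir c ?V u) u = dir c (g b b) u *\<^sub>R II a a u - 2 *\<^sub>R (dir c (g a b) u *\<^sub>R II a b u) + dir c (g a a) u *\<^sub>R II b b u
      + normal (dir a (hess a c) u + dir b (hess b c) u) u"
    by (simp add: normal_simps[OF assms(2)] II_def third_commute[OF assms(2)] hess_def[of a c] hess_def[of b c])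
  have dg: "dir c (g b b) u = 2 * mink (hess c b u) (dir b \<phi> u)"
    "dir c (g a b) u = mink (hess c a u) (dir b \<phi> u) + mink (hess c b u) (dir a \<phi> u)"
    "dir c (g a a) u = 2 * mink (hess c a u) (dir a \<phi> u)"
    by (simp_all add: dir_g[OF assms(2)] mink_commute)
  show ?thesis using 1 2 unfolding dg by (simp add: algebra_simps)
qed

theorem lap_mu:
  assumes "maximal" "u \<in> U" "orthonormal a b u"
  shows "lap a b (mu a b) u = sff_norm_sq a b u *\<^sub>R mu a b u - 4 *\<^sub>R wedge (II a a u) (II a b u)"
proof -
  note d = smooth_on_differentiable[OF _ assms(2)]
  note ar = orthonormal_area[OF assms(2,3)]
  have o: "mink (dir a \<phi> u) (dir a \<phi> u) = 1" "mink (dir b \<phi> u) (dir b \<phi> u) = 1"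
    "mink (dir a \<phi> u) (dir b \<phi> u) = 0" "mink (dir b \<phi> u) (dir a \<phi> u) = 0"
    using assms(3) mink_commute[of "dir b \<phi> u" "dir a \<phi> u"] by (auto simp: orthonormal_def g_def)
  have n: "mink (II c d u) (dir x \<phi> u) = 0" "mink (dir x \<phi> u) (II c d u) = 0" for c d x
    using normal_orth[OF assms(2)] by (simp_all add: II_def mink_commute)
  let ?J = "\<lambda>v. 1 / sqrt (gram a b v)" and ?N = "\<lambda>v. wedge (dir a \<phi> v) (dir b \<phi> v)"
  have sJ: "smooth_on U ?J"
    using gram_pos ar by (intro smooth_on_inverse_sqrt open_U smooth_gram) auto
  have sN: "smooth_on U ?N"
    by (rule smooth_on_bilinear[OF open_U bounded_bilinear_wedge smooth_on_dir[OF smooth] smooth_on_dir[OF smooth]])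
  have J1: "?J u = 1" using assms(3) by (simp add: gram_def orthonormal_def)
  have m: "mu a b u = ?N u" using J1 by (simp add: mu_def)
  have ddN: "dir c (dir c ?N) u = wedge (dir c (hess c a) u) (dir b \<phi> u)
      + 2 *\<^sub>R wedge (hess c a u) (hess c b u) + wedge (dir a \<phi> u) (dir c (hess c b) u)" for c
    unfolding hess_def
    by (rule dir_dir_bilinear[OF open_U assms(2) bounded_bilinear_wedge smooth_on_dir[OF smooth] smooth_on_dir[OF smooth]])
  have ddmu: "dir c (dir c (mu a b)) u = dir c (dir c ?J) u *\<^sub>R ?N u + 2 *\<^sub>R (dir c ?J u *\<^sub>R dir c ?N u)
      + dir c (dir c ?N) u" for c
    using dir_dir_bilinear[OF open_U assms(2) bounded_bilinear_scaleR sJ sN, of c] J1 by (simp add: mu_def[abs_def])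
  have dmu: "dir c (mu a b) u = dir c ?J u *\<^sub>R ?N u + dir c ?N u" for c
    using dir_bilinear[OF bounded_bilinear_scaleR d[OF sJ] d[OF sN]] J1 by (simp add: mu_def[abs_def])
  define s where "s c e = mink (hess c e u) (dir a \<phi> u)" for c e
  define t where "t c e = mink (hess c e u) (dir b \<phi> u)" for c e
  have bb: "II b b u = - II a a u" by (rule maximal_orthonormal[OF assms])
  have hba: "hess b a u = hess a b u" using second_commute[OF assms(2)] by (simp add: hess_def)
  note ex = orthonormal_expand[OF assms(2,3)]
  have haa: "hess a a u = s a a *\<^sub>R dir a \<phi> u + t a a *\<^sub>R dir b \<phi> u + II a a u"
    and hab: "hess a b u = s a b *\<^sub>R dir a \<phi> u + t a b *\<^sub>R dir b \<phi> u + II a b u"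
    and hbb: "hess b b u = s b b *\<^sub>R dir a \<phi> u + t b b *\<^sub>R dir b \<phi> u - II a a u"
    using ex[of "hess a a u"] ex[of "hess a b u"] ex[of "hess b b u"] bb
    by (auto simp: s_def t_def II_def)
  \<comment> \<open>By symmetry of third derivatives this is the sum of the second derivatives of
    \<open>dir c \<phi>\<close> along \<open>a\<close> and \<open>b\<close>; \<open>codazzi\<close>
    gives its normal part.\<close>
  define K where "K c = dir a (hess a c) u + dir b (hess b c) u" for c
  have al: "mink (hess a a u + hess b b u) (dir a \<phi> u) = s a a + s b b"
    "mink (hess a a u + hess b b u) (dir b \<phi> u) = t a a + t b b"
    by (simp_all add: s_def t_def mink_simps)
  note cod = codazzi[OF assms, folded K_def, unfolded al, folded s_def t_def]
  have IIba: "II b a u = II a b u" by (rule II_commute[OF assms(2)])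
  have sba: "s b a = s a b" "t b a = t a b" by (simp_all add: s_def t_def hba)
  define x where "x c = mink (K c) (dir a \<phi> u)" for c
  define y where "y c = mink (K c) (dir b \<phi> u)" for c
  have Ka: "K a = x a *\<^sub>R dir a \<phi> u + y a *\<^sub>R dir b \<phi> u + ((s a a + s b b) *\<^sub>R II a a u + (t a a + t b b) *\<^sub>R II a b u
      - ((2 * t a b) *\<^sub>R II a a u - (2 * (t a a + s a b)) *\<^sub>R II a b u - (2 * s a a) *\<^sub>R II a a u))"
    using ex[of "K a"] cod[of a] by (simp add: x_def y_def bb)
  have Kb: "K b = x b *\<^sub>R dir a \<phi> u + y b *\<^sub>R dir b \<phi> u + ((s a a + s b b) *\<^sub>R II a b u - (t a a + t b b) *\<^sub>R II a a u
      - ((2 * t b b) *\<^sub>R II a a u - (2 * (t a b + s b b)) *\<^sub>R II a b u - (2 * s a b) *\<^sub>R II a a u))"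
    using ex[of "K b"] cod[of b] by (simp add: x_def y_def bb IIba sba)
  define jj where "jj = dir a (dir a ?J) u + dir b (dir b ?J) u"
  have dJ: "dir a ?J u = - (s a a + t a b)" "dir b ?J u = - (s a b + t b b)"
    using dir_mu(2)[OF assms(2,3), of a] dir_mu(2)[OF assms(2,3), of b] by (simp_all add: s_def t_def hba)
  have dN: "dir a ?N u = wedge (hess a a u) (dir b \<phi> u) + wedge (dir a \<phi> u) (hess a b u)"
    "dir b ?N u = wedge (hess a b u) (dir b \<phi> u) + wedge (dir a \<phi> u) (hess b b u)"
    using dir_mu(3)[OF assms(2,3), of a] dir_mu(3)[OF assms(2,3), of b] by (simp_all add: hba)
  have cc: "coords (hess a a u + hess b b u) u = (s a a + s b b) *\<^sub>R a + (t a a + t b b) *\<^sub>R b"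
    using coords_orthonormal[OF assms(2,3)] by (simp add: al)
  have lm: "linear (\<lambda>v. dir v (mu a b) u)" by (rule linear_dir[OF d[OF smooth_mu[OF ar]]])
  have dc: "dir (coords (hess a a u + hess b b u) u) (mu a b) u
      = (s a a + s b b) *\<^sub>R dir a (mu a b) u + (t a a + t b b) *\<^sub>R dir b (mu a b) u"
    unfolding cc using linear_add[OF lm] linear_scale[OF lm] by simp
  have "lap a b (mu a b) u =
     (s a a + s b b) *\<^sub>R (- (s a a + t a b) *\<^sub>R ?N u + (wedge (hess a a u) (dir b \<phi> u) + wedge (dir a \<phi> u) (hess a b u)))
     + (t a a + t b b) *\<^sub>R (- (s a b + t b b) *\<^sub>R ?N u + (wedge (hess a b u) (dir b \<phi> u) + wedge (dir a \<phi> u) (hess b b u)))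
     - (jj *\<^sub>R ?N u + (2 * - (s a a + t a b)) *\<^sub>R (wedge (hess a a u) (dir b \<phi> u) + wedge (dir a \<phi> u) (hess a b u))
         + (2 * - (s a b + t b b)) *\<^sub>R (wedge (hess a b u) (dir b \<phi> u) + wedge (dir a \<phi> u) (hess b b u))
         + wedge (K a) (dir b \<phi> u) + wedge (dir a \<phi> u) (K b)
         + 2 *\<^sub>R (wedge (hess a a u) (hess a b u) + wedge (hess a b u) (hess b b u)))"
    unfolding lap_def dc ddmu ddN dmu[of a] dmu[of b] dJ dN jj_def K_def wedge_simps hba
    by (simp add: scaleR_add_right scaleR_add_left)
  \<comment> \<open>From the identity only the shape of the result is taken. The scalar
    \<open>l\<close>, which contains second derivatives of the normalising factor and tangential
    parts of \<open>K\<close>, is found below by pairing with \<open>mu\<close>.\<close>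
  then obtain l where l: "lap a b (mu a b) u = l *\<^sub>R ?N u - 4 *\<^sub>R wedge (II a a u) (II a b u)"
    unfolding haa hab hbb Ka Kb laplacian_wedge_identity by blast
  have sym: "biv_mink A B = biv_mink B A" for A B by (simp add: biv_mink_def mult.commute)
  have z1: "biv_mink (dir c (mu a b) u) (mu a b u) = 0" for c
    using dir_bilinear_const(1)[OF open_U assms(2) bounded_bilinear_biv_mink smooth_mu[OF ar] smooth_mu[OF ar] biv_mink_mu[OF ar], of c]
    by (simp add: sym[of "mu a b u"])
  \<comment> \<open>Here the squared norm of the second fundamental form enters: constant length
    converts second derivatives of \<open>mu\<close> into squares of first ones, summed in
    \<open>dir_mu_norm\<close>.\<close>
  have z2: "biv_mink (dir c (dir c (mu a b)) u) (mu a b u) = - biv_mink (dir c (mu a b) u) (dir c (mu a b) u)" for c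
    using dir_bilinear_const(2)[OF open_U assms(2) bounded_bilinear_biv_mink smooth_mu[OF ar] smooth_mu[OF ar] biv_mink_mu[OF ar], of c]
    by (simp add: sym[of "mu a b u"])
  have "biv_mink (lap a b (mu a b) u) (mu a b u) = sff_norm_sq a b u"
    unfolding lap_def biv_mink_simps z1 z2 using dir_mu_norm[OF assms(2,3)] by simp
  moreover have "biv_mink (lap a b (mu a b) u) (mu a b u) = l"
    unfolding l m by (simp add: biv_mink_simps biv_mink_wedge o n)
  ultimately show ?thesis using l m by simp
qed

section \<open>Independence of the directions, and smoothness of the squared norm\<close>

lemma wedge_dir:
  assumes "u \<in> U"
  shows "wedge (dir a \<phi> u) (dir b \<phi> u) = area a b *\<^sub>R wedge (dir E1 \<phi> u) (dir E2 \<phi> u)"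
proof -
  have "dir c \<phi> u = c$1 *\<^sub>R dir E1 \<phi> u + c$2 *\<^sub>R dir E2 \<phi> u" for c
    by (subst E_expand[of c]) (simp only: dir_phi_simps[OF assms])
  from this[of a] this[of b] show ?thesis
    by (simp add: wedge_simps area_def wedge_flip[of "dir E2 \<phi> u" "dir E1 \<phi> u"] scaleR_diff_left mult.commute)
qed

lemma gram_area:
  assumes "u \<in> U"
  shows "gram a b u = (area a b)\<^sup>2 * gram E1 E2 u"
proof -
  have G: "gram c d u = biv_mink (wedge (dir c \<phi> u) (dir d \<phi> u)) (wedge (dir c \<phi> u) (dir d \<phi> u))" for c d
    by (simp add: biv_mink_wedge gram_def g_def mink_commute)
  show ?thesis unfolding G wedge_dir[OF assms, of a b] by (simp add: biv_mink_simps power2_eq_square)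
qed

text \<open>A change of directions multiplies the wedge by the area and the square root by its
  absolute value, so only the orientation matters. Since the equality holds throughout the chart, it
  may be differentiated.\<close>

lemma mu_area_pos:
  assumes "u \<in> U" "area a b > 0"
  shows "mu a b u = mu E1 E2 u"
proof -
  have "sqrt (gram a b u) = area a b * sqrt (gram E1 E2 u)"
    unfolding gram_area[OF assms(1), of a b] using assms(2) by (simp add: real_sqrt_mult)
  then show ?thesis unfolding mu_def using wedge_dir[OF assms(1), of a b] assms(2) by simp
qed

lemma mu_orthonormal: "orthonormal a b u \<Longrightarrow> mu a b u = wedge (dir a \<phi> u) (dir b \<phi> u)"
  by (simp add: mu_def gram_def orthonormal_def)

text \<open>
  The squared length of \<open>d\<mu>\<close>, an expression for \<open>\<parallel>h\<parallel>\<^sup>2\<close> that is visibly smooth since it uses no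
  orthonormal frame.
\<close>

definition sff_trace :: "real^2 \<Rightarrow> real" where
  "sff_trace u = (1 / gram E1 E2 u) *
     (g E2 E2 u * biv_mink (dir E1 (mu E1 E2) u) (dir E1 (mu E1 E2) u)
      - 2 * g E1 E2 u * biv_mink (dir E1 (mu E1 E2) u) (dir E2 (mu E1 E2) u)
      + g E1 E1 u * biv_mink (dir E2 (mu E1 E2) u) (dir E2 (mu E1 E2) u))"

lemma smooth_sff_trace: "smooth_on U sff_trace"
proof -
  have s: "smooth_on U (\<lambda>u. biv_mink (dir c (mu E1 E2) u) (dir d (mu E1 E2) u))" for c d
    by (rule smooth_on_bilinear[OF open_U bounded_bilinear_biv_mink smooth_on_dir[OF smooth_mu] smooth_on_dir[OF smooth_mu]])
      (simp_all add: area_E)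
  have i: "smooth_on U (\<lambda>u. 1 / gram E1 E2 u)"
    by (rule smooth_on_inverse[OF open_U smooth_gram gram_pos]) (simp_all add: area_E)
  show ?thesis unfolding sff_trace_def[abs_def]
    by (intro smooth_on_mult smooth_on_add smooth_on_diff i s smooth_g smooth_on_const open_U)
qed

lemma dir_mu_area_pos:
  assumes "u \<in> U" "area a b > 0"
  shows "dir c (mu a b) u = dir c (mu E1 E2) u"
  using assms by (intro dir_cong_open[OF open_U assms(1)] mu_area_pos smooth_on_differentiable[OF smooth_mu]) auto

lemma sff_trace_eq:
  assumes "u \<in> U" "orthonormal a b u" "area a b > 0"
  shows "sff_trace u = sff_norm_sq a b u"
proof -
  let ?B = "\<lambda>c d. biv_mink (dir c (mu E1 E2) u) (dir d (mu E1 E2) u)"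
  have l: "linear (\<lambda>v. dir v (mu E1 E2) u)"
    by (rule linear_dir[OF smooth_on_differentiable[OF smooth_mu assms(1)]]) (simp add: area_E)
  have sym: "biv_mink A B = biv_mink B A" for A B by (simp add: biv_mink_def mult.commute)
  have "g E2 E2 u *\<^sub>R ?B E1 E1 - (2 * g E1 E2 u) *\<^sub>R ?B E1 E2 + g E1 E1 u *\<^sub>R ?B E2 E2 = gram E1 E2 u *\<^sub>R (?B a a + ?B b b)"
    by (rule trace_change_basis[OF assms(1,2)])
      (auto simp: linear_add[OF l] linear_scale[OF l] biv_mink_simps sym)
  moreover have "?B a a + ?B b b = sff_norm_sq a b u"
    using dir_mu_norm[OF assms(1,2)] unfolding dir_mu_area_pos[OF assms(1,3)] .
  moreover have "gram E1 E2 u > 0" using gram_pos[OF assms(1)] by (simp add: area_E)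
  ultimately show ?thesis by (simp add: sff_trace_def)
qed

text \<open>One orthonormal pair at each point is enough, as the cofactor expression in any other
  directions is a multiple of the trace in this pair.\<close>

lemma maximalI:
  assumes "\<And>u. u \<in> U \<Longrightarrow> \<exists>a b. orthonormal a b u \<and> II a a u + II b b u = 0"
  shows "maximal"
  unfolding maximal_def
proof (intro ballI allI)
  fix u c d assume u: "u \<in> U"
  obtain a b where ab: "orthonormal a b u" "II a a u + II b b u = 0" using assms[OF u] by blast
  have "g d d u *\<^sub>R II c c u - (2 * g c d u) *\<^sub>R II c d u + g c c u *\<^sub>R II d d u = gram c d u *\<^sub>R (II a a u + II b b u)"
    by (rule trace_change_basis[OF u ab(1), of "\<lambda>v w. II v w u"])
      (auto simp: II_linear[OF u] II_commute[OF u])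
  then show "g d d u *\<^sub>R II c c u - (2 * g c d u) *\<^sub>R II c d u + g c c u *\<^sub>R II d d u = 0"
    using ab(2) by simp
qed

text \<open>The Ricci equation for a maximal surface. \<open>c\<close> and \<open>d\<close> are
  coordinate expressions of two tangent fields, and the third term on the left is the one of their
  Lie bracket.\<close>

lemma normal_curvature_formula:
  assumes "maximal" "open V" "V \<subseteq> U" "u \<in> V" "orthonormal a b u"
    and \<xi>: "smooth_on V \<xi>" "\<And>v x. v \<in> V \<Longrightarrow> mink (\<xi> v) (dir x \<phi> v) = 0"
    and c: "smooth_on V c" and d: "smooth_on V d"
  shows "normal (dir (c u) (\<lambda>v. normal (dir (d v) \<xi> v) v) u) u
     - normal (dir (d u) (\<lambda>v. normal (dir (c v) \<xi> v) v) u) u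
     - normal (dir (dir (c u) d u - dir (d u) c u) \<xi> u) u
    = (2 * (g (c u) a u * g (d u) b u - g (c u) b u * g (d u) a u)) *\<^sub>R
        contract (wedge (II a a u) (II a b u)) (\<xi> u)"
proof -
  have u: "u \<in> U" using assms(3,4) by auto
  note df = smooth_on_differentiable[OF _ assms(4)]
  have phi: "smooth_on V \<phi>" by (rule smooth_on_subset[OF smooth assms(3)])
  \<comment> \<open>Differentiating the subtracted tangential projection contributes the last term.
    In the difference of the two orders the second derivatives of \<xi> cancel by symmetry and the
    terms with derivatives of \<open>c\<close>, \<open>d\<close> against the bracket.\<close>
  have key: "normal (dir (c u) (\<lambda>v. normal (dir (d v) \<xi> v) v) u) u
      = normal (dir (c u) (dir (d u) \<xi>) u) u + normal (dir (dir (c u) d u) \<xi> u) u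
        - II (c u) (coords (dir (d u) \<xi> u) u) u"
    if c: "smooth_on V c" and d: "smooth_on V d" for c d
  proof -
    have s1: "smooth_on V (\<lambda>v. dir (d v) \<xi> v)" by (rule smooth_on_dir_var[OF assms(2) \<xi>(1) d])
    have s2: "smooth_on V (\<lambda>v. coords (dir (d v) \<xi> v) v)" by (rule smooth_coords[OF assms(2,3) s1])
    have s3: "smooth_on V (\<lambda>v. dir (coords (dir (d v) \<xi> v) v) \<phi> v)" by (rule smooth_on_dir_var[OF assms(2) phi s2])
    have "dir (c u) (\<lambda>v. normal (dir (d v) \<xi> v) v) u
      = dir (c u) (\<lambda>v. dir (d v) \<xi> v) u - dir (c u) (\<lambda>v. dir (coords (dir (d v) \<xi> v) v) \<phi> v) u"
      unfolding normal_def by (rule dir_diff[OF df[OF s1] df[OF s3]])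
    also have "\<dots> = dir (c u) (dir (d u) \<xi>) u + dir (dir (c u) d u) \<xi> u
       - (dir (c u) (dir (coords (dir (d u) \<xi> u) u) \<phi>) u + dir (dir (c u) (\<lambda>v. coords (dir (d v) \<xi> v) v) u) \<phi> u)"
      by (simp only: dir_dir_var[OF assms(2,4) \<xi>(1) d] dir_dir_var[OF assms(2,4) phi s2])
    finally show ?thesis
      by (simp add: normal_simps[OF u] normal_dir[OF u] II_def hess_def)
  qed
  have lx: "linear (\<lambda>x. dir x \<xi> u)" by (rule linear_dir[OF df[OF \<xi>(1)]])
  \<comment> \<open>The Weingarten relation: differentiating the orthogonality of \<xi> and the
    tangent vectors identifies the tangential part of the derivative of \<xi> with minus the shape
    operator.\<close>
  have co: "coords (dir x \<xi> u) u = - (mink (\<xi> u) (II x a u) *\<^sub>R a + mink (\<xi> u) (II x b u) *\<^sub>R b)" for x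
  proof -
    have "mink (dir x \<xi> u) (dir y \<phi> u) = - mink (\<xi> u) (II x y u)" for y
    proof -
      have "dir x (\<lambda>v. mink (\<xi> v) (dir y \<phi> v)) u = mink (dir x \<xi> u) (dir y \<phi> u) + mink (\<xi> u) (hess x y u)"
        unfolding hess_def by (rule dir_bilinear[OF bounded_bilinear_mink df[OF \<xi>(1)] df[OF smooth_on_dir[OF phi]]])
      moreover have "dir x (\<lambda>v. mink (\<xi> v) (dir y \<phi> v)) u = dir x (\<lambda>v. 0) u"
        by (rule dir_cong_open[OF assms(2,4) \<xi>(2) df[OF smooth_on_bilinear[OF assms(2) bounded_bilinear_mink \<xi>(1) smooth_on_dir[OF phi]]]])
      moreover have "mink (\<xi> u) (hess x y u) = mink (\<xi> u) (II x y u)"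
        using mink_normal[OF u \<xi>(2)[OF assms(4)]] by (simp add: II_def mink_commute)
      ultimately show ?thesis by (simp add: dir_const)
    qed
    then show ?thesis unfolding coords_orthonormal[OF u assms(5)] by simp
  qed
  let ?P = "II a a u" and ?Q = "II a b u" and ?x = "\<xi> u"
  have exp: "v = g v a u *\<^sub>R a + g v b u *\<^sub>R b" for v
    using coords_orthonormal[OF u assms(5), of "dir v \<phi> u"] by (simp add: coords_dir[OF u] g_def)
  have cu: "c u = g (c u) a u *\<^sub>R a + g (c u) b u *\<^sub>R b" and du: "d u = g (d u) a u *\<^sub>R a + g (d u) b u *\<^sub>R b"
    using exp by auto
  obtain p q r t where pq: "c u = p *\<^sub>R a + q *\<^sub>R b" "d u = r *\<^sub>R a + t *\<^sub>R b"
    "p = g (c u) a u" "q = g (c u) b u" "r = g (d u) a u" "t = g (d u) b u"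
    using cu du by blast
  have neg: "II z (- w) u = - II z w u" for z w
    using II_linear(1)[OF u, of z "-1" w 0 w] by simp
  have "normal (dir (c u) (\<lambda>v. normal (dir (d v) \<xi> v) v) u) u
     - normal (dir (d u) (\<lambda>v. normal (dir (c v) \<xi> v) v) u) u
     - normal (dir (dir (c u) d u - dir (d u) c u) \<xi> u) u
    = II (d u) (coords (dir (c u) \<xi> u) u) u - II (c u) (coords (dir (d u) \<xi> u) u) u"
    unfolding key[OF c d] key[OF d c] linear_diff[OF lx] normal_simps[OF u]
      dir_commute[OF assms(2,4) \<xi>(1), of "d u" "c u"] by simp
  \<comment> \<open>Because II(b,b) = - II(a,a), the two shape operator terms contribute equally,
    whence the factor 2.\<close>
  also have "\<dots> = (2 * (p * t - q * r)) *\<^sub>R contract (wedge ?P ?Q) ?x"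
    unfolding co pq(1,2) II_linear[OF u] neg contract_wedge II_commute[OF u, of b a]
      maximal_orthonormal[OF assms(1) u assms(5)]
    by (rule euclidean_eqI) (simp add: inner_simps mink_simps mink_commute[of ?P ?x] mink_commute[of ?Q ?x], algebra)
  finally show ?thesis unfolding pq(3-6) .
qed

end

section \<open>Surfaces and charts\<close>

lemma area_linear: "area (M *v a) (M *v b) = det M * area a b"
  by (simp add: area_def det_2 matrix_vector_mult_def sum_2 algebra_simps)

locale spacelike_surface =
  fixes S :: "'m surface"
  assumes oriented: "oriented_surface S" and spacelike: "spacelike S"
begin

lemma chart_facts:
  assumes "(U, p) \<in> atlas S"
  shows "open U" "openin (surf_top S) (p ` U)"
    "homeomorphic_map (top_of_set U) (subtopology (surf_top S) (p ` U)) p"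
    "smooth_on U (immersion S \<circ> p)" "u \<in> U \<Longrightarrow> inj (frechet_derivative (immersion S \<circ> p) (at u))"
    "u \<in> U \<Longrightarrow> p u \<in> points S"
  using oriented assms openin_subset unfolding oriented_surface_def oriented_manifold_def by fast+

lemma chart_inj: "(U, p) \<in> atlas S \<Longrightarrow> inj_on p U"
  using homeomorphic_imp_injective_map[OF chart_facts(3)] by simp

lemma chart_preimage_open:
  assumes "(U, p) \<in> atlas S" "openin (surf_top S) W"
  shows "open {u \<in> U. p u \<in> W}"
proof -
  have "openin (subtopology (surf_top S) (p ` U)) (W \<inter> p ` U)"
    using assms(2) by (auto simp: openin_subtopology)
  from openin_continuous_map_preimage[OF homeomorphic_imp_continuous_map[OF chart_facts(3)[OF assms(1)]] this]
  moreover have "{u \<in> topspace (top_of_set U). p u \<in> W \<inter> p ` U} = {u \<in> U. p u \<in> W}" by auto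
  ultimately have "openin (top_of_set U) {u \<in> U. p u \<in> W}" by simp
  then show ?thesis using chart_facts(1)[OF assms(1)] openin_open_eq by blast
qed

lemma chart_exists:
  assumes "x \<in> points S"
  obtains U p u where "(U, p) \<in> atlas S" "u \<in> U" "p u = x"
proof -
  have "points S = (\<Union>(U, p)\<in>atlas S. p ` U)"
    using oriented unfolding oriented_surface_def oriented_manifold_def by (elim conjE)
  then show ?thesis using assms that by auto
qed

lemma chart_at_facts:
  assumes "x \<in> points S"
  shows "chart_at S x \<in> atlas S" "x \<in> snd (chart_at S x) ` fst (chart_at S x)"
proof -
  have "\<exists>c. c \<in> atlas S \<and> x \<in> snd c ` fst c"
    using chart_exists[OF assms] by (metis fst_conv imageI snd_conv)
  from someI_ex[OF this] show "chart_at S x \<in> atlas S" "x \<in> snd (chart_at S x) ` fst (chart_at S x)"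
    unfolding chart_at_def by auto
qed

lemma transition_facts:
  assumes "(U, p) \<in> atlas S" "(V, q) \<in> atlas S"
  defines "W \<equiv> {v \<in> V. q v \<in> p ` U}" and "\<tau> \<equiv> inv_into U p \<circ> q"
  shows "open W" "smooth_on W \<tau>" "v \<in> W \<Longrightarrow> \<tau> v \<in> U" "v \<in> W \<Longrightarrow> p (\<tau> v) = q v"
    "v \<in> W \<Longrightarrow> det (jacobian \<tau> (at v)) > 0"
proof -
  show "open W" unfolding W_def by (rule chart_preimage_open[OF assms(2) chart_facts(2)[OF assms(1)]])
  show "smooth_on W \<tau>" "v \<in> W \<Longrightarrow> det (jacobian \<tau> (at v)) > 0"
    using oriented assms(1,2) unfolding oriented_surface_def oriented_manifold_def W_def \<tau>_def by fast+
  show "v \<in> W \<Longrightarrow> \<tau> v \<in> U" "v \<in> W \<Longrightarrow> p (\<tau> v) = q v"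
    unfolding W_def \<tau>_def by (auto simp: inv_into_into f_inv_into_f)
qed

text \<open>\<open>diff_at\<close> reads differentials in the chart selected by
  \<open>chart_at\<close>; \<open>T\<close> is the Jacobian of the passage from that chart to
  \<open>p\<close>, and its positive determinant preserves the sign of areas. Both value types are
  listed so that the same \<open>T\<close> serves vector and bivector maps.\<close>

lemma diff_at_chart:
  fixes p :: "real^2 \<Rightarrow> 'm"
  assumes "(U, p) \<in> atlas S" "u \<in> U"
  obtains T where "linear T" "surj T" "\<And>a b. 0 < area (T a) (T b) \<longleftrightarrow> 0 < area a b"
    "\<And>(F :: 'm \<Rightarrow> real^4) b. F \<circ> p differentiable at u \<Longrightarrow> diff_at S F (p u) b = dir (T b) (F \<circ> p) u"
    "\<And>(F :: 'm \<Rightarrow> real^4^4) b. F \<circ> p differentiable at u \<Longrightarrow> diff_at S F (p u) b = dir (T b) (F \<circ> p) u"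
proof -
  obtain V q where c: "chart_at S (p u) = (V, q)" by fastforce
  have x: "p u \<in> points S" by (rule chart_facts(6)[OF assms])
  have q: "(V, q) \<in> atlas S" "p u \<in> q ` V" using chart_at_facts[OF x] c by auto
  let ?v = "inv_into V q (p u)"
  let ?\<tau> = "inv_into U p \<circ> q"
  let ?W = "{v \<in> V. q v \<in> p ` U}"
  note tr = transition_facts[OF assms(1) q(1)]
  have v: "?v \<in> ?W" "q ?v = p u" using q(2) assms(2) by (auto simp: inv_into_into f_inv_into_f)
  have tv: "?\<tau> ?v = u" using v(2) chart_inj[OF assms(1)] assms(2) by (simp add: inv_into_f_f)
  have td: "?\<tau> differentiable at ?v" by (rule smooth_on_differentiable[OF tr(2) v(1)])
  define M where "M = jacobian ?\<tau> (at ?v)"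
  have T: "dir b ?\<tau> ?v = M *v b" for b
    unfolding M_def by (rule dir_eqI[OF td[unfolded jacobian_works]])
  have gen: "diff_at S F (p u) b = dir (M *v b) (F \<circ> p) u"
    if F: "F \<circ> p differentiable at u" for F :: "'m \<Rightarrow> 'b::real_normed_vector" and b
  proof -
    have Fv: "F \<circ> p differentiable at (?\<tau> ?v)" unfolding tv by (rule F)
    have d: "(\<lambda>v. (F \<circ> p) (?\<tau> v)) differentiable at ?v"
      by (rule differentiable_compose[where f = "F \<circ> p" and g = ?\<tau>]) (fact Fv td)+
    have "dir b (\<lambda>v. (F \<circ> p) (?\<tau> v)) ?v = dir b (F \<circ> q) ?v"
      by (rule dir_cong_open[OF tr(1) v(1) _ d]) (use tr(4) in auto)
    moreover have "dir b (\<lambda>v. (F \<circ> p) (?\<tau> v)) ?v = dir (dir b ?\<tau> ?v) (F \<circ> p) (?\<tau> ?v)"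
      by (rule dir_compose[OF td Fv])
    ultimately show ?thesis unfolding diff_at_def c T tv by (simp add: dir_def)
  qed
  have det: "det M > 0" unfolding M_def by (rule tr(5)[OF v(1)])
  show ?thesis
  proof (rule that[of "(*v) M"])
    show "linear ((*v) M)" by simp
    show "surj ((*v) M)"
      using det matrix_right_invertible_surjective[of M] invertible_det_nz[of M] unfolding invertible_right_inverse by auto
    show "0 < area (M *v a) (M *v b) \<longleftrightarrow> 0 < area a b" for a b
      using det by (simp add: area_linear zero_less_mult_iff)
  qed (rule gen, assumption)+
qed

lemma spacelike_chart:
  assumes "(U, p) \<in> atlas S"
  shows "spacelike_chart U (immersion S \<circ> p)"
proof
  show "open U" "smooth_on U (immersion S \<circ> p)" using chart_facts[OF assms] by auto
  fix u and a :: "real^2" assume u: "u \<in> U" and a: "a \<noteq> 0"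
  have d: "immersion S \<circ> p differentiable at u"
    by (rule smooth_on_differentiable[OF chart_facts(4)[OF assms] u])
  obtain T where T: "surj T" "\<And>b. diff_at S (immersion S) (p u) b = dir (T b) (immersion S \<circ> p) u"
    using diff_at_chart[OF assms u] d by metis
  have "dir a (immersion S \<circ> p) u \<in> tangent_space S (p u)"
    unfolding tangent_space_def using T by (metis rangeI surjD)
  moreover have "dir a (immersion S \<circ> p) u \<noteq> 0"
    using injD[OF chart_facts(5)[OF assms u], of a 0] a linear_0[OF linear_dir[OF d]] by (auto simp: dir_def)
  ultimately show "0 < mink (dir a (immersion S \<circ> p) u) (dir a (immersion S \<circ> p) u)"
    using spacelike chart_facts(6)[OF assms u] unfolding spacelike_def by blast
qed

text \<open>The Jacobian \<open>T\<close> enters both the differential of \<open>F\<close> and that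
  of the immersion, so it cancels in \<open>deriv_along\<close>. From here on any chart may replace
  the selected one.\<close>

lemma chart_interface:
  assumes "(U, p) \<in> atlas S" "u \<in> U"
  defines "\<phi> \<equiv> immersion S \<circ> p"
  shows "tangent_space S (p u) = range (\<lambda>a. dir a \<phi> u)"
    "area (tangent_coords S (p u) (dir a \<phi> u)) (tangent_coords S (p u) (dir b \<phi> u)) > 0 \<longleftrightarrow> area a b > 0"
    "\<And>F :: 'm \<Rightarrow> real^4. F \<circ> p differentiable at u \<Longrightarrow> deriv_along S F (p u) (dir a \<phi> u) = dir a (F \<circ> p) u"
    "\<And>F :: 'm \<Rightarrow> real^4^4. F \<circ> p differentiable at u \<Longrightarrow> deriv_along S F (p u) (dir a \<phi> u) = dir a (F \<circ> p) u"
proof -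
  interpret c: spacelike_chart U \<phi> unfolding \<phi>_def by (rule spacelike_chart[OF assms(1)])
  obtain T where T: "linear T" "surj T" "\<And>a b. 0 < area (T a) (T b) \<longleftrightarrow> 0 < area a b"
    "\<And>(F :: 'm \<Rightarrow> real^4) b. F \<circ> p differentiable at u \<Longrightarrow> diff_at S F (p u) b = dir (T b) (F \<circ> p) u"
    "\<And>(F :: 'm \<Rightarrow> real^4^4) b. F \<circ> p differentiable at u \<Longrightarrow> diff_at S F (p u) b = dir (T b) (F \<circ> p) u"
    using diff_at_chart[OF assms(1,2)] by blast
  have imm: "diff_at S (immersion S) (p u) = (\<lambda>b. dir (T b) \<phi> u)"
    using T(4)[of "immersion S"] c.diff_phi[OF assms(2)] by (auto simp: \<phi>_def)
  show "tangent_space S (p u) = range (\<lambda>a. dir a \<phi> u)"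
    unfolding tangent_space_def imm using T(2) image_image[of "\<lambda>a. dir a \<phi> u" T UNIV] by simp
  have Ti: "inj T" using linear_surj_imp_inj[OF T(1,2)] .
  have inj: "inj (diff_at S (immersion S) (p u))"
    unfolding imm inj_def using c.coords_dir[OF assms(2)] Ti by (metis injD)
  have tc: "tangent_coords S (p u) (dir (T b) \<phi> u) = b" for b
    unfolding tangent_coords_def using inv_f_f[OF inj, of b] by (simp add: imm)
  obtain a' b' where ab: "a = T a'" "b = T b'" using T(2) by (metis surjD)
  show "area (tangent_coords S (p u) (dir a \<phi> u)) (tangent_coords S (p u) (dir b \<phi> u)) > 0 \<longleftrightarrow> area a b > 0"
    unfolding ab tc T(3) ..
  show "deriv_along S F (p u) (dir a \<phi> u) = dir a (F \<circ> p) u" if "F \<circ> p differentiable at u" for F :: "'m \<Rightarrow> real^4"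
    unfolding deriv_along_def ab tc T(4)[OF that] ..
  show "deriv_along S F (p u) (dir a \<phi> u) = dir a (F \<circ> p) u" if "F \<circ> p differentiable at u" for F :: "'m \<Rightarrow> real^4^4"
    unfolding deriv_along_def ab tc T(5)[OF that] ..
qed

lemma normal_space_chart:
  assumes "(U, p) \<in> atlas S" "u \<in> U"
  shows "n \<in> normal_space S (p u) \<longleftrightarrow> (\<forall>a. mink n (dir a (immersion S \<circ> p) u) = 0)"
  unfolding normal_space_def chart_interface(1)[OF assms] by auto

lemma nor_part_chart:
  assumes "(U, p) \<in> atlas S" "u \<in> U"
  shows "nor_part S (p u) w = spacelike_chart.normal (immersion S \<circ> p) w u"
    "tan_part S (p u) w = dir (spacelike_chart.coords (immersion S \<circ> p) w u) (immersion S \<circ> p) u"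
proof -
  let ?\<phi> = "immersion S \<circ> p"
  interpret c: spacelike_chart U ?\<phi> by (rule spacelike_chart[OF assms(1)])
  show t: "tan_part S (p u) w = dir (c.coords w u) ?\<phi> u"
    unfolding tan_part_def
  proof (rule the_equality)
    show "dir (c.coords w u) ?\<phi> u \<in> tangent_space S (p u) \<and> w - dir (c.coords w u) ?\<phi> u \<in> normal_space S (p u)"
      using c.normal_orth[OF assms(2)] unfolding chart_interface(1)[OF assms] normal_space_chart[OF assms] c.normal_def by auto
  next
    fix t assume t: "t \<in> tangent_space S (p u) \<and> w - t \<in> normal_space S (p u)"
    then obtain a where a: "t = dir a ?\<phi> u" unfolding chart_interface(1)[OF assms] by auto
    have "c.coords w u = a"
      by (rule c.coords_unique[OF assms(2)]) (use t a in \<open>auto simp: normal_space_chart[OF assms]\<close>)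
    then show "t = dir (c.coords w u) ?\<phi> u" using a by simp
  qed
  show "nor_part S (p u) w = c.normal w u" unfolding nor_part_def t c.normal_def ..
qed

end

section \<open>Orthonormal frames\<close>

lemma bounded_bilinear_contract: "bounded_bilinear contract"
  unfolding bilinear_conv_bounded_bilinear[symmetric] bilinear_def
  using linear_contract by blast

text \<open>The vector \<open>d\<close> is characterised by \<open>mink v d\<close> being the
  determinant with rows \<open>a\<close>, \<open>b\<close>, \<open>c\<close>, \<open>v\<close>.
  Repeated rows give the orthogonality, and the determinant of the completed frame is
  \<open>mink d d\<close>.\<close>

lemma complete_frame:
  assumes "mink a a = 1" "mink b b = 1" "mink a b = 0" "mink c c = -1" "mink a c = 0" "mink b c = 0"
  defines "d \<equiv> contract (hodge (wedge a b)) c"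
  shows "mink a d = 0" "mink b d = 0" "mink c d = 0" "mink d d = 1"
    "det (\<chi> i. if i = 1 then a else if i = 2 then b else if i = 3 then c else d) = 1"
proof -
  have d: "mink v d = - biv_mink (hodge (wedge a b)) (wedge c v)" for v
    unfolding d_def mink_contract[OF hodge_antisym] wedge_flip[of v c] by (simp add: biv_mink_simps)
  show "mink a d = 0" "mink b d = 0"
    unfolding d biv_mink_hodge_wedge det_4 by (simp_all add: algebra_simps)
  show "mink c d = 0" unfolding d by (simp add: biv_mink_simps)
  show dd: "mink d d = 1"
    unfolding d_def mink_contract_hodge using assms(1-6) by (simp add: mink_commute)
  show "det (\<chi> i. if i = 1 then a else if i = 2 then b else if i = 3 then c else d) = 1"
    using dd unfolding d[of d] biv_mink_hodge_wedge by simp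
qed

context spacelike_chart
begin

text \<open>Gram-Schmidt applied to the coordinate directions; the second vector is cleared of
  denominators before it is normalised.\<close>

definition frame_coord :: "4 \<Rightarrow> real^2 \<Rightarrow> real^2" where
  "frame_coord i u = (if i = 1 then (1 / sqrt (g E1 E1 u)) *\<^sub>R E1
     else (1 / sqrt (g E1 E1 u * gram E1 E2 u)) *\<^sub>R (g E1 E1 u *\<^sub>R E2 - g E1 E2 u *\<^sub>R E1))"

text \<open>
  Since the tangent planes are space-like, the normal part of the time axis has square at most \<open>-1\<close>;
  this gives a normal frame on the whole chart.
\<close>

definition time_normal :: "real^2 \<Rightarrow> real^4" where
  "time_normal u = normal (axis 1 1) u"

definition frame3 :: "real^2 \<Rightarrow> real^4" where
  "frame3 u = (1 / sqrt (- mink (time_normal u) (time_normal u))) *\<^sub>R time_normal u"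

definition frame :: "4 \<Rightarrow> real^2 \<Rightarrow> real^4" where
  "frame i u = (if i = 1 \<or> i = 2 then dir (frame_coord i u) \<phi> u else if i = 3 then frame3 u
     else contract (hodge (wedge (dir (frame_coord 1 u) \<phi> u) (dir (frame_coord 2 u) \<phi> u))) (frame3 u))"

lemma g_pos: "u \<in> U \<Longrightarrow> g E1 E1 u > 0"
  unfolding g_def by (rule pos) (simp_all add: axis_eq_0_iff)

lemma gram_E_pos: "u \<in> U \<Longrightarrow> gram E1 E2 u > 0"
  by (rule gram_pos) (simp_all add: area_E)

lemma smooth_frame_coord: "smooth_on U (frame_coord i)"
proof -
  have 1: "smooth_on U (\<lambda>u. 1 / sqrt (g E1 E1 u))"
    by (rule smooth_on_inverse_sqrt[OF open_U smooth_g g_pos])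
  have 2: "smooth_on U (\<lambda>u. 1 / sqrt (g E1 E1 u * gram E1 E2 u))"
    by (rule smooth_on_inverse_sqrt[OF open_U smooth_on_mult[OF open_U smooth_g smooth_gram]])
      (simp add: g_pos gram_E_pos)
  show ?thesis unfolding frame_coord_def[abs_def]
    by (cases "i = 1") (auto intro!: smooth_on_scaleR smooth_on_diff 1 2 smooth_g smooth_on_const open_U)
qed

lemma frame_coord_orthonormal:
  assumes "u \<in> U"
  shows "orthonormal (frame_coord 1 u) (frame_coord 2 u) u" "area (frame_coord 1 u) (frame_coord 2 u) > 0"
proof -
  let ?g = "g E1 E1 u" and ?G = "gram E1 E2 u"
  have p: "?g > 0" "?G > 0" using g_pos gram_E_pos assms by auto
  have gs: "g (x *\<^sub>R a) (y *\<^sub>R b) u = x * y * g a b u" for x y a b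
    by (simp add: g_def dir_phi_simps[OF assms] mink_simps)
  have gd: "g a (x *\<^sub>R b - y *\<^sub>R c) u = x * g a b u - y * g a c u" for a b c x y
    by (simp add: g_def dir_phi_simps[OF assms] mink_simps)
  have gd': "g (x *\<^sub>R b - y *\<^sub>R c) a u = x * g b a u - y * g c a u" for a b c x y
    by (simp add: g_def dir_phi_simps[OF assms] mink_simps)
  have "1 / sqrt ?g * (1 / sqrt ?g) * ?g = 1" using p by simp
  moreover have "(1 / sqrt (?g * ?G)) * (1 / sqrt (?g * ?G)) * (?g * ?G) = 1"
    using p by (simp add: less_imp_le)
  moreover have "g (?g *\<^sub>R E2 - g E1 E2 u *\<^sub>R E1) (?g *\<^sub>R E2 - g E1 E2 u *\<^sub>R E1) u = ?g * ?G"
    unfolding gd gd' gram_def g_commute[of E2 E1] by (simp add: algebra_simps)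
  moreover have "g E1 (?g *\<^sub>R E2 - g E1 E2 u *\<^sub>R E1) u = 0"
    unfolding gd by (simp add: algebra_simps)
  ultimately show "orthonormal (frame_coord 1 u) (frame_coord 2 u) u"
    by (simp add: orthonormal_def frame_coord_def gs)
  have "area (x *\<^sub>R E1) (y *\<^sub>R (z *\<^sub>R E2 - w *\<^sub>R E1)) = x * y * z" for x y z w
    by (simp add: area_def axis_def)
  then show "area (frame_coord 1 u) (frame_coord 2 u) > 0"
    using p by (simp add: frame_coord_def)
qed

lemma time_normal_neg:
  assumes "u \<in> U"
  shows "- mink (time_normal u) (time_normal u) > 0"
proof -
  let ?t = "axis 1 1 :: real^4" and ?d = "dir (coords (axis 1 1) u) \<phi> u"
  have "mink ?t ?t = -1" by (simp add: mink_def axis_def)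
  moreover have e: "?t = time_normal u + ?d" by (simp add: time_normal_def normal_def)
  moreover have o: "mink (time_normal u) ?d = 0" unfolding time_normal_def by (rule normal_orth[OF assms])
  moreover have o': "mink ?d (time_normal u) = 0" using o mink_commute by metis
  moreover have "mink ?t ?t = mink (time_normal u) (time_normal u) + mink ?d ?d"
    using arg_cong2[OF e e, of mink] unfolding mink_simps o o' by simp
  ultimately have "mink (time_normal u) (time_normal u) + mink ?d ?d = -1"
    by simp
  moreover have "mink ?d ?d \<ge> 0"
    using pos[OF assms, of "coords (axis 1 1) u"] linear_0[OF lin[OF assms]]
    by (cases "coords (axis 1 1) u = 0") (simp_all add: mink_simps)
  ultimately show ?thesis by linarith
qed

lemma smooth_frame3: "smooth_on U frame3"
proof -
  have s: "smooth_on U time_normal" unfolding time_normal_def[abs_def]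
    by (intro smooth_normal open_U order_refl smooth_on_const)
  have "smooth_on U (\<lambda>u. - mink (time_normal u) (time_normal u))"
    by (rule smooth_on_uminus[OF open_U smooth_on_bilinear[OF open_U bounded_bilinear_mink s s]])
  from smooth_on_inverse_sqrt[OF open_U this time_normal_neg]
  show ?thesis unfolding frame3_def[abs_def] by (intro smooth_on_scaleR open_U s)
qed

lemma smooth_frame: "smooth_on U (frame i)"
proof -
  have s: "smooth_on U (\<lambda>u. dir (frame_coord i u) \<phi> u)" for i
    by (rule smooth_on_dir_var[OF open_U smooth smooth_frame_coord])
  have "smooth_on U (\<lambda>u. wedge (dir (frame_coord 1 u) \<phi> u) (dir (frame_coord 2 u) \<phi> u))"
    by (rule smooth_on_bilinear[OF open_U bounded_bilinear_wedge s s])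
  note smooth_on_bilinear[OF open_U bounded_bilinear_contract smooth_on_linear[OF open_U bounded_linear_hodge this] smooth_frame3]
  then show ?thesis unfolding frame_def[abs_def] using s[of i] smooth_frame3
    by (cases "i = 1 \<or> i = 2"; cases "i = 3") (simp_all only: simp_thms if_True if_False)
qed

lemma frame_orthonormal:
  assumes "u \<in> U"
  shows "a \<noteq> b \<Longrightarrow> mink (frame a u) (frame b u) = 0" "\<bar>mink (frame a u) (frame a u)\<bar> = 1"
    "det (\<chi> a. frame a u) > 0" "mink (frame 3 u) (dir x \<phi> u) = 0" "mink (frame 4 u) (dir x \<phi> u) = 0"
proof -
  have o: "mink (frame 1 u) (frame 1 u) = 1" "mink (frame 2 u) (frame 2 u) = 1" "mink (frame 1 u) (frame 2 u) = 0"
    using frame_coord_orthonormal(1)[OF assms] by (simp_all add: orthonormal_def g_def frame_def)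
  let ?m = "- mink (time_normal u) (time_normal u)"
  have "mink (frame 3 u) (frame 3 u) = - ((1 / sqrt ?m) * (1 / sqrt ?m) * ?m)"
    by (simp add: frame_def frame3_def mink_simps)
  also have "\<dots> = -1" using time_normal_neg[OF assms] by simp
  finally have 3: "mink (frame 3 u) (frame 3 u) = -1" .
  show n3: "mink (frame 3 u) (dir x \<phi> u) = 0" for x
    using normal_orth[OF assms] by (simp add: frame_def frame3_def mink_simps time_normal_def)
  then have 13: "mink (frame 1 u) (frame 3 u) = 0" "mink (frame 2 u) (frame 3 u) = 0"
    by (simp_all add: frame_def mink_commute[of "dir _ _ _"])
  have 4: "frame 4 u = contract (hodge (wedge (frame 1 u) (frame 2 u))) (frame 3 u)"
    by (simp add: frame_def)
  note c = complete_frame[OF o 3 13, folded 4]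
  have "(\<chi> i. if i = 1 then frame 1 u else if i = 2 then frame 2 u else if i = 3 then frame 3 u else frame 4 u) = (\<chi> a. frame a u)"
    unfolding vec_eq_iff[where ?'b = 4] forall_4 by simp
  then show "det (\<chi> a. frame a u) > 0" using c(5) by simp
  show "a \<noteq> b \<Longrightarrow> mink (frame a u) (frame b u) = 0"
    using exhaust_4[of a] exhaust_4[of b] o(3) 13 c(1-3)
    by (elim disjE) (simp_all add: mink_commute)
  show "\<bar>mink (frame a u) (frame a u)\<bar> = 1"
    using exhaust_4[of a] o 3 c(4) by (elim disjE) simp_all
  obtain y z where x: "x = y *\<^sub>R frame_coord 1 u + z *\<^sub>R frame_coord 2 u"
    using basis_expand[of "frame_coord 1 u" "frame_coord 2 u" x] frame_coord_orthonormal(2)[OF assms] by auto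
  have "dir x \<phi> u = y *\<^sub>R frame 1 u + z *\<^sub>R frame 2 u"
    unfolding x dir_phi_simps[OF assms] by (simp add: frame_def)
  then show "mink (frame 4 u) (dir x \<phi> u) = 0"
    using c(1,2) by (simp add: mink_simps mink_commute[of "frame 4 u"])
qed

end

context spacelike_surface
begin

text \<open>This guarantees that the choice made in \<open>frame_at\<close> really yields an
  oriented orthonormal frame near the point.\<close>

lemma frame_exists:
  assumes "x \<in> points S"
  shows "\<exists>e W. openin (surf_top S) W \<and> x \<in> W \<and> oriented_frame_on S W e"
proof -
  obtain U p u where c: "(U, p) \<in> atlas S" "u \<in> U" "p u = x" using chart_exists[OF assms] .
  let ?\<phi> = "immersion S \<circ> p"
  interpret c: spacelike_chart U ?\<phi> by (rule spacelike_chart[OF c(1)])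
  define e where "e i y = c.frame i (inv_into U p y)" for i y
  have ep: "e i (p v) = c.frame i v" if "v \<in> U" for i v
    using chart_inj[OF c(1)] that by (simp add: e_def)
  have sm: "smooth_map_on S (p ` U) (e i)" for i
    unfolding smooth_map_on_def
  proof clarify
    fix V q assume q: "(V, q) \<in> atlas S"
    note tr = transition_facts[OF c(1) q]
    have "smooth_on {v \<in> V. q v \<in> p ` U} (\<lambda>v. c.frame i ((inv_into U p \<circ> q) v))"
      by (rule smooth_on_compose[OF tr(1) c.open_U tr(3) tr(2) c.smooth_frame])
    then show "smooth_on {v \<in> V. q v \<in> p ` U} (e i \<circ> q)" by (simp add: e_def[abs_def] o_def)
  qed
  have "oriented_frame_on S (p ` U) e"
    unfolding oriented_frame_on_def tangent_field_on_def normal_field_on_def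
  proof (intro conjI ballI allI impI sm)
    fix y assume "y \<in> p ` U"
    then obtain v where v: "v \<in> U" "y = p v" by auto
    note ci = chart_interface[OF c(1) v(1)]
    show "e 1 y \<in> tangent_space S y" "e 2 y \<in> tangent_space S y"
      unfolding v(2) ep[OF v(1)] ci(1) by (auto simp: c.frame_def)
    show "e 3 y \<in> normal_space S y" "e 4 y \<in> normal_space S y"
      unfolding v(2) ep[OF v(1)] normal_space_chart[OF c(1) v(1)] using c.frame_orthonormal(4,5)[OF v(1)] by auto
    show "mink (e a y) (e b y) = 0" if "a \<noteq> b" for a b
      unfolding v(2) ep[OF v(1)] by (rule c.frame_orthonormal(1)[OF v(1) that])
    show "\<bar>mink (e a y) (e a y)\<bar> = 1" for a
      unfolding v(2) ep[OF v(1)] by (rule c.frame_orthonormal(2)[OF v(1)])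
    show "det (\<chi> a. e a y) > 0"
      unfolding v(2) ep[OF v(1)] by (rule c.frame_orthonormal(3)[OF v(1)])
    have "det (vector [a, b] :: real^2^2) = area a b" for a b by (simp add: det_2 area_def)
    then show "det (vector [tangent_coords S y (e 1 y), tangent_coords S y (e 2 y)] :: real^2^2) > 0"
      unfolding v(2) ep[OF v(1)] using ci(2) c.frame_coord_orthonormal(2)[OF v(1)] by (simp add: c.frame_def)
  qed
  then show ?thesis using chart_facts(2)[OF c(1)] c(2,3) by blast
qed

lemma frame_at_facts:
  assumes "x \<in> points S"
  obtains W where "openin (surf_top S) W" "x \<in> W" "oriented_frame_on S W (frame_at S x)"
  using someI_ex[OF frame_exists[OF assms]] unfolding frame_at_def by blast

end

section \<open>The Laplacian of the Gauss map and the normal curvature\<close>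

locale surface_chart = spacelike_surface S for S :: "'m surface" +
  fixes U :: "(real^2) set" and p :: "real^2 \<Rightarrow> 'm"
  assumes in_atlas: "(U, p) \<in> atlas S"

sublocale surface_chart \<subseteq> spacelike_chart U "immersion S \<circ> p"
  by (rule spacelike_chart[OF in_atlas])

section \<open>Chart expressions of the geometric quantities\<close>

context surface_chart
begin

abbreviation "\<phi> \<equiv> immersion S \<circ> p"

definition chart_dom :: "'m set \<Rightarrow> (real^2) set" where
  "chart_dom W = {u \<in> U. p u \<in> W}"

definition field_coords :: "('m \<Rightarrow> real^4) \<Rightarrow> real^2 \<Rightarrow> real^2" where
  "field_coords X v = coords (X (p v)) v"

lemma chart_dom_subset: "chart_dom W \<subseteq> U" "u \<in> chart_dom W \<Longrightarrow> u \<in> U" "u \<in> chart_dom W \<Longrightarrow> p u \<in> W"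
  by (auto simp: chart_dom_def)

lemma open_chart_dom: "openin (surf_top S) W \<Longrightarrow> open (chart_dom W)"
  unfolding chart_dom_def by (rule chart_preimage_open[OF in_atlas])

lemma smooth_map_on_chart_dom: "smooth_map_on S W F \<Longrightarrow> smooth_on (chart_dom W) (F \<circ> p)"
  using in_atlas unfolding smooth_map_on_def chart_dom_def by fast

lemmas interface = chart_interface[OF in_atlas]

lemma nor_part_eq: "u \<in> U \<Longrightarrow> nor_part S (p u) w = normal w u"
  and tan_part_eq: "u \<in> U \<Longrightarrow> tan_part S (p u) w = dir (coords w u) \<phi> u"
  using nor_part_chart[OF in_atlas] by auto

lemma tangent_field_coords:
  assumes "openin (surf_top S) W" "tangent_field_on S W X"
  shows "smooth_on (chart_dom W) (field_coords X)" "u \<in> chart_dom W \<Longrightarrow> dir (field_coords X u) \<phi> u = X (p u)"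
proof -
  show "smooth_on (chart_dom W) (field_coords X)"
    using smooth_coords[OF open_chart_dom[OF assms(1)] chart_dom_subset(1) smooth_map_on_chart_dom, of X] assms(2)
    by (simp add: field_coords_def[abs_def] tangent_field_on_def)
  assume u: "u \<in> chart_dom W"
  then have "X (p u) \<in> range (\<lambda>a. dir a \<phi> u)"
    using assms(2) interface(1)[OF chart_dom_subset(2)[OF u]] chart_dom_subset(3)[OF u] by (auto simp: tangent_field_on_def)
  then show "dir (field_coords X u) \<phi> u = X (p u)"
    using coords_dir[OF chart_dom_subset(2)[OF u]] by (auto simp: field_coords_def)
qed

lemma deriv_along_field:
  assumes "openin (surf_top S) W" "tangent_field_on S W Y" "u \<in> chart_dom W"
  shows "deriv_along S Y (p u) (dir a \<phi> u) = hess a (field_coords Y u) u + dir (dir a (field_coords Y) u) \<phi> u"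
proof -
  note Y = tangent_field_coords[OF assms(1,2)]
  note o = open_chart_dom[OF assms(1)]
  have phi: "smooth_on (chart_dom W) \<phi>" by (rule smooth_on_subset[OF smooth chart_dom_subset(1)])
  have d: "Y \<circ> p differentiable at u"
    by (rule smooth_on_differentiable[OF smooth_map_on_chart_dom assms(3)]) (use assms(2) in \<open>simp add: tangent_field_on_def\<close>)
  have "deriv_along S Y (p u) (dir a \<phi> u) = dir a (Y \<circ> p) u"
    by (rule interface(3)[OF chart_dom_subset(2)[OF assms(3)] d])
  also have "\<dots> = dir a (\<lambda>v. dir (field_coords Y v) \<phi> v) u"
    by (rule dir_cong_open[OF o assms(3) _ d]) (simp add: Y(2))
  also have "\<dots> = hess a (field_coords Y u) u + dir (dir a (field_coords Y) u) \<phi> u"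
    unfolding hess_def by (rule dir_dir_var[OF o assms(3) phi Y(1)])
  finally show ?thesis .
qed

lemma second_ff_eq:
  assumes "openin (surf_top S) W" "tangent_field_on S W X" "tangent_field_on S W Y" "u \<in> chart_dom W"
  shows "second_ff S X Y (p u) = II (field_coords X u) (field_coords Y u) u"
  unfolding second_ff_def nor_part_eq[OF chart_dom_subset(2)[OF assms(4)]] tangent_field_coords(2)[OF assms(1,2,4), symmetric]
    deriv_along_field[OF assms(1,3,4)] normal_simps[OF chart_dom_subset(2)[OF assms(4)]] normal_dir[OF chart_dom_subset(2)[OF assms(4)]] II_def
  by simp

lemma levi_civita_eq:
  assumes "openin (surf_top S) W" "tangent_field_on S W X" "tangent_field_on S W Y" "u \<in> chart_dom W"
  shows "levi_civita S X Y (p u) = dir (coords (hess (field_coords X u) (field_coords Y u) u) u + dir (field_coords X u) (field_coords Y) u) \<phi> u"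
  unfolding levi_civita_def tan_part_eq[OF chart_dom_subset(2)[OF assms(4)]] tangent_field_coords(2)[OF assms(1,2,4), symmetric]
    deriv_along_field[OF assms(1,3,4)] coords_add[OF chart_dom_subset(2)[OF assms(4)]] coords_dir[OF chart_dom_subset(2)[OF assms(4)]] ..

text \<open>The Hessian terms cancel by symmetry, so the bracket is tangent with the expected
  coordinates; the connection along it thus becomes a directional derivative in the chart.\<close>

lemma lie_bracket_eq:
  assumes "openin (surf_top S) W" "tangent_field_on S W X" "tangent_field_on S W Y" "u \<in> chart_dom W"
  shows "lie_bracket S X Y (p u) = dir (dir (field_coords X u) (field_coords Y) u - dir (field_coords Y u) (field_coords X) u) \<phi> u"
  unfolding lie_bracket_def tangent_field_coords(2)[OF assms(1,2,4), symmetric] tangent_field_coords(2)[OF assms(1,3,4), symmetric]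
    deriv_along_field[OF assms(1,3,4)] deriv_along_field[OF assms(1,2,4)] dir_phi_simps[OF chart_dom_subset(2)[OF assms(4)]]
  using second_commute[OF chart_dom_subset(2)[OF assms(4)]] by (simp add: hess_def)

lemma normal_curvature_eq:
  assumes "openin (surf_top S) W" "tangent_field_on S W X" "tangent_field_on S W Y" "normal_field_on S W \<xi>" "u \<in> chart_dom W"
  shows "normal_curvature S X Y \<xi> (p u) =
     normal (dir (field_coords X u) (\<lambda>v. normal (dir (field_coords Y v) (\<xi> \<circ> p) v) v) u) u
     - normal (dir (field_coords Y u) (\<lambda>v. normal (dir (field_coords X v) (\<xi> \<circ> p) v) v) u) u
     - normal (dir (dir (field_coords X u) (field_coords Y) u - dir (field_coords Y u) (field_coords X) u) (\<xi> \<circ> p) u) u"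
proof -
  note o = open_chart_dom[OF assms(1)]
  have sx: "smooth_on (chart_dom W) (\<xi> \<circ> p)"
    by (rule smooth_map_on_chart_dom) (use assms(4) in \<open>simp add: normal_field_on_def\<close>)
  have conn: "normal_connection S Z \<xi> (p v) = normal (dir b (\<xi> \<circ> p) v) v"
    if "v \<in> chart_dom W" "Z (p v) = dir b \<phi> v" for Z v b
    unfolding normal_connection_def nor_part_eq[OF chart_dom_subset(2)[OF that(1)]] that(2)
      interface(3)[OF chart_dom_subset(2)[OF that(1)] smooth_on_differentiable[OF sx that(1)]] ..
  \<comment> \<open>The inner covariant derivative has to be known as a differentiable map in the
    chart before it can be differentiated again.\<close>
  have nest: "normal_connection S X (normal_connection S Y \<xi>) (p u)
      = normal (dir (field_coords X u) (\<lambda>v. normal (dir (field_coords Y v) (\<xi> \<circ> p) v) v) u) u"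
    if X: "tangent_field_on S W X" and Y: "tangent_field_on S W Y" for X Y
  proof -
    note fX = tangent_field_coords[OF assms(1) X] and fY = tangent_field_coords[OF assms(1) Y]
    have s: "smooth_on (chart_dom W) (\<lambda>v. normal (dir (field_coords Y v) (\<xi> \<circ> p) v) v)"
      by (rule smooth_normal[OF o chart_dom_subset(1) smooth_on_dir_var[OF o sx fY(1)]])
    note ds = smooth_on_differentiable[OF s assms(5)]
    have eq: "normal (dir (field_coords Y v) (\<xi> \<circ> p) v) v = (normal_connection S Y \<xi> \<circ> p) v" if "v \<in> chart_dom W" for v
      using conn[of v Y "field_coords Y v", OF that fY(2)[OF that, symmetric]] by simp
    have d: "normal_connection S Y \<xi> \<circ> p differentiable at u"
      by (rule differentiable_cong_open[OF o assms(5) eq ds])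
    have e: "dir (field_coords X u) (\<lambda>v. normal (dir (field_coords Y v) (\<xi> \<circ> p) v) v) u = dir (field_coords X u) (normal_connection S Y \<xi> \<circ> p) u"
      by (rule dir_cong_open[OF o assms(5) eq ds])
    show ?thesis
      unfolding normal_connection_def[of S X] nor_part_eq[OF chart_dom_subset(2)[OF assms(5)]] fX(2)[OF assms(5), symmetric]
        interface(3)[OF chart_dom_subset(2)[OF assms(5)] d] e ..
  qed
  show ?thesis
    unfolding normal_curvature_def nest[OF assms(2,3)] nest[OF assms(3,2)]
      conn[of u "lie_bracket S X Y", OF assms(5) lie_bracket_eq[OF assms(1,2,3,5)]] ..
qed

lemma frame_facts:
  assumes "openin (surf_top S) W" "oriented_frame_on S W e" "u \<in> chart_dom W"
  shows "mink_frame (\<lambda>a. e a (p u))" "orthonormal (field_coords (e 1) u) (field_coords (e 2) u) u"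
    "area (field_coords (e 1) u) (field_coords (e 2) u) > 0"
    "wedge (e 3 (p u)) (e 4 (p u)) = hodge (mu E1 E2 u)"
    "mink (dir x \<phi> u) (e 3 (p u)) = 0" "mink (dir x \<phi> u) (e 4 (p u)) = 0"
proof -
  note u = chart_dom_subset(2,3)[OF assms(3)]
  note fr = assms(2)[unfolded oriented_frame_on_def]
  show fm: "mink_frame (\<lambda>a. e a (p u))"
    by unfold_locales (use fr u(2) in blast)+
  then interpret f: mink_frame "\<lambda>a. e a (p u)" .
  have t: "tangent_field_on S W (e 1)" "tangent_field_on S W (e 2)" using fr by auto
  have field_coords: "dir (field_coords (e 1) u) \<phi> u = e 1 (p u)" "dir (field_coords (e 2) u) \<phi> u = e 2 (p u)"
    using tangent_field_coords(2)[OF assms(1) _ assms(3)] t by auto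
  \<comment> \<open>A frame only prescribes squares of absolute value 1; for tangent vectors
    space-likeness selects the value 1.\<close>
  have un: "mink (dir a \<phi> u) (dir a \<phi> u) = 1" if "\<bar>mink (dir a \<phi> u) (dir a \<phi> u)\<bar> = 1" for a
    using pos[OF u(1), of a] that linear_0[OF lin[OF u(1)]] by (cases "a = 0") (auto simp: mink_simps)
  have 1: "mink (e 1 (p u)) (e 1 (p u)) = 1" "mink (e 2 (p u)) (e 2 (p u)) = 1"
    using un[of "field_coords (e 1) u"] un[of "field_coords (e 2) u"] f.unit[of 1] f.unit[of 2] by (simp_all add: field_coords)
  then show on: "orthonormal (field_coords (e 1) u) (field_coords (e 2) u) u"
    using f.orth[of 1 2] by (simp add: orthonormal_def g_def field_coords)
  have "det (vector [a, b] :: real^2^2) = area a b" for a b by (simp add: det_2 area_def)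
  then show ar: "area (field_coords (e 1) u) (field_coords (e 2) u) > 0"
    using fr u(2) interface(2)[OF u(1), of "field_coords (e 1) u" "field_coords (e 2) u"] by (simp add: field_coords)
  show "wedge (e 3 (p u)) (e 4 (p u)) = hodge (mu E1 E2 u)"
    unfolding f.wedge_normal_eq_hodge[OF 1] mu_area_pos[OF u(1) ar, symmetric] mu_orthonormal[OF on] field_coords ..
  have n: "e 3 (p u) \<in> normal_space S (p u)" "e 4 (p u) \<in> normal_space S (p u)"
    using fr u(2) by (auto simp: normal_field_on_def)
  show "mink (dir x \<phi> u) (e 3 (p u)) = 0" "mink (dir x \<phi> u) (e 4 (p u)) = 0"
    using n[unfolded normal_space_chart[OF in_atlas u(1)]] mink_commute by metis+
qed

text \<open>\<open>gauss_map\<close> uses a separately chosen frame at each point. The right side is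
  free of this choice and smooth on the whole chart.\<close>

lemma gauss_map_eq:
  assumes "u \<in> U"
  shows "gauss_map S (p u) = hodge (mu E1 E2 u)"
proof -
  obtain W where W: "openin (surf_top S) W" "p u \<in> W" "oriented_frame_on S W (frame_at S (p u))"
    using frame_at_facts[OF chart_facts(6)[OF in_atlas assms]] .
  then have "u \<in> chart_dom W" using assms by (simp add: chart_dom_def)
  from frame_facts(4)[OF W(1,3) this] show ?thesis by (simp add: gauss_map_def Let_def)
qed

text \<open>The connection term and the second derivative both contain the derivative of
  \<open>F\<close> along the derivative of the coordinate field in its own direction. These
  contributions cancel, leaving only the values of the frame at \<open>u\<close>.\<close>

lemma laplacian_eq:
  fixes F :: "'m \<Rightarrow> real^4^4"
  assumes "openin (surf_top S) W" "oriented_frame_on S W e" "u \<in> chart_dom W" "smooth_on U (F \<circ> p)"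
  shows "(\<Sum>i\<in>{1,2}. (deriv_along S F (p u) (levi_civita S (e i) (e i) (p u))
               - deriv_along S (\<lambda>y. deriv_along S F y (e i y)) (p u) (e i (p u))))
     = lap (field_coords (e 1) u) (field_coords (e 2) u) (F \<circ> p) u"
proof -
  note u = chart_dom_subset(2,3)[OF assms(3)]
  note o = open_chart_dom[OF assms(1)]
  have sF: "smooth_on (chart_dom W) (F \<circ> p)" by (rule smooth_on_subset[OF assms(4) chart_dom_subset(1)])
  have dF: "F \<circ> p differentiable at v" if "v \<in> U" for v by (rule smooth_on_differentiable[OF assms(4) that])
  have lF: "linear (\<lambda>v. dir v (F \<circ> p) u)" by (rule linear_dir[OF dF[OF u(1)]])
  have *: "deriv_along S F (p u) (levi_civita S X X (p u)) - deriv_along S (\<lambda>y. deriv_along S F y (X y)) (p u) (X (p u))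
      = dir (coords (hess (field_coords X u) (field_coords X u) u) u) (F \<circ> p) u - dir (field_coords X u) (dir (field_coords X u) (F \<circ> p)) u"
    if X: "tangent_field_on S W X" for X
  proof -
    note f = tangent_field_coords[OF assms(1) X]
    have 1: "deriv_along S F (p u) (levi_civita S X X (p u))
        = dir (coords (hess (field_coords X u) (field_coords X u) u) u) (F \<circ> p) u + dir (dir (field_coords X u) (field_coords X) u) (F \<circ> p) u"
      unfolding levi_civita_eq[OF assms(1) X X assms(3)] interface(4)[OF u(1) dF[OF u(1)]] linear_add[OF lF] ..
    have s: "smooth_on (chart_dom W) (\<lambda>v. dir (field_coords X v) (F \<circ> p) v)" by (rule smooth_on_dir_var[OF o sF f(1)])
    note ds = smooth_on_differentiable[OF s assms(3)]
    have eq: "dir (field_coords X v) (F \<circ> p) v = ((\<lambda>y. deriv_along S F y (X y)) \<circ> p) v" if v: "v \<in> chart_dom W" for v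
      using interface(4)[OF chart_dom_subset(2)[OF v] dF[OF chart_dom_subset(2)[OF v]], of "field_coords X v"] f(2)[OF v] by simp
    have d: "(\<lambda>y. deriv_along S F y (X y)) \<circ> p differentiable at u"
      by (rule differentiable_cong_open[OF o assms(3) eq ds])
    have "deriv_along S (\<lambda>y. deriv_along S F y (X y)) (p u) (X (p u)) = dir (field_coords X u) ((\<lambda>y. deriv_along S F y (X y)) \<circ> p) u"
      using interface(4)[OF u(1) d, of "field_coords X u"] unfolding f(2)[OF assms(3)] .
    also have "\<dots> = dir (field_coords X u) (\<lambda>v. dir (field_coords X v) (F \<circ> p) v) u"
      by (rule dir_cong_open[OF o assms(3) eq ds, symmetric])
    also have "\<dots> = dir (field_coords X u) (dir (field_coords X u) (F \<circ> p)) u + dir (dir (field_coords X u) (field_coords X) u) (F \<circ> p) u"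
      by (rule dir_dir_var[OF o assms(3) sF f(1)])
    finally show ?thesis using 1 by simp
  qed
  have t: "tangent_field_on S W (e 1)" "tangent_field_on S W (e 2)"
    using assms(2) by (auto simp: oriented_frame_on_def)
  show ?thesis
    unfolding lap_def coords_add[OF u(1)] linear_add[OF lF] using *[OF t(1)] *[OF t(2)] by simp
qed

lemma frame_at_chart:
  assumes "u \<in> U"
  obtains W where "openin (surf_top S) W" "oriented_frame_on S W (frame_at S (p u))" "u \<in> chart_dom W"
  using frame_at_facts[OF chart_facts(6)[OF in_atlas assms]] assms by (auto simp: chart_dom_def)

text \<open>The chosen frame may vary without any regularity as \<open>u\<close> moves, so these
  directions are evaluated at one point and then held constant, never differentiated.\<close>

definition frame_at_coords :: "4 \<Rightarrow> real^2 \<Rightarrow> real^2" where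
  "frame_at_coords i u = field_coords (frame_at S (p u) i) u"

lemma mean_curvature_vector_eq:
  assumes "u \<in> U"
  shows "mean_curvature_vector S (p u) = (1/2) *\<^sub>R (II (frame_at_coords 1 u) (frame_at_coords 1 u) u + II (frame_at_coords 2 u) (frame_at_coords 2 u) u)"
proof -
  obtain W where W: "openin (surf_top S) W" "oriented_frame_on S W (frame_at S (p u))" "u \<in> chart_dom W"
    using frame_at_chart[OF assms] .
  then have t: "tangent_field_on S W (frame_at S (p u) 1)" "tangent_field_on S W (frame_at S (p u) 2)"
    by (auto simp: oriented_frame_on_def)
  show ?thesis
    unfolding mean_curvature_vector_def Let_def second_ff_eq[OF W(1) t(1,1) W(3)] second_ff_eq[OF W(1) t(2,2) W(3)] frame_at_coords_def ..
qed

lemma frame_at_coords_orthonormal: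
  assumes "u \<in> U"
  shows "orthonormal (frame_at_coords 1 u) (frame_at_coords 2 u) u" "area (frame_at_coords 1 u) (frame_at_coords 2 u) > 0"
  using frame_at_chart[OF assms] frame_facts(2,3) unfolding frame_at_coords_def by metis+

lemma norm_h_sq_eq:
  assumes "u \<in> U"
  shows "norm_h_sq S (p u) = sff_norm_sq (frame_at_coords 1 u) (frame_at_coords 2 u) u"
proof -
  obtain W where W: "openin (surf_top S) W" "oriented_frame_on S W (frame_at S (p u))" "u \<in> chart_dom W"
    using frame_at_chart[OF assms] .
  let ?e = "frame_at S (p u)"
  have t: "tangent_field_on S W (?e 1)" "tangent_field_on S W (?e 2)"
    using W(2) by (auto simp: oriented_frame_on_def)
  interpret f: mink_frame "\<lambda>a. ?e a (p u)" by (rule frame_facts(1)[OF W])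
  have d: "?e 1 (p u) = dir (frame_at_coords 1 u) \<phi> u" "?e 2 (p u) = dir (frame_at_coords 2 u) \<phi> u"
    using tangent_field_coords(2)[OF W(1) t(1) W(3)] tangent_field_coords(2)[OF W(1) t(2) W(3)] by (simp_all add: frame_at_coords_def)
  have n: "(\<Sum>b\<in>{3,4}. mink (?e b (p u)) (?e b (p u)) * (mink (II a c u) (?e b (p u)))\<^sup>2) = mink (II a c u) (II a c u)" for a c
    by (rule f.normal_norm[symmetric]) (simp_all add: d II_def normal_orth[OF assms])
  have "norm_h_sq S (p u) = (\<Sum>i\<in>{1,2::4}. \<Sum>j\<in>{1,2::4}.
      mink (second_ff S (?e i) (?e j) (p u)) (second_ff S (?e i) (?e j) (p u)))"
    unfolding norm_h_sq_def Let_def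
  proof (intro sum.cong refl)
    fix i j :: 4 assume ij: "i \<in> {1,2}" "j \<in> {1,2}"
    then have ti: "tangent_field_on S W (?e i)" "tangent_field_on S W (?e j)" using t by auto
    show "(\<Sum>b\<in>{3,4}. mink (?e b (p u)) (?e b (p u)) * (mink (second_ff S (?e i) (?e j) (p u)) (?e b (p u)))\<^sup>2)
      = mink (second_ff S (?e i) (?e j) (p u)) (second_ff S (?e i) (?e j) (p u))"
      unfolding second_ff_eq[OF W(1) ti W(3)] by (rule n)
  qed
  also have "\<dots> = mink (II (frame_at_coords 1 u) (frame_at_coords 1 u) u) (II (frame_at_coords 1 u) (frame_at_coords 1 u) u) + mink (II (frame_at_coords 1 u) (frame_at_coords 2 u) u) (II (frame_at_coords 1 u) (frame_at_coords 2 u) u)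
      + (mink (II (frame_at_coords 2 u) (frame_at_coords 1 u) u) (II (frame_at_coords 2 u) (frame_at_coords 1 u) u) + mink (II (frame_at_coords 2 u) (frame_at_coords 2 u) u) (II (frame_at_coords 2 u) (frame_at_coords 2 u) u))"
    by (simp add: second_ff_eq[OF W(1) t(1,1) W(3)] second_ff_eq[OF W(1) t(1,2) W(3)] second_ff_eq[OF W(1) t(2,1) W(3)]
        second_ff_eq[OF W(1) t(2,2) W(3)] frame_at_coords_def)
  finally show ?thesis by (simp add: sff_norm_sq_def II_commute[OF assms, of "frame_at_coords 2 u" "frame_at_coords 1 u"])
qed

lemma maximal_chart:
  assumes "\<forall>x\<in>points S. mean_curvature_vector S x = 0"
  shows "maximal"
proof (rule maximalI)
  fix u assume u: "u \<in> U"
  have "mean_curvature_vector S (p u) = 0" using assms chart_facts(6)[OF in_atlas u] by blast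
  then show "\<exists>a b. orthonormal a b u \<and> II a a u + II b b u = 0"
    using frame_at_coords_orthonormal(1)[OF u] unfolding mean_curvature_vector_eq[OF u] by auto
qed

lemma laplacian_gauss_map_eq:
  assumes "maximal" "u \<in> U"
  shows "laplacian S (gauss_map S) (p u) = norm_h_sq S (p u) *\<^sub>R gauss_map S (p u)
    - 4 *\<^sub>R hodge (wedge (II (frame_at_coords 1 u) (frame_at_coords 1 u) u) (II (frame_at_coords 1 u) (frame_at_coords 2 u) u))"
proof -
  obtain W where W: "openin (surf_top S) W" "oriented_frame_on S W (frame_at S (p u))" "u \<in> chart_dom W"
    using frame_at_chart[OF assms(2)] .
  let ?a = "frame_at_coords 1 u" and ?b = "frame_at_coords 2 u" and ?h = "\<lambda>v. hodge (mu (frame_at_coords 1 u) (frame_at_coords 2 u) v)"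
  note on = frame_at_coords_orthonormal[OF assms(2)]
  have ar: "area ?a ?b \<noteq> 0" using on(2) by simp
  note m = smooth_mu[OF ar]
  \<comment> \<open>The directions are frozen at their values at \<open>u\<close>. Positive area
    makes the Gauss map agree with the star of their \<open>mu\<close> on the whole chart, as needed
    for taking second derivatives.\<close>
  have h: "hodge (mu E1 E2 v) = ?h v" "gauss_map S (p v) = ?h v" if "v \<in> U" for v
    using mu_area_pos[OF that on(2)] gauss_map_eq[OF that] by simp_all
  have sh: "smooth_on U ?h" by (rule smooth_on_linear[OF open_U bounded_linear_hodge m])
  have sG: "smooth_on U (gauss_map S \<circ> p)"
    by (rule smooth_on_cong[OF open_U _ sh]) (simp add: h)
  note dh = smooth_on_differentiable[OF sh]
  have G1: "dir c (gauss_map S \<circ> p) v = dir c ?h v" if "v \<in> U" for c v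
    by (rule dir_cong_open[OF open_U that _ smooth_on_differentiable[OF sG that]]) (simp add: h)
  have G2: "dir c (dir c (gauss_map S \<circ> p)) u = dir c (dir c ?h) u" for c
    by (rule dir_cong_open[OF open_U assms(2) G1 smooth_on_differentiable[OF smooth_on_dir[OF sG] assms(2)]])
  have lh: "linear hodge" using bounded_linear_hodge by (rule bounded_linear.linear)
  have "laplacian S (gauss_map S) (p u) = lap ?a ?b (gauss_map S \<circ> p) u"
    unfolding laplacian_def Let_def frame_at_coords_def by (rule laplacian_eq[OF W sG])
  also have "\<dots> = hodge (lap ?a ?b (mu ?a ?b) u)"
    unfolding lap_def G1[OF assms(2)] G2 linear_diff[OF lh]
      dir_linear[OF bounded_linear_hodge smooth_on_differentiable[OF m assms(2)]]
      dir_dir_linear[OF open_U assms(2) bounded_linear_hodge m] ..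
  also have "\<dots> = norm_h_sq S (p u) *\<^sub>R gauss_map S (p u) - 4 *\<^sub>R hodge (wedge (II ?a ?a u) (II ?a ?b u))"
    unfolding lap_mu[OF assms on(1)] linear_diff[OF lh] linear_scale[OF lh] norm_h_sq_eq[OF assms(2)] h(2)[OF assms(2)] ..
  finally show ?thesis .
qed

text \<open>After removal of the star, the eigenvalue equation equates a multiple of the tangent
  bivector with a bivector built from normal vectors. Contraction with a tangent vector annihilates
  the latter, so both sides vanish.\<close>

lemma wedge_eq_0_if_eigen:
  assumes "maximal" "u \<in> U" "laplacian S (gauss_map S) (p u) = f *\<^sub>R gauss_map S (p u)"
  shows "wedge (II (frame_at_coords 1 u) (frame_at_coords 1 u) u) (II (frame_at_coords 1 u) (frame_at_coords 2 u) u) = 0"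
proof -
  let ?a = "frame_at_coords 1 u" and ?b = "frame_at_coords 2 u"
  let ?w = "wedge (II ?a ?a u) (II ?a ?b u)" and ?k = "norm_h_sq S (p u) - f"
  note on = frame_at_coords_orthonormal[OF assms(2)]
  have o: "mink (dir ?a \<phi> u) (dir ?a \<phi> u) = 1" "mink (dir ?b \<phi> u) (dir ?b \<phi> u) = 1" "mink (dir ?a \<phi> u) (dir ?b \<phi> u) = 0"
    using on(1) by (simp_all add: orthonormal_def g_def)
  have lh: "linear hodge" using bounded_linear_hodge by (rule bounded_linear.linear)
  have g: "gauss_map S (p u) = hodge (wedge (dir ?a \<phi> u) (dir ?b \<phi> u))"
    unfolding gauss_map_eq[OF assms(2)] mu_area_pos[OF assms(2) on(2), symmetric] mu_orthonormal[OF on(1)] ..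
  have "hodge (?k *\<^sub>R wedge (dir ?a \<phi> u) (dir ?b \<phi> u)) = hodge (4 *\<^sub>R ?w)"
    using assms(3) unfolding laplacian_gauss_map_eq[OF assms(1,2)] g linear_scale[OF lh]
    by (simp add: algebra_simps)
  then have "hodge (hodge (?k *\<^sub>R wedge (dir ?a \<phi> u) (dir ?b \<phi> u))) = hodge (hodge (4 *\<^sub>R ?w))" by simp
  then have e: "?k *\<^sub>R wedge (dir ?a \<phi> u) (dir ?b \<phi> u) = 4 *\<^sub>R ?w"
    unfolding linear_scale[OF lh] hodge_hodge[OF wedge_antisym] by simp
  have "contract (?k *\<^sub>R wedge (dir ?a \<phi> u) (dir ?b \<phi> u)) (dir ?b \<phi> u) = ?k *\<^sub>R dir ?a \<phi> u"
    unfolding linear_scale[OF linear_contract(1)] contract_wedge by (simp add: o)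
  moreover have "contract (4 *\<^sub>R ?w) (dir ?b \<phi> u) = 0"
    unfolding linear_scale[OF linear_contract(1)] contract_wedge by (simp add: II_def normal_orth[OF assms(2)])
  ultimately have "?k *\<^sub>R dir ?a \<phi> u = 0" unfolding e by simp
  moreover have "dir ?a \<phi> u \<noteq> 0" using o(1) by (auto simp: mink_simps)
  ultimately have "?k = 0" by simp
  then show ?thesis using e by simp
qed

lemma normal_curvature_frame:
  assumes "maximal" "u \<in> U" "openin (surf_top S) W" "tangent_field_on S W X" "tangent_field_on S W Y"
    "normal_field_on S W \<xi>" "u \<in> chart_dom W" "orthonormal a b u"
  shows "normal_curvature S X Y \<xi> (p u) =
    (2 * (g (field_coords X u) a u * g (field_coords Y u) b u - g (field_coords X u) b u * g (field_coords Y u) a u)) *\<^sub>R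
        contract (wedge (II a a u) (II a b u)) (\<xi> (p u))"
proof -
  have sx: "smooth_on (chart_dom W) (\<xi> \<circ> p)"
    by (rule smooth_map_on_chart_dom) (use assms(6) in \<open>simp add: normal_field_on_def\<close>)
  have n: "mink ((\<xi> \<circ> p) v) (dir x \<phi> v) = 0" if "v \<in> chart_dom W" for v x
    using assms(6) chart_dom_subset(3)[OF that] normal_space_chart[OF in_atlas chart_dom_subset(2)[OF that]]
    by (auto simp: normal_field_on_def)
  show ?thesis
    unfolding normal_curvature_eq[OF assms(3,4,5,6,7)]
    using normal_curvature_formula[OF assms(1) open_chart_dom[OF assms(3)] chart_dom_subset(1) assms(7,8) sx n
        tangent_field_coords(1)[OF assms(3,4)] tangent_field_coords(1)[OF assms(3,5)]]
    by (simp add: o_def)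
qed

text \<open>The curvature of the pair \<open>e 1\<close>, \<open>e 2\<close> applied to
  \<open>e 3\<close> and \<open>e 4\<close> shows that the contractions with these normals vanish.
  Those with tangent vectors vanish because the factors are normal, and a bivector with all
  contractions zero is zero.\<close>

lemma wedge_eq_0_if_flat:
  assumes "maximal" "u \<in> U" "flat_normal_bundle S"
  shows "wedge (II (frame_at_coords 1 u) (frame_at_coords 1 u) u) (II (frame_at_coords 1 u) (frame_at_coords 2 u) u) = 0"
proof -
  obtain W where W: "openin (surf_top S) W" "oriented_frame_on S W (frame_at S (p u))" "u \<in> chart_dom W"
    using frame_at_chart[OF assms(2)] .
  let ?e = "frame_at S (p u)" and ?B = "wedge (II (frame_at_coords 1 u) (frame_at_coords 1 u) u) (II (frame_at_coords 1 u) (frame_at_coords 2 u) u)"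
  have t: "tangent_field_on S W (?e 1)" "tangent_field_on S W (?e 2)" "normal_field_on S W (?e 3)" "normal_field_on S W (?e 4)"
    using W(2) by (auto simp: oriented_frame_on_def)
  note on = frame_at_coords_orthonormal[OF assms(2)]
  interpret f: mink_frame "\<lambda>a. ?e a (p u)" by (rule frame_facts(1)[OF W])
  have n: "contract ?B (\<xi> (p u)) = 0" if "normal_field_on S W \<xi>" for \<xi>
  proof -
    have "normal_curvature S (?e 1) (?e 2) \<xi> (p u) = 0"
      using assms(3) W(1) t(1,2) that chart_dom_subset(3)[OF W(3)] unfolding flat_normal_bundle_def by blast
    then show ?thesis
      using normal_curvature_frame[OF assms(1,2) W(1) t(1,2) that W(3) on(1)] on(1)
      unfolding frame_at_coords_def[symmetric] orthonormal_def by (simp add: g_commute[of "frame_at_coords 2 u" "frame_at_coords 1 u"])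
  qed
  have d: "?e 1 (p u) = dir (frame_at_coords 1 u) \<phi> u" "?e 2 (p u) = dir (frame_at_coords 2 u) \<phi> u"
    using tangent_field_coords(2)[OF W(1) t(1) W(3)] tangent_field_coords(2)[OF W(1) t(2) W(3)] by (simp_all add: frame_at_coords_def)
  have tz: "contract ?B (dir x \<phi> u) = 0" for x
    unfolding contract_wedge by (simp add: II_def normal_orth[OF assms(2)])
  have z: "contract ?B (?e b (p u)) = 0" for b
    using exhaust_4[of b] n[OF t(3)] n[OF t(4)] tz d by metis
  show ?thesis
    by (rule f.bivector_eq_0I[OF wedge_antisym]) (simp only: mink_contract[OF wedge_antisym, symmetric] z mink_simps)
qed

text \<open>The frame in \<open>norm_h_sq\<close> is chosen anew at each point, so smoothness is
  inherited from the frame-free expression \<open>sff_trace\<close>.\<close>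

lemma smooth_norm_h_sq: "smooth_on U (norm_h_sq S \<circ> p)"
proof (rule smooth_on_cong[OF open_U _ smooth_sff_trace])
  fix u assume u: "u \<in> U"
  show "sff_trace u = (norm_h_sq S \<circ> p) u"
    using sff_trace_eq[OF u frame_at_coords_orthonormal[OF u]] norm_h_sq_eq[OF u] by simp
qed

end

theorem theorem4p1:
  fixes S :: "'m surface"
  assumes "maximal_surface S"
  shows "(pointwise_1type_first_kind S \<longleftrightarrow> flat_normal_bundle S) \<and>
         (flat_normal_bundle S \<longrightarrow> pointwise_1type_with S (norm_h_sq S) 0)"
proof -
  interpret spacelike_surface S
    by unfold_locales (use assms in \<open>auto simp: maximal_surface_def\<close>)
  have H: "\<forall>x\<in>points S. mean_curvature_vector S x = 0" using assms by (simp add: maximal_surface_def)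
  have ch: "surface_chart S U p" if "(U, p) \<in> atlas S" for U p
    by unfold_locales (rule that)
  \<comment> \<open>For any \<open>f\<close>, the equation at a single point already annihilates the
    bivector that governs the normal curvature at that point.\<close>
  have 1: "flat_normal_bundle S" if "pointwise_1type_with S f 0" for f
    unfolding flat_normal_bundle_def
  proof (intro allI impI ballI)
    fix W X Y \<xi> x
    assume W: "openin (surf_top S) W" "tangent_field_on S W X" "tangent_field_on S W Y" "normal_field_on S W \<xi>" "x \<in> W"
    then have x: "x \<in> points S" using openin_subset by blast
    obtain U p u where c: "(U, p) \<in> atlas S" "u \<in> U" "p u = x" using chart_exists[OF x] .
    interpret c: surface_chart S U p by (rule ch[OF c(1)])
    note m = c.maximal_chart[OF H]
    have "laplacian S (gauss_map S) (p u) = f (p u) *\<^sub>R gauss_map S (p u)"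
      using that x c(3) by (simp add: pointwise_1type_with_def)
    note z = c.wedge_eq_0_if_eigen[OF m c(2) this]
    have u: "u \<in> c.chart_dom W" using c(2,3) W(5) by (simp add: c.chart_dom_def)
    show "normal_curvature S X Y \<xi> x = 0"
      using c.normal_curvature_frame[OF m c(2) W(1-4) u c.frame_at_coords_orthonormal(1)[OF c(2)]] c(3)
      unfolding z linear_0[OF linear_contract(1)] by simp
  qed
  \<comment> \<open>The squared norm of h is also the witness for the remaining direction of the
    equivalence.\<close>
  have 2: "pointwise_1type_with S (norm_h_sq S) 0" if flat: "flat_normal_bundle S"
    unfolding pointwise_1type_with_def
  proof (intro conjI ballI)
    show "smooth_map_on S (points S) (norm_h_sq S)"
      unfolding smooth_map_on_def
    proof clarify
      fix U p assume c: "(U, p) \<in> atlas S"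
      interpret c: surface_chart S U p by (rule ch[OF c])
      have "{u \<in> U. p u \<in> points S} = U" using chart_facts(6)[OF c] by auto
      then show "smooth_on {u \<in> U. p u \<in> points S} (norm_h_sq S \<circ> p)" using c.smooth_norm_h_sq by simp
    qed
    show "0 \<in> bivectors" by (simp add: bivectors_def transpose_def vec_eq_iff)
    fix x assume x: "x \<in> points S"
    obtain U p u where c: "(U, p) \<in> atlas S" "u \<in> U" "p u = x" using chart_exists[OF x] .
    interpret c: surface_chart S U p by (rule ch[OF c(1)])
    note m = c.maximal_chart[OF H]
    show "laplacian S (gauss_map S) x = norm_h_sq S x *\<^sub>R (gauss_map S x + 0)"
      using c.laplacian_gauss_map_eq[OF m c(2)] bounded_linear.linear[OF bounded_linear_hodge, THEN linear_0]
      unfolding c.wedge_eq_0_if_flat[OF m c(2) flat] c(3) by simp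
  qed
  show ?thesis using 1 2 unfolding pointwise_1type_first_kind_def by blast
qed

end
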